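(* Consider the two-user real Gaussian MIMO interference channel with channel matrices $H_1,H_2,H_3,H_4$ and power constraints $P_1,P_2$ (see context), where $H_1$ and $H_4$ are square and invertible. For symmetric positive semidefinite $S_1,S_2$ define $$A_1=(I+H_2S_2H_2^T)H_1^{-T}H_3^T,\qquad A_2=(I+H_3S_1H_3^T)H_4^{-T}H_2^T .$$ Suppose that for all symmetric positive semidefinite $S_1,S_2$ with $\mathrm{tr}(S_1)\le P_1$ and $\mathrm{tr}(S_2)\le P_2$ there exist symmetric positive definite matrices $\Sigma_1,\Sigma_2$ such that $$\Sigma_1\preceq I-A_2\Sigma_2^{-1}A_2^T\qquad\text{and}\qquad \Sigma_2\preceq I-A_1\Sigma_1^{-1}A_1^T .$$ Then the sum-rate capacity of the channel is achieved by treating interference as noise at both receivers; that is, the sum-rate capacity equals $$\max_{\substack{S_1\succeq 0,\ \mathrm{tr}(S_1)\le P_1\\ S_2\succeq 0,\ \mathrm{tr}(S_2)\le P_2}}\ \tfrac12\log\left|I+H_1S_1H_1^T(I+H_2S_2H_2^T)^{-1}\right|+\tfrac12\log\left|I+H_4S_2H_4^T(I+H_3S_1H_3^T)^{-1}\right| .$$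
   Context: Channel: at each use, $y_1=H_1x_1+H_2x_2+z_1$ and $y_2=H_3x_1+H_4x_2+z_2$, where $x_i$ is the real vector sent by transmitter $i$, $y_i$ is the vector seen by receiver $i$, the $H_j$ are fixed real matrices of compatible sizes known to all, and $z_1,z_2$ are Gaussian vectors with zero mean and identity covariance, independent of the inputs and i.i.d. over channel uses. A length-$n$ code with rates $(R_1,R_2)$: independent messages $m_i$ uniform on a set of size $\lceil e^{nR_i}\rceil$; transmitter $i$ maps $m_i$ to $(x_{i,1},\dots,x_{i,n})$ subject to the average power constraint $\frac1n\sum_{j=1}^nE\|x_{i,j}\|^2\le P_i$; receiver $i$ estimates $m_i$ from $(y_{i,1},\dots,y_{i,n})$ only. A pair of nonnegative rates is achievable if there are codes with error probabilities at both receivers tending to $0$ as $n\to\infty$; the capacity region is the closure of the set of achievable pairs; the sum-rate capacity is the supremum of $R_1+R_2$ over it. "Treating interference as noise" means each receiver decodes only its own message, regarding the other user's (Gaussian) signal as additional Gaussian noise. Notation: $|X|$ of a matrix is its determinant; $X^{-T}=(X^{-1})^T$; $\log$ is natural; $A\succeq B$ (equivalently $B\preceq A$) means $A-B$ is positive semidefinite. *)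

theory Defs
  imports "HOL-Probability.Probability"
begin

section \<open>The Loewner order\<close>

definition psd :: "real^'n^'n \<Rightarrow> bool" where
  "psd A \<longleftrightarrow> transpose A = A \<and> (\<forall>x. 0 \<le> x \<bullet> (A *v x))"

definition posdef :: "real^'n^'n \<Rightarrow> bool" where
  "posdef A \<longleftrightarrow> transpose A = A \<and> (\<forall>x. x \<noteq> 0 \<longrightarrow> 0 < x \<bullet> (A *v x))"

definition loewner_le :: "real^'n^'n \<Rightarrow> real^'n^'n \<Rightarrow> bool"  (infix "\<preceq>\<^sub>L" 50) where
  "A \<preceq>\<^sub>L B \<longleftrightarrow> psd (B - A)"


section \<open>Operational model of the two-user Gaussian MIMO interference channel\<close>

definition std_gaussian_vec :: "(real^'r) measure" where
  "std_gaussian_vec = density lborel (\<lambda>z. ennreal (\<Prod>i\<in>UNIV. std_normal_density (z $ i)))"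

definition noise_block :: "nat \<Rightarrow> (nat \<Rightarrow> real^'r) measure" where
  "noise_block n = (\<Pi>\<^sub>M j\<in>{..<n}. std_gaussian_vec)"

definition num_messages :: "nat \<Rightarrow> real \<Rightarrow> nat" where
  "num_messages n R = nat \<lceil>exp (real n * R)\<rceil>"

text \<open>
  Messages are the numbers below \<open>M\<close>.  An encoder \<open>enc\<close> maps a message \<open>m\<close> to the
  codeword whose \<open>j\<close>-th vector is \<open>enc m j\<close>, where channel uses are numbered from \<open>0\<close>;
  only the values at \<open>m < M\<close> and \<open>j < n\<close> matter.
\<close>

definition power_constraint ::
  "nat \<Rightarrow> nat \<Rightarrow> real \<Rightarrow> (nat \<Rightarrow> nat \<Rightarrow> real^'t) \<Rightarrow> bool" where
  "power_constraint n M P enc \<longleftrightarrow>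
     (1 / real n) * (\<Sum>j<n. measure_pmf.expectation (pmf_of_set {..<M}) (\<lambda>m. (norm (enc m j))\<^sup>2)) \<le> P"

definition decoder :: "nat \<Rightarrow> nat \<Rightarrow> ((nat \<Rightarrow> real^'r) \<Rightarrow> nat) \<Rightarrow> bool" where
  "decoder n M dec \<longleftrightarrow> dec \<in> (\<Pi>\<^sub>M j\<in>{..<n}. borel) \<rightarrow>\<^sub>M count_space {..<M}"

definition received ::
  "nat \<Rightarrow> real^'t^'r \<Rightarrow> real^'s^'r \<Rightarrow> (nat \<Rightarrow> real^'t) \<Rightarrow> (nat \<Rightarrow> real^'s) \<Rightarrow> (nat \<Rightarrow> real^'r)
     \<Rightarrow> (nat \<Rightarrow> real^'r)" where
  "received n G K x w z = (\<lambda>j\<in>{..<n}. G *v x j + K *v w j + z j)"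

text \<open>
  Error probability at one receiver: \<open>G\<close>, \<open>M\<close>, \<open>enc\<close> belong to the user to be decoded,
  \<open>K\<close>, \<open>N\<close>, \<open>enc'\<close> to the interfering one.  It depends only on the noise at that
  receiver, so no joint law of the two noise processes has to be specified.
\<close>

definition error_prob ::
  "nat \<Rightarrow> nat \<Rightarrow> nat \<Rightarrow> real^'t^'r \<Rightarrow> real^'s^'r \<Rightarrow> (nat \<Rightarrow> nat \<Rightarrow> real^'t) \<Rightarrow>
     (nat \<Rightarrow> nat \<Rightarrow> real^'s) \<Rightarrow> ((nat \<Rightarrow> real^'r) \<Rightarrow> nat) \<Rightarrow> real" where
  "error_prob n M N G K enc enc' dec =
     (let \<Omega> = measure_pmf (pair_pmf (pmf_of_set {..<M}) (pmf_of_set {..<N})) \<Otimes>\<^sub>M noise_block n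
      in measure \<Omega> {((m, l), z) \<in> space \<Omega>. dec (received n G K (enc m) (enc' l) z) \<noteq> m})"

definition achievable ::
  "real^'t1^'r1 \<Rightarrow> real^'t2^'r1 \<Rightarrow> real^'t1^'r2 \<Rightarrow> real^'t2^'r2 \<Rightarrow> real \<Rightarrow> real \<Rightarrow> real \<Rightarrow> real \<Rightarrow> bool" where
  "achievable H1 H2 H3 H4 P1 P2 R1 R2 \<longleftrightarrow> 0 \<le> R1 \<and> 0 \<le> R2 \<and>
     (\<exists>(enc1 :: nat \<Rightarrow> nat \<Rightarrow> nat \<Rightarrow> real^'t1) (enc2 :: nat \<Rightarrow> nat \<Rightarrow> nat \<Rightarrow> real^'t2)
       (dec1 :: nat \<Rightarrow> (nat \<Rightarrow> real^'r1) \<Rightarrow> nat) (dec2 :: nat \<Rightarrow> (nat \<Rightarrow> real^'r2) \<Rightarrow> nat).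
       (\<forall>n>0. power_constraint n (num_messages n R1) P1 (enc1 n) \<and>
              power_constraint n (num_messages n R2) P2 (enc2 n) \<and>
              decoder n (num_messages n R1) (dec1 n) \<and>
              decoder n (num_messages n R2) (dec2 n)) \<and>
       (\<lambda>n. error_prob n (num_messages n R1) (num_messages n R2) H1 H2 (enc1 n) (enc2 n) (dec1 n))
         \<longlonglongrightarrow> 0 \<and>
       (\<lambda>n. error_prob n (num_messages n R2) (num_messages n R1) H4 H3 (enc2 n) (enc1 n) (dec2 n))
         \<longlonglongrightarrow> 0)"

definition capacity_region ::
  "real^'t1^'r1 \<Rightarrow> real^'t2^'r1 \<Rightarrow> real^'t1^'r2 \<Rightarrow> real^'t2^'r2 \<Rightarrow> real \<Rightarrow> real \<Rightarrow> (real \<times> real) set" where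
  "capacity_region H1 H2 H3 H4 P1 P2 = closure {(R1, R2). achievable H1 H2 H3 H4 P1 P2 R1 R2}"

text \<open>Extended-real valued, because the real supremum of an unbounded set is arbitrary.\<close>

definition sum_rate_capacity ::
  "real^'t1^'r1 \<Rightarrow> real^'t2^'r1 \<Rightarrow> real^'t1^'r2 \<Rightarrow> real^'t2^'r2 \<Rightarrow> real \<Rightarrow> real \<Rightarrow> ereal" where
  "sum_rate_capacity H1 H2 H3 H4 P1 P2 =
     (SUP (R1, R2)\<in>capacity_region H1 H2 H3 H4 P1 P2. ereal (R1 + R2))"


section \<open>Treating interference as noise\<close>

text \<open>
  Rate of a user with channel \<open>G\<close> and input covariance \<open>S\<close> whose interferer has channel \<open>K\<close>
  and Gaussian input of covariance \<open>T\<close>.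
\<close>

definition tin_rate :: "real^'t^'r \<Rightarrow> real^'s^'r \<Rightarrow> real^'t^'t \<Rightarrow> real^'s^'s \<Rightarrow> real" where
  "tin_rate G K S T =
     1/2 * ln (det (mat 1 + G ** S ** transpose G ** matrix_inv (mat 1 + K ** T ** transpose K)))"

definition tin_sum_rate ::
  "real^'t1^'r1 \<Rightarrow> real^'t2^'r1 \<Rightarrow> real^'t1^'r2 \<Rightarrow> real^'t2^'r2 \<Rightarrow> real^'t1^'t1 \<Rightarrow> real^'t2^'t2 \<Rightarrow> real" where
  "tin_sum_rate H1 H2 H3 H4 S1 S2 = tin_rate H1 H2 S1 S2 + tin_rate H4 H3 S2 S1"

definition feasible_cov :: "real \<Rightarrow> real^'t^'t \<Rightarrow> bool" where
  "feasible_cov P S \<longleftrightarrow> psd S \<and> trace S \<le> P"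

text \<open>
  With \<open>G\<close> the direct and \<open>K\<close> the cross channel into a receiver, and \<open>L\<close> the cross channel
  from the desired transmitter into the other receiver, this is the matrix
  \<open>(I + K T K\<^sup>T) G\<^sup>-\<^sup>T L\<^sup>T\<close>.
\<close>

definition genie_matrix :: "real^'t^'t \<Rightarrow> real^'s^'t \<Rightarrow> real^'t^'q \<Rightarrow> real^'s^'s \<Rightarrow> real^'q^'t" where
  "genie_matrix G K L T =
     (mat 1 + K ** T ** transpose K) ** transpose (matrix_inv G) ** transpose L"

end

theory Submission
  imports Defs
begin

text \<open>
  Converse.  The genie may depend on the code, so no optimality conditions on the maximizer are needed.
  After centering the codewords of user 1, let \<open>S\<^sub>1\<close>, \<open>S\<^sub>2\<close> be the empirical covariances of a code
  and take \<open>\<Sigma>\<^sub>1\<close>, \<open>\<Sigma>\<^sub>2\<close> for them.  Let \<open>w\<^sub>1 = H\<^sub>2 x\<^sub>2 + z\<^sub>1\<close> and let \<open>D\<close> be relative entropy to the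
  Gaussian that would arise from Gaussian inputs of covariances \<open>S\<^sub>1\<close>, \<open>S\<^sub>2\<close>.  Fano's inequality bounds
  \<open>n (R\<^sub>1 + R\<^sub>2)\<close> by \<open>n\<close> times the rate of treating interference as noise plus
  \<open>D(w\<^sub>1) - D(y\<^sub>1) + D(w\<^sub>2) - D(y\<^sub>2)\<close>.  Write \<open>z\<^sub>1 = A\<^sub>1 \<Sigma>\<^sub>1\<^sup>-\<^sup>1 n\<^sub>1 + z\<^sub>1'\<close> with independent \<open>n\<^sub>1 \<sim> N(0, \<Sigma>\<^sub>1)\<close>
  and \<open>z\<^sub>1'\<close>, and put \<open>s\<^sub>1 = H\<^sub>3 x\<^sub>1 + n\<^sub>1\<close>, \<open>t\<^sub>1 = H\<^sub>2 x\<^sub>2 + z\<^sub>1'\<close>.  The form of \<open>A\<^sub>1\<close> makes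
  \<open>x\<^sub>1 - y\<^sub>1 - s\<^sub>1\<close> a Markov chain for Gaussian inputs, which yields \<open>D(w\<^sub>1) + D(s\<^sub>1) \<le> D(y\<^sub>1) + D(t\<^sub>1)\<close>.
  By hypothesis the covariance of \<open>z\<^sub>1'\<close> dominates \<open>\<Sigma>\<^sub>2\<close>, so \<open>t\<^sub>1\<close> is a noisier version of
  \<open>s\<^sub>2 = H\<^sub>2 x\<^sub>2 + n\<^sub>2\<close> and \<open>D(t\<^sub>1) \<le> D(s\<^sub>2)\<close>.  Adding the same for user 2, everything cancels.

  Achievability.  Gaussian random codebooks of covariance \<open>(1 - \<delta>) S\<^sub>i\<close> with threshold decoding of the
  information density; averaged over the codebook of the interferer, the interference is i.i.d. Gaussian.
\<close>



text \<open>A codebook is finite, so every signal in the converse has as its law a finite mixture of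
  translates of one Gaussian block law. Its density is positive with integrable logarithm, and each
  comparison of entropies becomes \<open>ln r \<le> r - 1\<close> for an explicit quotient
  \<open>r\<close>.

  The reference Gaussians have mean zero and the second moments of the code; only then are the
  expected logarithms of their densities exact Gaussian entropies. For a received signal this
  requires that the cross moment of the two inputs vanish at every channel use, which is why one
  user is centered.

  The Markov property is one identity: with
  \<open>C = A\<^sub>1 \<Sigma>\<^sub>1\<^sup>-\<^sup>1\<close>, the matrix \<open>\<Sigma>\<^sub>1
  C\<^sup>T (I + H\<^sub>2 S\<^sub>2 H\<^sub>2\<^sup>T)\<^sup>-\<^sup>1\<close> that estimates
  \<open>n\<^sub>1\<close> from \<open>w\<^sub>1\<close> equals
  \<open>H\<^sub>3 H\<^sub>1\<^sup>-\<^sup>1\<close>, so it carries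
  \<open>H\<^sub>1 x\<^sub>1\<close> to \<open>H\<^sub>3 x\<^sub>1\<close>.

  In achievability the power constraint binds each code, not the average over the ensemble. The
  factor \<open>1 - \<delta>\<close> makes it hold with a probability bounded below uniformly in
  \<open>n\<close>, while the mean error tends to zero; demanding both costs a constant factor
  only.\<close>

section \<open>Matrices and the Loewner order\<close>

text \<open>Keeps \<open>transpose A *v x\<close> from being rewritten to \<open>x v* A\<close>;
  adjoints stay in the form that \<open>inner_matrix_vector_left\<close> produces.\<close>

declare transpose_matrix_vector [simp del]

lemma inner_matrix_vector_left: "(A *v x) \<bullet> y = x \<bullet> (transpose A *v y)"
  for A :: "real^'n^'m"
  by (metis dot_lmul_matrix inner_commute transpose_matrix_vector)

lemma transpose_add: "transpose (A + B) = transpose A + transpose B"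
  by (simp add: transpose_def vec_eq_iff)


lemma matrix_diff_ldistrib: "A ** (B - C) = A ** B - A ** C"
  for A :: "real^'n^'m"
  by (vector matrix_matrix_mult_def sum_subtractf[symmetric] field_simps)

lemma matrix_diff_rdistrib: "(B - C) ** A = B ** A - C ** A"
  for A :: "real^'n^'m"
  by (vector matrix_matrix_mult_def sum_subtractf[symmetric] field_simps)

lemma matrix_add_rdistrib': "(B + C) ** A = B ** A + C ** A"
  for A :: "real^'n^'m"
  by (vector matrix_matrix_mult_def sum.distrib[symmetric] field_simps)

lemmas matrix_distribs = matrix_diff_ldistrib matrix_diff_rdistrib matrix_add_rdistrib' matrix_add_ldistrib


lemma
  assumes "invertible A"
  shows matrix_inv_right': "A ** matrix_inv A = mat 1"
    and matrix_inv_left': "matrix_inv A ** A = mat 1"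
  using assms someI_ex[of "\<lambda>A'. A ** A' = mat 1 \<and> A' ** A = mat 1"]
  unfolding invertible_def matrix_inv_def by auto

lemma matrix_inv_eqI: "A ** B = mat 1 \<Longrightarrow> matrix_inv A = B" for A :: "real^'n^'n"
  by (metis invertible_right_inverse matrix_inv_left' matrix_mul_assoc matrix_mul_lid matrix_mul_rid)

lemma transpose_matrix_inv: "invertible A \<Longrightarrow> transpose (matrix_inv A) = matrix_inv (transpose A)"
  for A :: "real^'n^'n"
  by (metis matrix_inv_eqI matrix_inv_left' matrix_transpose_mul transpose_mat)


section \<open>Positive semidefinite and positive definite matrices\<close>

lemma posdef_imp_psd: "posdef A \<Longrightarrow> psd A"
  unfolding posdef_def psd_def by (metis inner_zero_left less_eq_real_def matrix_vector_mult_0_right)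

lemma posdef_sym: "posdef A \<Longrightarrow> transpose A = A"
  by (simp add: posdef_def)

lemma psd_sym: "psd A \<Longrightarrow> transpose A = A"
  by (simp add: psd_def)

lemma posdef_mat_1: "posdef (mat 1)"
  by (simp add: posdef_def)

lemma psd_0: "psd 0"
  by (simp add: psd_def transpose_def vec_eq_iff)

lemma posdef_add_psd: "posdef A \<Longrightarrow> psd B \<Longrightarrow> posdef (A + B)"
  unfolding posdef_def psd_def
  by (auto simp: transpose_add matrix_vector_mult_add_rdistrib inner_add_right add_pos_nonneg)

lemma psd_add: "psd A \<Longrightarrow> psd B \<Longrightarrow> psd (A + B)"
  unfolding psd_def
  by (auto simp: transpose_add matrix_vector_mult_add_rdistrib inner_add_right)

lemma psd_scaleR: "psd A \<Longrightarrow> 0 \<le> c \<Longrightarrow> psd (c *\<^sub>R A)"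
  unfolding psd_def by (auto simp: transpose_scalar scaleR_matrix_vector_assoc[symmetric])

lemma psd_congruence: "psd S \<Longrightarrow> psd (C ** S ** transpose C)" for C :: "real^'n^'m"
  unfolding psd_def
proof safe
  assume *: "transpose S = S" "\<forall>x. 0 \<le> x \<bullet> (S *v x)"
  show "transpose (C ** S ** transpose C) = C ** S ** transpose C"
    by (simp add: matrix_transpose_mul * matrix_mul_assoc)
  fix x
  have "x \<bullet> (C ** S ** transpose C *v x) = (transpose C *v x) \<bullet> (S *v (transpose C *v x))"
    by (simp add: inner_matrix_vector_left matrix_vector_mul_assoc matrix_mul_assoc)
  then show "0 \<le> x \<bullet> (C ** S ** transpose C *v x)" using * by simp
qed

lemma psd_mult_transpose: "psd (L ** transpose L)" for L :: "real^'n^'m"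
  using psd_congruence[OF posdef_imp_psd[OF posdef_mat_1], of L] by simp

lemma posdef_le: "posdef A \<Longrightarrow> A \<preceq>\<^sub>L B \<Longrightarrow> posdef B"
  unfolding loewner_le_def using posdef_add_psd[of A "B - A"] by simp

lemma posdef_invertible: "posdef A \<Longrightarrow> invertible A" for A :: "real^'n^'n"
  unfolding invertible_left_inverse matrix_left_invertible_ker posdef_def
  by (metis inner_zero_right less_irrefl)

lemma posdef_inv_sym: "posdef A \<Longrightarrow> transpose (matrix_inv A) = matrix_inv A" for A :: "real^'n^'n"
  by (simp add: posdef_invertible transpose_matrix_inv posdef_sym)

lemma posdef_matrix_inv: "posdef A \<Longrightarrow> posdef (matrix_inv A)" for A :: "real^'n^'n"
  unfolding posdef_def[of "matrix_inv A"]
proof safe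
  assume A: "posdef A"
  then show "transpose (matrix_inv A) = matrix_inv A" by (rule posdef_inv_sym)
  fix x :: "real^'n" assume x: "x \<noteq> 0"
  define y where "y = matrix_inv A *v x"
  have Ay: "A *v y = x"
    by (simp add: y_def matrix_vector_mul_assoc matrix_inv_right' posdef_invertible A)
  then have "y \<noteq> 0" using x by auto
  then have "0 < y \<bullet> (A *v y)" using A by (simp add: posdef_def)
  then show "0 < x \<bullet> (matrix_inv A *v x)" by (simp add: Ay inner_commute flip: y_def)
qed

lemma psd_diag_nonneg: "psd S \<Longrightarrow> 0 \<le> S $ i $ i" for S :: "real^'n^'n"
  unfolding psd_def
  by (auto dest!: spec[of _ "axis i 1"] simp: matrix_vector_mul_component inner_axis inner_axis')

lemma sym_inner_axis: "(S *v axis i 1) $ j = S $ j $ i" for S :: "real^'n^'n"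
  by (simp add: matrix_vector_mul_component inner_axis)

text \<open>The quadratic form at \<open>x + t *\<^sub>R y\<close> is a polynomial in
  \<open>t\<close> that is never negative; a suitable \<open>t\<close> yields the bound, also for a
  degenerate form.\<close>

lemma psd_cauchy_schwarz:
  fixes S :: "real^'n^'n"
  assumes "psd S"
  shows "(x \<bullet> (S *v y))\<^sup>2 \<le> (x \<bullet> (S *v x)) * (y \<bullet> (S *v y))"
proof -
  define a b c where "a = x \<bullet> (S *v x)" "b = x \<bullet> (S *v y)" "c = y \<bullet> (S *v y)"
  have yx: "y \<bullet> (S *v x) = b"
    using assms unfolding a_b_c_def by (metis psd_sym inner_commute inner_matrix_vector_left)
  have q: "0 \<le> a + 2 * t * b + t\<^sup>2 * c" for t
  proof -
    have "0 \<le> (x + t *\<^sub>R y) \<bullet> (S *v (x + t *\<^sub>R y))"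
      using assms by (simp add: psd_def)
    also have "\<dots> = a + 2 * t * b + t\<^sup>2 * c"
      using yx unfolding a_b_c_def
      by (simp add: algebra_simps inner_add_left inner_add_right power2_eq_square matrix_vector_right_distrib)
    finally show ?thesis .
  qed
  have c: "0 \<le> c" using assms by (simp add: a_b_c_def psd_def)
  have "b\<^sup>2 \<le> a * c"
  proof (cases "c = 0")
    case True
    have "b = 0"
    proof (rule ccontr)
      assume "b \<noteq> 0"
      \<comment> \<open>For \<open>c = 0\<close> the polynomial is affine in \<open>t\<close>, and
        at this point it takes the value -1.\<close>
      with q[of "- (a + 1) / (2 * b)"] True show False by (simp add: field_simps)
    qed
    then show ?thesis using True by simp
  next
    case False
    with c have "0 < c" by simp
    with q[of "- b / c"] show ?thesis by (simp add: field_simps power2_eq_square)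
  qed
  then show ?thesis by (simp add: a_b_c_def)
qed

lemma psd_entry_le:
  fixes S :: "real^'n^'n"
  assumes "psd S"
  shows "(S $ i $ j)\<^sup>2 \<le> S $ i $ i * S $ j $ j"
  using psd_cauchy_schwarz[OF assms, of "axis i 1" "axis j 1"]
  by (simp add: inner_axis' sym_inner_axis)

text \<open>Symmetric Gaussian elimination: column \<open>k\<close> of the factor clears row \<open>k\<close> of the remainder.\<close>

lemma psd_eliminate:
  fixes S :: "real^'n^'n"
  assumes "psd S" "finite K"
  shows "\<exists>u. psd (S - (\<chi> i j. \<Sum>k\<in>K. u k $ i * u k $ j)) \<and>
             (\<forall>k\<in>K. \<forall>j. (S - (\<chi> i j. \<Sum>k\<in>K. u k $ i * u k $ j)) $ k $ j = 0)"
  using assms(2)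
proof induction
  case empty
  have "(\<chi> i j. 0) = (0 :: real^'n^'n)" by (simp add: vec_eq_iff)
  then show ?case using assms(1) by simp
next
  case (insert k K)
  then obtain u where u: "psd (S - (\<chi> i j. \<Sum>k\<in>K. u k $ i * u k $ j))"
     "\<And>k j. k\<in>K \<Longrightarrow> (S - (\<chi> i j. \<Sum>k\<in>K. u k $ i * u k $ j)) $ k $ j = 0" by blast
  define T where "T = S - (\<chi> i j. \<Sum>k\<in>K. u k $ i * u k $ j)"
  have T: "psd T" "\<And>l j. l \<in> K \<Longrightarrow> T $ l $ j = 0" using u by (auto simp: T_def)
  have symT: "T $ i $ j = T $ j $ i" for i j
    using psd_sym[OF T(1)] by (metis transpose_def vec_lambda_beta)
  \<comment> \<open>Column \<open>k\<close> of the remainder, scaled by the root of the pivot. If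
    the pivot \<open>T$k$k\<close> is zero, division by zero makes \<open>v = 0\<close>, and row
    \<open>k\<close> has vanished already by \<open>psd_entry_le\<close>. Rows cleared before stay
    cleared, because \<open>v\<close> is zero there.\<close>
  define v where "v = (1 / sqrt (T$k$k)) *\<^sub>R (T *v axis k 1)"
  define T' where "T' = T - (\<chi> i j. v $ i * v $ j)"
  have v: "v $ i = T$i$k / sqrt (T$k$k)" for i
    by (simp add: v_def sym_inner_axis)
  have vv: "v $ i * v $ j = T$i$k * T$j$k / T$k$k" for i j
    using psd_diag_nonneg[OF T(1), of k] by (simp add: v flip: times_divide_times_eq real_sqrt_mult)
  have T'1: "psd T'"
    unfolding psd_def
  proof safe
    show "transpose T' = T'"
      by (simp add: T'_def transpose_def vec_eq_iff symT mult.commute)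
    fix x
    have *: "x \<bullet> ((\<chi> i j. v $ i * v $ j) *v x) = (x \<bullet> v)\<^sup>2"
      by (simp add: inner_vec_def matrix_vector_mult_def power2_eq_square sum_product sum_distrib_left mult_ac)
    \<comment> \<open>What is split off never exceeds the form of \<open>T\<close>: this is
      Cauchy-Schwarz against \<open>axis k 1\<close>.\<close>
    have "(x \<bullet> v)\<^sup>2 = (x \<bullet> (T *v axis k 1))\<^sup>2 / T$k$k"
      using psd_diag_nonneg[OF T(1), of k] by (simp add: v_def power_divide)
    also have "\<dots> \<le> x \<bullet> (T *v x)"
    proof (cases "T$k$k = 0")
      case True then show ?thesis using T(1) by (simp add: psd_def)
    next
      case False
      then have "0 < T$k$k" using psd_diag_nonneg[OF T(1), of k] by simp
      moreover have "(x \<bullet> (T *v axis k 1))\<^sup>2 \<le> (x \<bullet> (T *v x)) * T$k$k"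
        using psd_cauchy_schwarz[OF T(1), of x "axis k 1"] by (simp add: inner_axis' sym_inner_axis)
      ultimately show ?thesis by (simp add: field_simps)
    qed
    finally show "0 \<le> x \<bullet> (T' *v x)"
      by (simp add: T'_def matrix_vector_mult_diff_rdistrib inner_diff_right *)
  qed
  have Tkk: "T$k$k = 0 \<Longrightarrow> T$k$j = 0" for j
    using psd_entry_le[OF T(1), of k j] by simp
  have T'2: "T' $ l $ j = 0" if "l \<in> insert k K" for l j
    using that by (auto simp: T'_def vv T(2) Tkk symT[of j k])
  have "T' = S - (\<chi> i j. \<Sum>l\<in>insert k K. (u(k:=v)) l $ i * (u(k:=v)) l $ j)"
  proof -
    have "(\<Sum>l\<in>K. (u(k:=v)) l $ i * (u(k:=v)) l $ j) = (\<Sum>l\<in>K. u l $ i * u l $ j)" for i j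
      using insert.hyps by (intro sum.cong) auto
    then show ?thesis using insert.hyps
      by (simp add: T'_def T_def vec_eq_iff)
  qed
  with T'1 T'2 show ?case by (intro exI[of _ "u(k := v)"]) simp
qed

text \<open>Once all rows are cleared the remainder is zero, and the vectors split off are the
  columns of the factor.\<close>

lemma psd_factor:
  fixes S :: "real^'n^'n"
  assumes "psd S"
  obtains L :: "real^'n^'n" where "S = L ** transpose L"
proof -
  obtain u :: "'n \<Rightarrow> real^'n" where "\<forall>k\<in>UNIV. \<forall>j. (S - (\<chi> i j. \<Sum>k\<in>UNIV. u k $ i * u k $ j)) $ k $ j = 0"
    using psd_eliminate[OF assms finite, of UNIV] by (elim exE conjE) (rule that)
  then have u: "S = (\<chi> i j. \<Sum>k\<in>UNIV. u k $ i * u k $ j)" by (simp add: vec_eq_iff)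
  have "S = (\<chi> i k. u k $ i) ** transpose (\<chi> i k. u k $ i)"
    by (subst u) (simp add: vec_eq_iff matrix_matrix_mult_def transpose_def)
  then show ?thesis by (rule that)
qed

lemma posdef_factor:
  fixes S :: "real^'n^'n"
  assumes "posdef S"
  obtains L :: "real^'n^'n" where "S = L ** transpose L" "invertible L" "\<bar>det L\<bar> = sqrt (det S)"
proof -
  obtain L :: "real^'n^'n" where L: "S = L ** transpose L"
    using psd_factor posdef_imp_psd assms by blast
  have "det S \<noteq> 0" using posdef_invertible[OF assms] by (simp add: invertible_det_nz)
  moreover have d: "det S = (det L)\<^sup>2" by (simp add: L det_mul power2_eq_square)
  ultimately have "invertible L" by (simp add: invertible_det_nz)
  with L d show ?thesis by (intro that) auto
qed

lemma posdef_det_pos: "posdef S \<Longrightarrow> 0 < det S" for S :: "real^'n^'n"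
  by (metis posdef_factor invertible_det_nz abs_ge_zero less_eq_real_def real_sqrt_eq_zero_cancel_iff
      posdef_invertible real_sqrt_gt_0_iff)


section \<open>Gaussian densities\<close>

lemma borel_measurable_vec_lambda [measurable (raw)]:
  fixes f :: "'i::finite \<Rightarrow> 'b \<Rightarrow> real"
  assumes "\<And>i. f i \<in> borel_measurable M"
  shows "(\<lambda>x. \<chi> i. f i x) \<in> borel_measurable M"
  by (subst borel_measurable_euclidean_space) (auto simp: Basis_vec_def inner_axis assms)

text \<open>Lebesgue measure is a product over the coordinates. With the other coordinates fixed,
  the shear translates coordinate \<open>m\<close> by a constant, and one-dimensional Lebesgue
  measure is translation invariant.\<close>

lemma nn_integral_lborel_shear:
  fixes h :: "real^'n \<Rightarrow> ennreal" and m n :: 'n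
  assumes [measurable]: "h \<in> borel_measurable borel" and mn: "m \<noteq> n"
  shows "(\<integral>\<^sup>+x. h (\<chi> i. if i = m then x$m + x$n else x$i) \<partial>lborel) = (\<integral>\<^sup>+x. h x \<partial>lborel)"
proof -
  interpret product_sigma_finite "\<lambda>_::real^'n. lborel :: real measure" ..
  define B where "B = (Basis :: (real^'n) set) - {axis m 1}"
  have B: "finite B" "axis m 1 \<notin> B" and Basis: "Basis = insert (axis m 1) B"
    by (auto simp: B_def axis_in_Basis_iff)
  define E where "E f = (\<Sum>b\<in>Basis. f b *\<^sub>R b)" for f :: "real^'n \<Rightarrow> real"
  have comp: "E f $ i = f (axis i 1)" for f i
  proof -
    have "E f $ i = (\<Sum>b\<in>Basis. f b *\<^sub>R b) \<bullet> axis i 1" by (simp add: inner_axis E_def)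
    then show ?thesis by (simp add: inner_sum_left_Basis)
  qed
  have [measurable]: "E \<in> borel_measurable (\<Pi>\<^sub>M b\<in>insert (axis m 1) B. lborel)"
    unfolding E_def Basis[symmetric] by measurable
  have lE: "lborel = distr (\<Pi>\<^sub>M b\<in>insert (axis m 1) B. lborel) borel E"
    by (subst lborel_eq) (simp add: E_def[abs_def] flip: Basis)
  define g where "g x = h (\<chi> i. if i = m then x$m + x$n else x$i)" for x
  have [measurable]: "g \<in> borel_measurable borel" unfolding g_def by measurable
  have sh: "g (E (f(axis m 1 := y))) = h (E (f(axis m 1 := f (axis n 1) + y)))" for f y
    unfolding g_def using mn
    by (intro arg_cong[where f = h], subst vec_eq_iff) (simp add: comp axis_eq_axis add.commute)
  have "(\<integral>\<^sup>+x. g x \<partial>lborel) = (\<integral>\<^sup>+f. g (E f) \<partial>(\<Pi>\<^sub>M b\<in>insert (axis m 1) B. lborel))"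
    by (subst lE, subst nn_integral_distr) simp_all
  also have "\<dots> = (\<integral>\<^sup>+f. \<integral>\<^sup>+y. h (E (f(axis m 1 := f (axis n 1) + y))) \<partial>lborel \<partial>(\<Pi>\<^sub>M b\<in>B. lborel))"
    by (subst product_nn_integral_insert[OF B]) (simp_all add: sh)
  also have "\<dots> = (\<integral>\<^sup>+f. \<integral>\<^sup>+y. h (E (f(axis m 1 := y))) \<partial>lborel \<partial>(\<Pi>\<^sub>M b\<in>B. lborel))"
  proof (rule nn_integral_cong)
    fix f :: "real^'n \<Rightarrow> real" assume "f \<in> space (\<Pi>\<^sub>M b\<in>B. lborel)"
    then have [measurable]: "(\<lambda>y. h (E (f(axis m 1 := y)))) \<in> borel_measurable borel"
      unfolding E_def by (simp add: fun_upd_def)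
    show "(\<integral>\<^sup>+y. h (E (f(axis m 1 := f (axis n 1) + y))) \<partial>lborel) = (\<integral>\<^sup>+y. h (E (f(axis m 1 := y))) \<partial>lborel)"
      by (subst (2) lborel_distr_plus[of "f (axis n 1)", symmetric], subst nn_integral_distr) simp_all
  qed
  also have "\<dots> = (\<integral>\<^sup>+f. h (E f) \<partial>(\<Pi>\<^sub>M b\<in>insert (axis m 1) B. lborel))"
    by (subst product_nn_integral_insert[OF B]) simp_all
  also have "\<dots> = (\<integral>\<^sup>+x. h x \<partial>lborel)"
    by (subst lE, subst nn_integral_distr) simp_all
  finally show ?thesis by (simp add: g_def)
qed

lemma nn_integral_lborel_diagonal:
  fixes h :: "real^'n \<Rightarrow> ennreal"
  assumes [measurable]: "h \<in> borel_measurable borel" and c: "\<And>i. c i \<noteq> 0"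
  shows "ennreal \<bar>\<Prod>i\<in>UNIV. c i\<bar> * (\<integral>\<^sup>+x. h (\<chi> i. c i * x$i) \<partial>lborel) = (\<integral>\<^sup>+x. h x \<partial>lborel)"
proof -
  \<comment> \<open>The scale factors carried over from indices to basis vectors, as
    \<open>lborel_affine_euclidean\<close> expects them.\<close>
  define d :: "real^'n \<Rightarrow> real" where "d b = (\<Sum>i\<in>UNIV. c i * b $ i)" for b
  have d: "d (axis i 1) = c i" for i
    by (simp add: d_def axis_def if_distrib cong: if_cong)
  have T: "0 + (\<Sum>j\<in>Basis. (d j * (x \<bullet> j)) *\<^sub>R j) = (\<chi> i. c i * x$i)" for x :: "real^'n"
  proof -
    have "(\<Sum>j\<in>Basis. (d j * (x \<bullet> j)) *\<^sub>R j) \<bullet> axis i 1 = c i * x $ i" for i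
      by (subst inner_sum_left_Basis) (auto simp: d inner_axis)
    then show ?thesis by (simp add: vec_eq_iff inner_axis)
  qed
  have pr: "(\<Prod>j\<in>Basis. \<bar>d j\<bar>) = \<bar>\<Prod>i\<in>UNIV. c i\<bar>"
  proof -
    have "bij_betw (\<lambda>i. axis i 1) UNIV (Basis :: (real^'n) set)"
      by (auto simp: bij_betw_def inj_on_def axis_eq_axis Basis_vec_def)
    from prod.reindex_bij_betw[OF this, of "\<lambda>j. \<bar>d j\<bar>"] show ?thesis by (simp add: d abs_prod)
  qed
  have dn: "d j \<noteq> 0" if "j \<in> Basis" for j :: "real^'n"
    using that c by (auto simp: Basis_vec_def d)
  have aff: "lborel = density (distr lborel borel (\<lambda>x::real^'n. \<chi> i. c i * x$i)) (\<lambda>_. ennreal \<bar>\<Prod>i\<in>UNIV. c i\<bar>)"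
    using lborel_affine_euclidean[of d 0, OF dn] unfolding T pr .
  have "(\<integral>\<^sup>+x. h x \<partial>lborel) = (\<integral>\<^sup>+x. ennreal \<bar>\<Prod>i\<in>UNIV. c i\<bar> * h x \<partial>distr lborel borel (\<lambda>x. \<chi> i. c i * x $ i))"
    by (subst aff) (simp add: nn_integral_density)
  also have "\<dots> = ennreal \<bar>\<Prod>i\<in>UNIV. c i\<bar> * (\<integral>\<^sup>+x. h (\<chi> i. c i * x$i) \<partial>lborel)"
    by (subst nn_integral_distr) (simp_all add: nn_integral_cmult)
  finally show ?thesis by simp
qed

text \<open>Induction over a factorization into elementary maps. Determinants multiply, so a
  composition with nonzero determinant has factors with nonzero determinants, and maps with a zero
  row satisfy the implication vacuously.\<close>

lemma nn_integral_lborel_linear_aux: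
  fixes f :: "real^'n \<Rightarrow> real^'n"
  assumes "linear f"
  shows "det (matrix f) \<noteq> 0 \<longrightarrow> (\<forall>h \<in> borel_measurable borel.
    ennreal \<bar>det (matrix f)\<bar> * (\<integral>\<^sup>+x. h (f x) \<partial>lborel) = (\<integral>\<^sup>+x. h x \<partial>lborel))"
    (is "?P f")
  using assms
proof (rule induct_linear_elementary)
  fix f g :: "real^'n \<Rightarrow> real^'n"
  assume lin: "linear f" "linear g" and P: "?P f" "?P g"
  have [measurable]: "f \<in> borel_measurable borel" "g \<in> borel_measurable borel"
    using lin by (auto intro: borel_measurable_continuous_onI linear_continuous_on linear_conv_bounded_linear[THEN iffD1])
  have m: "matrix (f \<circ> g) = matrix f ** matrix g" using lin by (simp add: matrix_compose)
  show "?P (f \<circ> g)"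
  proof (intro impI ballI)
    fix h :: "real^'n \<Rightarrow> ennreal" assume [measurable]: "h \<in> borel_measurable borel"
    assume "det (matrix (f \<circ> g)) \<noteq> 0"
    then have n0: "det (matrix f) \<noteq> 0" "det (matrix g) \<noteq> 0" by (auto simp: m det_mul)
    have "ennreal \<bar>det (matrix (f \<circ> g))\<bar> * (\<integral>\<^sup>+x. h ((f \<circ> g) x) \<partial>lborel)
      = ennreal \<bar>det (matrix f)\<bar> * (ennreal \<bar>det (matrix g)\<bar> * (\<integral>\<^sup>+x. h (f (g x)) \<partial>lborel))"
      by (simp add: m det_mul abs_mult ennreal_mult mult.assoc)
    also have "(ennreal \<bar>det (matrix g)\<bar> * (\<integral>\<^sup>+x. h (f (g x)) \<partial>lborel)) = (\<integral>\<^sup>+x. h (f x) \<partial>lborel)"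
      using P(2) n0(2) by (auto dest!: bspec[of _ _ "\<lambda>x. h (f x)"])
    also have "ennreal \<bar>det (matrix f)\<bar> * \<dots> = (\<integral>\<^sup>+x. h x \<partial>lborel)"
      using P(1) n0(1) by auto
    finally show "ennreal \<bar>det (matrix (f \<circ> g))\<bar> * (\<integral>\<^sup>+x. h ((f \<circ> g) x) \<partial>lborel) = (\<integral>\<^sup>+x. h x \<partial>lborel)" .
  qed
next
  fix f :: "real^'n \<Rightarrow> real^'n" and i
  assume "linear f" and 0: "\<And>x. f x $ i = 0"
  have "row i (matrix f) = 0" by (simp add: vec_eq_iff row_def matrix_def 0)
  then have "det (matrix f) = 0" by (rule det_zero_row(2))
  then show "?P f" by simp
next
  fix c :: "'n \<Rightarrow> real"
  have "matrix (\<lambda>x. \<chi> i. c i * x $ i) = (\<chi> i j. if i = j then c i else 0)"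
    by (auto simp: matrix_def vec_eq_iff axis_def)
  then have d: "det (matrix (\<lambda>x. \<chi> i. c i * x $ i)) = (\<Prod>i\<in>UNIV. c i)"
    by (simp add: det_diagonal)
  show "?P (\<lambda>x. \<chi> i. c i * x $ i)"
    unfolding d by (auto intro!: nn_integral_lborel_diagonal)
next
  fix m n :: 'n assume mn: "m \<noteq> n"
  define sh where "sh m n x = (\<chi> i. if i = m then x$m + x$n else x$i)" for m n and x :: "real^'n"
  define dg where "dg x = (\<chi> i. (if i = n then -1 else 1) * x$i)" for x :: "real^'n"
  let ?sw = "\<lambda>x::real^'n. \<chi> i. x $ Transposition.transpose m n i"
  \<comment> \<open>On the coordinates \<open>m\<close>, \<open>n\<close> the chain runs through (a,
    b), (a+b, b), (a+b, -b), (a+b, a), (a+b, -a), (b, -a), (b, a): a swap is made of shears and sign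
    changes.\<close>
  have eq: "?sw x = dg (sh m n (dg (sh n m (dg (sh m n x)))))" for x
    using mn by (auto simp: vec_eq_iff Transposition.transpose_def sh_def dg_def)
  have [measurable]: "sh a b \<in> borel_measurable borel" "dg \<in> borel_measurable borel" for a b
    unfolding sh_def dg_def by measurable
  have dg: "(\<integral>\<^sup>+x. h (dg x) \<partial>lborel) = (\<integral>\<^sup>+x. h x \<partial>lborel)"
    if [measurable]: "h \<in> borel_measurable borel" for h
  proof -
    have "\<bar>\<Prod>i\<in>UNIV. (if i = n then -1 else 1) :: real\<bar> = 1" by (simp add: abs_prod)
    then show ?thesis
      using nn_integral_lborel_diagonal[OF that, of "\<lambda>i. if i = n then -1 else 1"] by (simp add: dg_def)
  qed
  have sh: "(\<integral>\<^sup>+x. h (sh a b x) \<partial>lborel) = (\<integral>\<^sup>+x. h x \<partial>lborel)"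
    if "a \<noteq> b" "h \<in> borel_measurable borel" for a b h
    unfolding sh_def using that by (intro nn_integral_lborel_shear)
  have "matrix ?sw = (\<chi> i. mat 1 $ Transposition.transpose m n i)"
    by (auto simp: matrix_def vec_eq_iff axis_def mat_def)
  then have d: "\<bar>det (matrix ?sw)\<bar> = 1"
    using det_permute_rows[of "Transposition.transpose m n" "mat 1 :: real^'n^'n"] mn
    by (simp add: permutes_swap_id sign_swap_id)
  show "?P ?sw"
  proof (intro impI ballI)
    fix h :: "real^'n \<Rightarrow> ennreal" assume [measurable]: "h \<in> borel_measurable borel"
    have "(\<integral>\<^sup>+x. h (?sw x) \<partial>lborel) = (\<integral>\<^sup>+x. h (dg (sh m n (dg (sh n m (dg x))))) \<partial>lborel)"
      unfolding eq using mn by (intro sh[of m n "\<lambda>x. h (dg (sh m n (dg (sh n m (dg x)))))"]) simp_all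
    also have "\<dots> = (\<integral>\<^sup>+x. h (dg (sh m n (dg (sh n m x)))) \<partial>lborel)"
      by (intro dg[of "\<lambda>x. h (dg (sh m n (dg (sh n m x))))"]) simp
    also have "\<dots> = (\<integral>\<^sup>+x. h (dg (sh m n (dg x))) \<partial>lborel)"
      using mn by (intro sh[of n m "\<lambda>x. h (dg (sh m n (dg x)))"]) simp_all
    also have "\<dots> = (\<integral>\<^sup>+x. h (dg (sh m n x)) \<partial>lborel)"
      by (intro dg[of "\<lambda>x. h (dg (sh m n x))"]) simp
    also have "\<dots> = (\<integral>\<^sup>+x. h (dg x) \<partial>lborel)"
      using mn by (intro sh[of m n "\<lambda>x. h (dg x)"]) simp_all
    also have "\<dots> = (\<integral>\<^sup>+x. h x \<partial>lborel)"
      by (intro dg) simp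
    finally show "ennreal \<bar>det (matrix ?sw)\<bar> * (\<integral>\<^sup>+x. h (?sw x) \<partial>lborel) = (\<integral>\<^sup>+x. h x \<partial>lborel)"
      by (simp add: d)
  qed
next
  fix m n :: 'n assume mn: "m \<noteq> n"
  let ?sh = "\<lambda>x::real^'n. \<chi> i. if i = m then x$m + x$n else x$i"
  have "matrix ?sh = (\<chi> i. if i = m then row m (mat 1) + 1 *s row n (mat 1) else row i (mat 1))"
    by (auto simp: matrix_def vec_eq_iff axis_def mat_def row_def)
  then have d: "det (matrix ?sh) = 1"
    using det_row_operation[OF mn, of "mat 1 :: real^'n^'n" 1] by simp
  show "?P ?sh"
    unfolding d using nn_integral_lborel_shear[OF _ mn] by simp
qed

lemma nn_integral_lborel_matrix:
  fixes A :: "real^'n^'n"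
  assumes "invertible A" "h \<in> borel_measurable borel"
  shows "ennreal \<bar>det A\<bar> * (\<integral>\<^sup>+x. h (A *v x) \<partial>lborel) = (\<integral>\<^sup>+x. h x \<partial>lborel)"
  using nn_integral_lborel_linear_aux[of "(*v) A"] assms by (auto simp: invertible_det_nz)


section \<open>Gaussian laws with positive definite covariance\<close>

definition gauss_density :: "real^'n^'n \<Rightarrow> real^'n \<Rightarrow> real" where
  "gauss_density S x = exp (- (x \<bullet> (matrix_inv S *v x)) / 2) / sqrt ((2*pi) ^ CARD('n) * det S)"

definition gauss_measure :: "real^'n^'n \<Rightarrow> (real^'n) measure" where
  "gauss_measure S = density lborel (\<lambda>x. ennreal (gauss_density S x))"

lemma borel_measurable_matrix_vector [measurable]: "(*v) X \<in> borel_measurable borel" for X :: "real^'n^'m"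
  by (intro borel_measurable_continuous_onI continuous_intros)

lemma borel_measurable_gauss_density [measurable]: "gauss_density S \<in> borel_measurable borel"
  unfolding gauss_density_def by measurable

lemma gauss_density_pos: "posdef S \<Longrightarrow> 0 < gauss_density S x"
  unfolding gauss_density_def by (intro divide_pos_pos) (auto intro!: mult_pos_pos posdef_det_pos)

lemma gauss_density_nonneg: "posdef S \<Longrightarrow> 0 \<le> gauss_density S x"
  using gauss_density_pos[of S x] by simp

lemma sets_gauss_measure [simp, measurable_cong]: "sets (gauss_measure S) = sets borel"
  by (simp add: gauss_measure_def)

lemma space_gauss_measure [simp]: "space (gauss_measure S) = UNIV"
  by (simp add: gauss_measure_def)

lemma gauss_density_mat_1: "(\<Prod>i\<in>UNIV. std_normal_density (z $ i)) = gauss_density (mat 1) z"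
proof -
  have "(\<Prod>i\<in>UNIV. std_normal_density (z $ i)) = (1 / sqrt (2*pi)) ^ CARD('a) * exp (\<Sum>i\<in>UNIV. - (z $ i)\<^sup>2 / 2)"
    by (simp add: std_normal_density_def prod_dividef exp_sum power_one_over)
  moreover have "(\<Sum>i\<in>UNIV. - (z $ i)\<^sup>2 / 2) = - (z \<bullet> z) / 2"
    by (simp add: inner_vec_def power2_eq_square sum_negf sum_divide_distrib)
  moreover have "matrix_inv (mat 1) = (mat 1 :: real^'a^'a)"
    by (rule matrix_inv_eqI) simp
  ultimately show ?thesis
    by (simp add: gauss_density_def real_sqrt_power real_sqrt_mult power_mult_distrib power_one_over)
qed

lemma std_gaussian_vec_eq: "std_gaussian_vec = gauss_measure (mat 1)"
  by (simp add: std_gaussian_vec_def gauss_measure_def gauss_density_mat_1)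

lemma nn_integral_lborel_vec_prod:
  fixes f :: "'n::finite \<Rightarrow> real \<Rightarrow> ennreal"
  assumes [measurable]: "\<And>i. f i \<in> borel_measurable borel"
  shows "(\<integral>\<^sup>+x. (\<Prod>i\<in>UNIV. f i (x $ i)) \<partial>(lborel :: (real^'n) measure)) = (\<Prod>i\<in>UNIV. \<integral>\<^sup>+x. f i x \<partial>lborel)"
proof -
  have bij: "bij_betw (\<lambda>i. axis i 1) UNIV (Basis :: (real^'n) set)"
    by (auto simp: bij_betw_def inj_on_def axis_eq_axis Basis_vec_def)
  define g where "g b = f (inv_into UNIV (\<lambda>i. axis i 1 :: real^'n) b)" for b
  have inj: "inj (\<lambda>i. axis i 1 :: real^'n)" by (auto simp: inj_on_def axis_eq_axis)
  have g: "g (axis i 1) = f i" for i using inv_into_f_f[OF inj] by (simp add: g_def)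
  have [measurable]: "g b \<in> borel_measurable borel" for b by (simp add: g_def)
  have "(\<Prod>b\<in>Basis. g b (x \<bullet> b)) = (\<Prod>i\<in>UNIV. f i (x $ i))" for x :: "real^'n"
    using prod.reindex_bij_betw[OF bij, of "\<lambda>b. g b (x \<bullet> b)"] by (simp add: g inner_axis)
  moreover have "(\<Prod>b\<in>Basis. \<integral>\<^sup>+x. g b x \<partial>lborel) = (\<Prod>i\<in>UNIV. \<integral>\<^sup>+x. f i x \<partial>lborel)"
    using prod.reindex_bij_betw[OF bij, of "\<lambda>b. \<integral>\<^sup>+x. g b x \<partial>lborel"] by (simp add: g)
  ultimately show ?thesis using nn_integral_lborel_prod[of g] by simp
qed

lemma nn_integral_std_normal_density: "(\<integral>\<^sup>+x. ennreal (std_normal_density x) \<partial>lborel) = 1"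
  by (subst nn_integral_eq_integral) auto

lemma nn_integral_gauss_density_mat_1: "(\<integral>\<^sup>+x. ennreal (gauss_density (mat 1) x) \<partial>lborel) = 1"
  unfolding gauss_density_mat_1[symmetric]
  using nn_integral_lborel_vec_prod[of "\<lambda>_ x. ennreal (std_normal_density x)"]
  by (simp add: prod_ennreal[symmetric] nn_integral_std_normal_density)

lemma gauss_density_image:
  fixes L :: "real^'n^'n"
  assumes L: "invertible L"
  shows "gauss_density (L ** transpose L) (L *v x) = gauss_density (mat 1) x / \<bar>det L\<bar>"
proof -
  have "(L ** transpose L) ** (transpose (matrix_inv L) ** matrix_inv L) = L ** transpose (matrix_inv L ** L) ** matrix_inv L"
    by (simp add: matrix_transpose_mul matrix_mul_assoc)
  then have inv: "matrix_inv (L ** transpose L) = transpose (matrix_inv L) ** matrix_inv L"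
    using L by (intro matrix_inv_eqI) (simp add: matrix_inv_left' matrix_inv_right')
  have "(L *v x) \<bullet> (matrix_inv (L ** transpose L) *v (L *v x)) = x \<bullet> x"
    unfolding inv using L
    by (simp add: matrix_vector_mul_assoc[symmetric] inner_matrix_vector_left[symmetric])
       (simp add: matrix_vector_mul_assoc matrix_inv_left')
  moreover have "matrix_inv (mat 1) = (mat 1 :: real^'n^'n)" by (rule matrix_inv_eqI) simp
  ultimately show ?thesis
    by (simp add: gauss_density_def det_mul real_sqrt_mult)
qed

lemma nn_integral_gauss_measure:
  assumes [measurable]: "h \<in> borel_measurable borel"
  shows "(\<integral>\<^sup>+x. h x \<partial>gauss_measure S) = (\<integral>\<^sup>+x. ennreal (gauss_density S x) * h x \<partial>lborel)"
  unfolding gauss_measure_def by (subst nn_integral_density) auto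

text \<open>Change of variables, where the Jacobian cancels the determinant in
  \<open>gauss_density_image\<close>. It reduces total mass, integrability and symmetries of
  Gaussian laws to the standard one.\<close>

lemma gauss_measure_eq_distr:
  fixes L :: "real^'n^'n"
  assumes L: "invertible L"
  shows "gauss_measure (L ** transpose L) = distr std_gaussian_vec borel ((*v) L)"
proof (rule measure_eqI)
  fix A assume "A \<in> sets (gauss_measure (L ** transpose L))"
  then have A[measurable]: "A \<in> sets borel" by simp
  have d: "ennreal \<bar>det L\<bar> * ennreal (gauss_density (L ** transpose L) (L *v x)) = ennreal (gauss_density (mat 1) x)" for x
    using L by (subst ennreal_mult[symmetric])
      (auto simp: gauss_density_image invertible_det_nz intro!: divide_nonneg_nonneg gauss_density_nonneg posdef_mat_1)
  have "emeasure (gauss_measure (L ** transpose L)) A = (\<integral>\<^sup>+x. ennreal (gauss_density (L ** transpose L) x) * indicator A x \<partial>lborel)"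
    using nn_integral_gauss_measure[of "indicator A" "L ** transpose L"] by simp
  also have "\<dots> = ennreal \<bar>det L\<bar> * (\<integral>\<^sup>+x. ennreal (gauss_density (L ** transpose L) (L *v x)) * indicator A (L *v x) \<partial>lborel)"
    by (rule nn_integral_lborel_matrix[OF L, symmetric]) simp
  also have "\<dots> = (\<integral>\<^sup>+x. ennreal (gauss_density (mat 1) x) * indicator A (L *v x) \<partial>lborel)"
    by (subst nn_integral_cmult[symmetric]) (auto simp: mult.assoc[symmetric] d)
  also have "\<dots> = (\<integral>\<^sup>+x. indicator A (L *v x) \<partial>gauss_measure (mat 1))"
    by (rule nn_integral_gauss_measure[symmetric]) simp
  also have "\<dots> = (\<integral>\<^sup>+x. indicator A x \<partial>distr std_gaussian_vec borel ((*v) L))"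
    by (subst nn_integral_distr) (auto simp: std_gaussian_vec_eq)
  finally show "emeasure (gauss_measure (L ** transpose L)) A = emeasure (distr std_gaussian_vec borel ((*v) L)) A"
    by simp
qed simp

lemma prob_space_std_gaussian_vec: "prob_space (std_gaussian_vec :: (real^'n) measure)"
  unfolding std_gaussian_vec_eq
  by (rule prob_spaceI) (use nn_integral_gauss_measure[of "\<lambda>_. 1" "mat 1 :: real^'n^'n"] nn_integral_gauss_density_mat_1[where 'a = 'n] in simp)

lemma prob_space_gauss_measure:
  fixes S :: "real^'n^'n"
  assumes "posdef S" shows "prob_space (gauss_measure S)"
proof -
  obtain L :: "real^'n^'n" where L: "S = L ** transpose L" "invertible L" by (rule posdef_factor[OF assms])
  show ?thesis unfolding L gauss_measure_eq_distr[OF L(2)]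
    by (intro prob_space.prob_space_distr prob_space_std_gaussian_vec)
       (auto simp: std_gaussian_vec_eq intro!: borel_measurable_continuous_onI continuous_intros)
qed

lemma nn_integral_gauss_density: "posdef S \<Longrightarrow> (\<integral>\<^sup>+x. ennreal (gauss_density S x) \<partial>lborel) = 1"
  using nn_integral_gauss_measure[of "\<lambda>_. 1" S] prob_space.emeasure_space_1[OF prob_space_gauss_measure, of S]
  by simp

lemma nn_integral_lborel_shift:
  fixes c :: "real^'n"
  assumes [measurable]: "h \<in> borel_measurable borel"
  shows "(\<integral>\<^sup>+x. h (x + c) \<partial>lborel) = (\<integral>\<^sup>+x. h x \<partial>lborel)"
  by (subst (2) lborel_distr_plus[of c, symmetric], subst nn_integral_distr) (simp_all add: add.commute)

lemma matrix_mul_cancel: "A ** B = mat 1 \<Longrightarrow> X ** A ** B = X" for A :: "real^'n^'m"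
  by (metis matrix_mul_assoc matrix_mul_rid)

text \<open>
  Bayes' rule for \<open>w = C n + t\<close> with independent Gaussian \<open>n\<close>, \<open>t\<close> of covariances \<open>S\<close>, \<open>T\<close>.
  The normalizing constants agree because both sides are probability densities in \<open>(w, n)\<close>;
  no determinant identity is needed.
\<close>

lemma
  fixes S :: "real^'n^'n" and T :: "real^'m^'m" and C :: "real^'n^'m"
  assumes S: "posdef S" and T: "posdef T"
  defines "G \<equiv> T + C ** S ** transpose C"
  defines "B \<equiv> S ** transpose C ** matrix_inv G"
  defines "V \<equiv> S - B ** G ** transpose B"
  shows gauss_bayes_posdef: "posdef G" "posdef V"
    and gauss_bayes: "gauss_density S n * gauss_density T (w - C *v n) = gauss_density G w * gauss_density V (n - B *v w)"
proof -
  define P Q where "P = matrix_inv S" and "Q = matrix_inv T"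
  have iS: "P ** S = mat 1" "S ** P = mat 1" and iT: "Q ** T = mat 1" "T ** Q = mat 1"
    using S T by (auto simp: P_def Q_def matrix_inv_left' matrix_inv_right' posdef_invertible)
  have symQ: "transpose Q = Q" and pQ: "posdef Q" and pP: "posdef P"
    using S T by (auto simp: P_def Q_def posdef_inv_sym posdef_matrix_inv)
  \<comment> \<open>The posterior precision of \<open>n\<close> given \<open>w\<close>: the prior
    precision \<open>P\<close> plus what the observation contributes. Its inverse \<open>U\<close>
    will turn out to be \<open>V\<close>.\<close>
  define M where "M = P + transpose C ** Q ** C"
  have pM: "posdef M" unfolding M_def
    using posdef_add_psd[OF pP psd_congruence[OF posdef_imp_psd[OF pQ], of "transpose C"]] by simp
  define U where "U = matrix_inv M"
  have iM: "U ** M = mat 1" "M ** U = mat 1"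
    using pM by (auto simp: U_def matrix_inv_left' matrix_inv_right' posdef_invertible)
  have pU: "posdef U" and symU: "transpose U = U" using pM by (auto simp: U_def posdef_matrix_inv posdef_inv_sym)
  show pG: "posdef G" unfolding G_def by (intro posdef_add_psd T psd_congruence posdef_imp_psd S)
  have CQC: "transpose C ** Q ** C = M - P" by (simp add: M_def)
  have CQC': "X ** transpose C ** Q ** C = X ** M - X ** P" for X :: "real^'n^'q"
    by (metis CQC matrix_mul_assoc matrix_diff_ldistrib)
  note cancel = iS iT iM iS[THEN matrix_mul_cancel] iT[THEN matrix_mul_cancel] iM[THEN matrix_mul_cancel]
  note sm = matrix_distribs matrix_mul_assoc CQC CQC' cancel
  \<comment> \<open>Woodbury's formula for the inverse of \<open>G\<close>, verified by
    multiplication.\<close>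
  define Q' where "Q' = Q - Q ** C ** U ** transpose C ** Q"
  have "Q' ** G = mat 1" by (simp add: Q'_def G_def sm)
  then have "G ** Q' = mat 1" by (metis invertible_left_inverse matrix_inv_right' matrix_inv_eqI matrix_left_right_inverse)
  then have Q': "matrix_inv G = Q'" by (rule matrix_inv_eqI)
  have B: "B = U ** transpose C ** Q" by (simp add: B_def Q' Q'_def sm)
  have tB: "transpose B = Q ** C ** U" by (simp add: B matrix_transpose_mul symQ symU matrix_mul_assoc)
  have GtB: "G ** transpose B = C ** S"
  proof -
    have "transpose B = matrix_inv G ** C ** S"
      using S pG by (simp add: B_def matrix_transpose_mul posdef_sym posdef_inv_sym matrix_mul_assoc)
    then show ?thesis using pG by (simp add: matrix_mul_assoc matrix_inv_right' posdef_invertible)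
  qed
  have V: "V = U"
  proof -
    have "V = S - B ** (C ** S)" by (simp add: V_def GtB flip: matrix_mul_assoc)
    also have "\<dots> = U" by (simp add: B sm)
    finally show ?thesis .
  qed
  show pV: "posdef V" using pU by (simp add: V)
  have iV: "matrix_inv V = M" unfolding V by (rule matrix_inv_eqI) (rule iM)
  \<comment> \<open>Completing the square in \<open>n\<close>: the exponents of prior and likelihood
    equal those of marginal and posterior.\<close>
  have quad: "n \<bullet> (P *v n) + (w - C *v n) \<bullet> (Q *v (w - C *v n))
     = w \<bullet> (Q' *v w) + (n - B *v w) \<bullet> (M *v (n - B *v w))" for n w
  proof -
    have MB: "M ** B = transpose C ** Q" by (simp add: B sm)
    have 1: "(B *v w) \<bullet> (M *v n) = w \<bullet> ((Q ** C) *v n)"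
      by (simp add: inner_matrix_vector_left matrix_vector_mul_assoc tB sm)
    have 2: "(B *v w) \<bullet> (M *v (B *v w)) = w \<bullet> ((Q ** C ** U ** transpose C ** Q) *v w)"
      by (simp add: inner_matrix_vector_left matrix_vector_mul_assoc tB MB sm)
    have 3: "n \<bullet> (M *v (B *v w)) = n \<bullet> ((transpose C ** Q) *v w)"
      by (simp add: matrix_vector_mul_assoc MB)
    have 4: "(C *v n) \<bullet> (Q *v (C *v n)) = n \<bullet> (M *v n) - n \<bullet> (P *v n)"
      by (simp add: inner_matrix_vector_left matrix_vector_mul_assoc sm matrix_vector_mult_diff_rdistrib inner_diff_right)
    have 5: "(C *v n) \<bullet> (Q *v w) = n \<bullet> ((transpose C ** Q) *v w)"
      by (simp add: inner_matrix_vector_left matrix_vector_mul_assoc)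
    show ?thesis
      by (simp add: matrix_vector_mult_diff_distrib inner_diff_left inner_diff_right 1 2 3 4 5 Q'_def
          matrix_vector_mult_diff_rdistrib) (simp add: matrix_vector_mul_assoc)
  qed
  define k where "k = (sqrt ((2*pi) ^ CARD('m) * det G) * sqrt ((2*pi) ^ CARD('n) * det V))
     / (sqrt ((2*pi) ^ CARD('n) * det S) * sqrt ((2*pi) ^ CARD('m) * det T))"
  have pos: "0 < det G" "0 < det V" "0 < det S" "0 < det T" using pG pV S T by (auto intro: posdef_det_pos)
  have k0: "0 \<le> k" using pos by (simp add: k_def)
  have eq: "gauss_density S n * gauss_density T (w - C *v n) = k * (gauss_density G w * gauss_density V (n - B *v w))" for n w
  proof -
    have "exp (- (n \<bullet> (P *v n)) / 2) * exp (- ((w - C *v n) \<bullet> (Q *v (w - C *v n))) / 2)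
       = exp (- (w \<bullet> (Q' *v w)) / 2) * exp (- ((n - B *v w) \<bullet> (M *v (n - B *v w))) / 2)"
      using quad[of n w] by (simp flip: exp_add add: field_simps)
    then show ?thesis using pos
      unfolding gauss_density_def P_def[symmetric] Q_def[symmetric] Q' iV k_def
      by (simp add: divide_simps)
  qed
  have one: "(\<integral>\<^sup>+w. \<integral>\<^sup>+n. ennreal (gauss_density G w * gauss_density V (n - B *v w)) \<partial>lborel \<partial>lborel) = 1"
    using nn_integral_lborel_shift[of "\<lambda>n. ennreal (gauss_density V n)" "- (B *v _)"] pG pV
    by (simp add: ennreal_mult gauss_density_nonneg nn_integral_cmult nn_integral_gauss_density)
  have "1 = (\<integral>\<^sup>+n. \<integral>\<^sup>+w. ennreal (gauss_density S n * gauss_density T (w - C *v n)) \<partial>lborel \<partial>lborel)"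
    using nn_integral_lborel_shift[of "\<lambda>n. ennreal (gauss_density T n)" "- (C *v _)"] S T
    by (simp add: ennreal_mult gauss_density_nonneg nn_integral_cmult nn_integral_gauss_density)
  also have "\<dots> = (\<integral>\<^sup>+w. \<integral>\<^sup>+n. ennreal (gauss_density S n * gauss_density T (w - C *v n)) \<partial>lborel \<partial>lborel)"
    by (rule lborel_pair.Fubini') simp
  also have "\<dots> = (\<integral>\<^sup>+w. \<integral>\<^sup>+n. ennreal k * ennreal (gauss_density G w * gauss_density V (n - B *v w)) \<partial>lborel \<partial>lborel)"
    using k0 pG pV by (intro nn_integral_cong) (simp add: eq ennreal_mult gauss_density_nonneg)
  also have "\<dots> = ennreal k * (\<integral>\<^sup>+w. \<integral>\<^sup>+n. ennreal (gauss_density G w * gauss_density V (n - B *v w)) \<partial>lborel \<partial>lborel)"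
    by (simp add: nn_integral_cmult)
  also have "\<dots> = ennreal k" by (simp add: one)
  finally have "k = 1" by simp
  then show "gauss_density S n * gauss_density T (w - C *v n) = gauss_density G w * gauss_density V (n - B *v w)"
    using eq by simp
qed


section \<open>Moments of the standard Gaussian vector\<close>

lemma sets_std_gaussian_vec [simp, measurable_cong]: "sets std_gaussian_vec = sets borel"
  by (simp add: std_gaussian_vec_eq)

lemma space_std_gaussian_vec [simp]: "space std_gaussian_vec = UNIV"
  by (simp add: std_gaussian_vec_eq)

lemma distr_std_gaussian_vec_component:
  "distr std_gaussian_vec borel (\<lambda>u::real^'n. u $ i) = density lborel std_normal_density"
proof (rule measure_eqI)
  fix A :: "real set" assume "A \<in> sets (distr std_gaussian_vec borel (\<lambda>u::real^'n. u $ i))"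
  then have [measurable]: "A \<in> sets borel" by simp
  define f where "f k x = ennreal (std_normal_density x) * (if k = i then indicator A x else 1)" for k :: 'n and x
  have [measurable]: "f k \<in> borel_measurable borel" for k
    by (cases "k = i") (simp_all add: f_def[abs_def])
  have fi: "(\<integral>\<^sup>+x. f k x \<partial>lborel) = (if k = i then emeasure (density lborel std_normal_density) A else 1)" for k
    by (auto simp: f_def nn_integral_std_normal_density emeasure_density)
  have P: "(\<Prod>k\<in>UNIV. f k (u $ k)) = ennreal (gauss_density (mat 1) u) * indicator A (u $ i)" for u
    by (simp add: f_def prod.distrib prod_ennreal gauss_density_mat_1 prod.delta)
  have "emeasure (distr std_gaussian_vec borel (\<lambda>u::real^'n. u $ i)) A
      = (\<integral>\<^sup>+x. indicator A x \<partial>distr std_gaussian_vec borel (\<lambda>u::real^'n. u $ i))"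
    by simp
  also have "\<dots> = (\<integral>\<^sup>+u. indicator A (u $ i) \<partial>gauss_measure (mat 1 :: real^'n^'n))"
    by (subst nn_integral_distr) (simp_all add: std_gaussian_vec_eq)
  also have "\<dots> = (\<integral>\<^sup>+u. (\<Prod>k\<in>UNIV. f k (u $ k)) \<partial>lborel)"
    by (subst nn_integral_gauss_measure) (simp_all add: P)
  also have "\<dots> = emeasure (density lborel std_normal_density) A"
    by (subst nn_integral_lborel_vec_prod) (simp_all add: fi)
  finally show "emeasure (distr std_gaussian_vec borel (\<lambda>u::real^'n. u $ i)) A = emeasure (density lborel std_normal_density) A" .
qed simp

lemma
  shows integrable_std_gaussian_vec_power: "integrable std_gaussian_vec (\<lambda>u::real^'n. (u $ i) ^ k)"
    and integral_std_gaussian_vec_square: "(\<integral>u. (u $ i)\<^sup>2 \<partial>(std_gaussian_vec :: (real^'n) measure)) = 1"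
proof -
  show "integrable std_gaussian_vec (\<lambda>u::real^'n. (u $ i) ^ k)"
    using integrable_distr_eq[of "\<lambda>u::real^'n. u $ i" std_gaussian_vec borel "\<lambda>x. x ^ k"]
    by (simp add: distr_std_gaussian_vec_component integrable_density integrable_std_normal_moment)
  have "(\<integral>u. (u $ i)\<^sup>2 \<partial>(std_gaussian_vec :: (real^'n) measure)) = (\<integral>x. std_normal_density x * x\<^sup>2 \<partial>lborel)"
    using integral_distr[of "\<lambda>u::real^'n. u $ i" std_gaussian_vec borel "\<lambda>x. x\<^sup>2"]
    by (simp add: distr_std_gaussian_vec_component integral_density)
  also have "\<dots> = 1" using integral_std_normal_moment_even[of 1] by simp
  finally show "(\<integral>u. (u $ i)\<^sup>2 \<partial>(std_gaussian_vec :: (real^'n) measure)) = 1" .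
qed

text \<open>The weak law will be applied to the information density, a quadratic polynomial in
  Gaussian vectors, so its square has degree four. By Cauchy-Schwarz the fourth power of the norm is
  dominated by the fourth powers of the components.\<close>

lemma integrable_std_gaussian_vec_norm4: "integrable std_gaussian_vec (\<lambda>u::real^'n. norm u ^ 4)"
proof (rule Bochner_Integration.integrable_bound)
  show "integrable std_gaussian_vec (\<lambda>u::real^'n. real CARD('n) * (\<Sum>i\<in>UNIV. (u $ i) ^ 4))"
    by (intro integrable_mult_right Bochner_Integration.integrable_sum integrable_std_gaussian_vec_power)
  show "AE u in (std_gaussian_vec :: (real^'n) measure). norm (norm u ^ 4) \<le> norm (real CARD('n) * (\<Sum>i\<in>UNIV. (u $ i) ^ 4))"
  proof (intro AE_I2)
    fix u :: "real^'n"
    have "norm u ^ 4 = ((norm u)\<^sup>2)\<^sup>2" by simp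
    also have "(norm u)\<^sup>2 = (\<Sum>i\<in>UNIV. (u $ i)\<^sup>2)"
      by (simp add: norm_vec_def L2_set_def sum_nonneg)
    also have "\<dots>\<^sup>2 \<le> (\<Sum>i\<in>UNIV. ((u $ i)\<^sup>2)\<^sup>2) * real CARD('n)"
      by (rule sum_squared_le_sum_of_squares)
    finally show "norm (norm u ^ 4) \<le> norm (real CARD('n) * (\<Sum>i\<in>UNIV. (u $ i) ^ 4))"
      by (simp add: abs_mult abs_of_nonneg sum_nonneg mult.commute)
  qed
qed (simp add: measurable_cong_sets[OF sets_std_gaussian_vec refl])

lemma integrable_std_gaussian_vec_bound:
  fixes f :: "real^'n \<Rightarrow> real"
  assumes [measurable]: "f \<in> borel_measurable borel" and b: "\<And>u. \<bar>f u\<bar> \<le> A + B * norm u ^ 4"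
  shows "integrable std_gaussian_vec f"
proof (rule Bochner_Integration.integrable_bound)
  interpret prob_space "std_gaussian_vec :: (real^'n) measure" by (rule prob_space_std_gaussian_vec)
  show "integrable std_gaussian_vec (\<lambda>u::real^'n. A + B * norm u ^ 4)"
    by (intro Bochner_Integration.integrable_add integrable_mult_right integrable_std_gaussian_vec_norm4) simp
  show "AE u in std_gaussian_vec. norm (f u) \<le> norm (A + B * norm u ^ 4)"
    using b by (intro AE_I2) (smt (verit) real_norm_def)
qed (simp add: measurable_cong_sets[OF sets_std_gaussian_vec refl])

lemma le_add_power4: "x\<^sup>2 \<le> 1 + x ^ 4" for x :: real
proof -
  have "2 * x\<^sup>2 \<le> x ^ 4 + 1"
    using zero_le_power2[of "x\<^sup>2 - 1"] unfolding power2_diff by (simp add: power_even_eq[symmetric])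
  then show ?thesis using zero_le_power2[of x] by linarith
qed

lemma integrable_std_gaussian_vec_bound2:
  fixes f :: "real^'n \<Rightarrow> real"
  assumes "f \<in> borel_measurable borel" and b: "\<And>u. \<bar>f u\<bar> \<le> A + B * (norm u)\<^sup>2" and "0 \<le> B"
  shows "integrable std_gaussian_vec f"
proof (rule integrable_std_gaussian_vec_bound)
  fix u :: "real^'n"
  have "B * (norm u)\<^sup>2 \<le> B * (1 + norm u ^ 4)" using le_add_power4 assms(3) by (intro mult_left_mono) auto
  then show "\<bar>f u\<bar> \<le> (A + B) + B * norm u ^ 4" using b[of u] by (simp add: algebra_simps)
qed fact

text \<open>A reflection in one coordinate is orthogonal and so preserves the standard Gaussian.
  This makes the means and the mixed second moments vanish.\<close>

lemma std_gaussian_vec_reflect: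
  fixes h :: "real^'n \<Rightarrow> real"
  assumes [measurable]: "h \<in> borel_measurable borel"
  shows "(\<integral>u. h (\<chi> k. if k = i then - u $ k else u $ k) \<partial>std_gaussian_vec) = (\<integral>u. h u \<partial>std_gaussian_vec)"
proof -
  define D :: "real^'n^'n" where "D = (\<chi> k l. if k = l then (if k = i then -1 else 1) else 0)"
  define s :: "'n \<Rightarrow> real" where "s k = (if k = i then -1 else 1)" for k
  have D: "D = (\<chi> k l. if k = l then s k else 0)" by (simp add: D_def s_def vec_eq_iff)
  have DD: "D ** transpose D = mat 1"
    by (simp add: D matrix_matrix_mult_def transpose_def mat_def vec_eq_iff if_distrib[where f = "\<lambda>x. x * _"] cong: if_cong)
       (simp add: s_def)
  then have inv: "invertible D" using invertible_right_inverse by blast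
  have Du: "D *v u = (\<chi> k. if k = i then - u $ k else u $ k)" for u
    by (simp add: D matrix_vector_mult_def vec_eq_iff if_distrib[where f = "\<lambda>x. x * _"] cong: if_cong)
       (simp add: s_def)
  have "std_gaussian_vec = distr std_gaussian_vec borel ((*v) D)"
    using gauss_measure_eq_distr[OF inv] by (simp add: DD std_gaussian_vec_eq)
  then have "(\<integral>u. h u \<partial>std_gaussian_vec) = (\<integral>u. h u \<partial>distr std_gaussian_vec borel ((*v) D))" by simp
  also have "\<dots> = (\<integral>u. h (D *v u) \<partial>std_gaussian_vec)"
    by (subst integral_distr) (simp_all add: measurable_cong_sets[OF sets_std_gaussian_vec refl])
  finally show ?thesis by (simp add: Du)
qed

lemma integral_std_gaussian_vec_component: "(\<integral>u. u $ i \<partial>(std_gaussian_vec :: (real^'n) measure)) = 0"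
  using std_gaussian_vec_reflect[of "\<lambda>u. u $ i" i] by simp

lemma integrable_std_gaussian_vec_mult: "integrable std_gaussian_vec (\<lambda>u::real^'n. u $ i * u $ j)"
proof (rule integrable_std_gaussian_vec_bound2[where A = 0 and B = 1])
  fix u :: "real^'n"
  show "\<bar>u $ i * u $ j\<bar> \<le> 0 + 1 * (norm u)\<^sup>2"
    using mult_mono[OF component_le_norm_cart[of u i] component_le_norm_cart[of u j]]
    by (simp add: abs_mult power2_eq_square)
qed simp_all

lemma integral_std_gaussian_vec_mult:
  "(\<integral>u. u $ i * u $ j \<partial>(std_gaussian_vec :: (real^'n) measure)) = (if i = j then 1 else 0)"
proof (cases "i = j")
  case True
  then show ?thesis using integral_std_gaussian_vec_square[of i] by (simp add: power2_eq_square)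
next
  case False
  then have "(\<integral>u. - (u $ i * u $ j) \<partial>(std_gaussian_vec :: (real^'n) measure)) = (\<integral>u. u $ i * u $ j \<partial>std_gaussian_vec)"
    using std_gaussian_vec_reflect[of "\<lambda>u. u $ i * u $ j" i] by simp
  then show ?thesis using False by simp
qed

lemma abs_quadratic_le: "\<bar>x \<bullet> (Q *v x)\<bar> \<le> onorm ((*v) Q) * (norm x)\<^sup>2" for Q :: "real^'n^'n"
proof -
  have "\<bar>x \<bullet> (Q *v x)\<bar> \<le> norm x * norm (Q *v x)" by (rule Cauchy_Schwarz_ineq2)
  also have "\<dots> \<le> norm x * (onorm ((*v) Q) * norm x)"
    by (intro mult_left_mono onorm) auto
  finally show ?thesis by (simp add: power2_eq_square mult_ac)
qed

lemma norm_affine_le: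
  fixes L :: "real^'n^'m"
  shows "(norm (L *v u + e))\<^sup>2 \<le> 2 * (norm e)\<^sup>2 + 2 * (onorm ((*v) L))\<^sup>2 * (norm u)\<^sup>2"
proof -
  have "norm (L *v u + e) \<le> onorm ((*v) L) * norm u + norm e"
    using norm_triangle_ineq[of "L *v u" e] onorm[of "(*v) L" u] by simp
  then have "(norm (L *v u + e))\<^sup>2 \<le> (onorm ((*v) L) * norm u + norm e)\<^sup>2"
    by (intro power_mono) auto
  also have "\<dots> \<le> 2 * (norm e)\<^sup>2 + 2 * (onorm ((*v) L) * norm u)\<^sup>2"
    using zero_le_power2[of "onorm ((*v) L) * norm u - norm e"] by (simp add: power2_sum power2_diff)
  finally show ?thesis by (simp add: power_mult_distrib)
qed

lemma
  fixes L :: "real^'n^'m" and Q :: "real^'m^'m"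
  shows integrable_std_gaussian_vec_quadratic:
      "integrable std_gaussian_vec (\<lambda>u. (L *v u + e) \<bullet> (Q *v (L *v u + e)))" (is ?A)
    and integral_std_gaussian_vec_quadratic:
      "(\<integral>u. (L *v u + e) \<bullet> (Q *v (L *v u + e)) \<partial>std_gaussian_vec) = trace (Q ** L ** transpose L) + e \<bullet> (Q *v e)" (is ?B)
proof -
  show ?A
  proof (rule integrable_std_gaussian_vec_bound2)
    fix u
    have "\<bar>(L *v u + e) \<bullet> (Q *v (L *v u + e))\<bar> \<le> onorm ((*v) Q) * (norm (L *v u + e))\<^sup>2" by (rule abs_quadratic_le)
    also have "\<dots> \<le> onorm ((*v) Q) * (2 * (norm e)\<^sup>2 + 2 * (onorm ((*v) L))\<^sup>2 * (norm u)\<^sup>2)"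
      by (intro mult_left_mono norm_affine_le onorm_pos_le) simp
    finally show "\<bar>(L *v u + e) \<bullet> (Q *v (L *v u + e))\<bar>
       \<le> onorm ((*v) Q) * (2 * (norm e)\<^sup>2) + (onorm ((*v) Q) * (2 * (onorm ((*v) L))\<^sup>2)) * (norm u)\<^sup>2"
      by (simp add: algebra_simps)
  qed (auto intro!: mult_nonneg_nonneg onorm_pos_le)
  interpret prob_space "std_gaussian_vec :: (real^'n) measure" by (rule prob_space_std_gaussian_vec)
  define M where "M = transpose L ** Q ** L"
  \<comment> \<open>\<open>Q\<close> may be nonsymmetric, so the two terms linear in
    \<open>u\<close> combine to \<open>Q + transpose Q\<close>. They have mean zero.\<close>
  define v where "v = (transpose L ** (Q + transpose Q)) *v e"
  have ex: "(L *v u + e) \<bullet> (Q *v (L *v u + e)) = (\<Sum>i\<in>UNIV. \<Sum>j\<in>UNIV. M $ i $ j * (u $ i * u $ j)) + (\<Sum>i\<in>UNIV. v $ i * u $ i) + e \<bullet> (Q *v e)" for u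
  proof -
    have "(L *v u + e) \<bullet> (Q *v (L *v u + e)) = u \<bullet> (M *v u) + (u \<bullet> v) + e \<bullet> (Q *v e)"
    proof -
      have "e \<bullet> (Q *v (L *v u)) = u \<bullet> ((transpose L ** transpose Q) *v e)"
        by (metis inner_commute inner_matrix_vector_left matrix_transpose_mul matrix_vector_mul_assoc)
      moreover have "(L *v u) \<bullet> (Q *v e) = u \<bullet> ((transpose L ** Q) *v e)"
        by (simp add: inner_matrix_vector_left matrix_vector_mul_assoc)
      moreover have "(L *v u) \<bullet> (Q *v (L *v u)) = u \<bullet> (M *v u)"
        by (simp add: inner_matrix_vector_left matrix_vector_mul_assoc M_def matrix_mul_assoc)
      ultimately show ?thesis
        by (simp add: matrix_vector_right_distrib inner_add_left inner_add_right v_def matrix_add_ldistrib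
            matrix_vector_mult_add_rdistrib)
    qed
    also have "u \<bullet> (M *v u) = (\<Sum>i\<in>UNIV. \<Sum>j\<in>UNIV. M $ i $ j * (u $ i * u $ j))"
      by (simp add: inner_vec_def matrix_vector_mult_def sum_distrib_left mult_ac)
    also have "u \<bullet> v = (\<Sum>i\<in>UNIV. v $ i * u $ i)" by (simp add: inner_vec_def mult.commute)
    finally show ?thesis .
  qed
  have [simp]: "integrable std_gaussian_vec (\<lambda>u::real^'n. u $ i)" for i
    using integrable_std_gaussian_vec_power[of i 1] by simp
  note [simp] = integrable_std_gaussian_vec_mult
  have "(\<integral>u. (L *v u + e) \<bullet> (Q *v (L *v u + e)) \<partial>std_gaussian_vec)
     = (\<Sum>i\<in>UNIV. \<Sum>j\<in>UNIV. M $ i $ j * (if i = j then 1 else 0)) + e \<bullet> (Q *v e)"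
    unfolding ex by (simp add: prob_space[unfolded space_std_gaussian_vec] integral_std_gaussian_vec_mult integral_std_gaussian_vec_component)
  also have "(\<Sum>i\<in>UNIV. \<Sum>j\<in>UNIV. M $ i $ j * (if i = j then 1 else 0)) = trace M"
    by (simp add: trace_def if_distrib cong: if_cong)
  also have "trace M = trace (Q ** L ** transpose L)"
    unfolding M_def by (metis matrix_mul_assoc trace_mul_sym)
  finally show ?B .
qed


section \<open>Blocks of Gaussian vectors\<close>

definition block_lborel :: "nat \<Rightarrow> (nat \<Rightarrow> real^'r) measure" where
  "block_lborel n = (\<Pi>\<^sub>M j\<in>{..<n}. lborel)"

definition gauss_block :: "nat \<Rightarrow> real^'r^'r \<Rightarrow> (nat \<Rightarrow> real^'r) measure" where
  "gauss_block n S = (\<Pi>\<^sub>M j\<in>{..<n}. gauss_measure S)"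

definition block_density :: "nat \<Rightarrow> real^'r^'r \<Rightarrow> (nat \<Rightarrow> real^'r) \<Rightarrow> real" where
  "block_density n S x = (\<Prod>j<n. gauss_density S (x j))"

text \<open>The restriction to \<open>{..<n}\<close> keeps the result in the space of the product
  measure, whose points are extensional.\<close>

definition block_shift :: "nat \<Rightarrow> (nat \<Rightarrow> real^'r) \<Rightarrow> (nat \<Rightarrow> real^'r) \<Rightarrow> nat \<Rightarrow> real^'r" where
  "block_shift n c x = (\<lambda>j\<in>{..<n}. x j + c j)"

text \<open>The density of \<open>c i\<close> plus i.i.d. Gaussian noise of covariance
  \<open>S\<close>, for \<open>i\<close> uniform on \<open>I\<close>. Interference plus noise,
  received signals and genie signals all have laws of this form.\<close>

definition mixture_density ::
  "nat \<Rightarrow> real^'r^'r \<Rightarrow> 'i set \<Rightarrow> ('i \<Rightarrow> nat \<Rightarrow> real^'r) \<Rightarrow> (nat \<Rightarrow> real^'r) \<Rightarrow> real" where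
  "mixture_density n S I c y = (\<Sum>i\<in>I. block_density n S (\<lambda>j. y j - c i j)) / real (card I)"

definition mixture ::
  "nat \<Rightarrow> real^'r^'r \<Rightarrow> 'i set \<Rightarrow> ('i \<Rightarrow> nat \<Rightarrow> real^'r) \<Rightarrow> (nat \<Rightarrow> real^'r) measure" where
  "mixture n S I c = density (block_lborel n) (\<lambda>y. ennreal (mixture_density n S I c y))"

lemma sets_block_lborel [measurable_cong]: "sets (block_lborel n) = sets (\<Pi>\<^sub>M j\<in>{..<n}. borel)"
  unfolding block_lborel_def by (intro sets_PiM_cong) simp_all

lemma sets_gauss_block [measurable_cong]: "sets (gauss_block n S) = sets (\<Pi>\<^sub>M j\<in>{..<n}. borel)"
  unfolding gauss_block_def by (intro sets_PiM_cong) simp_all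

lemma sets_mixture [measurable_cong]: "sets (mixture n S I c) = sets (\<Pi>\<^sub>M j\<in>{..<n}. borel)"
  by (simp add: mixture_def sets_block_lborel)

lemma space_block: "space (block_lborel n) = extensional {..<n}" "space (gauss_block n S) = extensional {..<n}"
  "space (mixture n S I c) = extensional {..<n}"
  by (auto simp: mixture_def block_lborel_def gauss_block_def space_PiM PiE_def)

lemma noise_block_eq: "noise_block n = gauss_block n (mat 1)"
  by (simp add: noise_block_def gauss_block_def std_gaussian_vec_eq)

lemma sigma_finite_block_lborel: "sigma_finite_measure (block_lborel n :: (nat \<Rightarrow> real^'r) measure)"
proof -
  interpret product_sigma_finite "\<lambda>_::nat. lborel :: (real^'r) measure" ..
  show ?thesis unfolding block_lborel_def by (rule sigma_finite) simp
qed

lemma prob_space_gauss_block: "posdef S \<Longrightarrow> prob_space (gauss_block n S)"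
  unfolding gauss_block_def by (intro prob_space_PiM prob_space_gauss_measure)


lemma borel_measurable_block_component [measurable]:
  "j < n \<Longrightarrow> (\<lambda>x. x j) \<in> borel_measurable (\<Pi>\<^sub>M j\<in>{..<n}. borel)"
  by simp

lemma borel_measurable_block_density [measurable (raw)]:
  fixes y :: "'w \<Rightarrow> nat \<Rightarrow> real^'r"
  assumes "\<And>j. j < n \<Longrightarrow> (\<lambda>\<omega>. y \<omega> j) \<in> borel_measurable M"
  shows "(\<lambda>\<omega>. block_density n S (y \<omega>)) \<in> borel_measurable M"
  unfolding block_density_def
  by (intro borel_measurable_prod measurable_compose[OF assms borel_measurable_gauss_density]) simp

lemma borel_measurable_mixture_density [measurable (raw)]:
  fixes y :: "'w \<Rightarrow> nat \<Rightarrow> real^'r"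
  assumes "\<And>j. j < n \<Longrightarrow> (\<lambda>\<omega>. y \<omega> j) \<in> borel_measurable M"
  shows "(\<lambda>\<omega>. mixture_density n S I c (y \<omega>)) \<in> borel_measurable M"
  unfolding mixture_density_def using assms by measurable

lemma measurable_block_shift [measurable (raw)]:
  fixes y :: "'w \<Rightarrow> nat \<Rightarrow> real^'r"
  assumes "\<And>j. j < n \<Longrightarrow> (\<lambda>\<omega>. y \<omega> j) \<in> borel_measurable M"
  shows "(\<lambda>\<omega>. block_shift n c (y \<omega>)) \<in> M \<rightarrow>\<^sub>M (\<Pi>\<^sub>M j\<in>{..<n}. borel)"
  unfolding block_shift_def using assms by measurable

lemma block_density_pos: "posdef S \<Longrightarrow> 0 < block_density n S x"
  unfolding block_density_def by (intro prod_pos gauss_density_pos)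

lemma block_density_nonneg: "posdef S \<Longrightarrow> 0 \<le> block_density n S x"
  using block_density_pos[of S n x] by simp

lemma mixture_density_pos: "posdef S \<Longrightarrow> finite I \<Longrightarrow> I \<noteq> {} \<Longrightarrow> 0 < mixture_density n S I c y"
  unfolding mixture_density_def by (intro divide_pos_pos sum_pos block_density_pos) (simp_all add: card_gt_0_iff)

lemma mixture_density_nonneg: "posdef S \<Longrightarrow> 0 \<le> mixture_density n S I c y"
  unfolding mixture_density_def by (intro divide_nonneg_nonneg sum_nonneg block_density_nonneg) simp_all

text \<open>A translate such as \<open>\<lambda>j. y j - c i j\<close> leaves the extensional
  functions, whereas \<open>block_shift\<close> stays in them. Since only the first \<open>n\<close>
  values enter the densities, this rule and the next pass between the two forms.\<close>

lemma block_density_cong: "(\<And>j. j < n \<Longrightarrow> x j = y j) \<Longrightarrow> block_density n S x = block_density n S y"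
  unfolding block_density_def by (intro prod.cong) auto

lemma mixture_density_cong: "(\<And>j. j < n \<Longrightarrow> x j = y j) \<Longrightarrow> mixture_density n S I c x = mixture_density n S I c y"
  unfolding mixture_density_def by (intro arg_cong2[where f = "(/)"] sum.cong block_density_cong) auto

text \<open>Both sides agree on boxes, by translation invariance in each factor, and boxes determine
  the product measure.\<close>

lemma block_lborel_shift:
  fixes c :: "nat \<Rightarrow> real^'r"
  shows "distr (block_lborel n) (block_lborel n) (block_shift n c) = block_lborel n"
proof -
  interpret product_sigma_finite "\<lambda>_::nat. lborel :: (real^'r) measure" ..
  have "distr (block_lborel n) (block_lborel n) (block_shift n c) = (\<Pi>\<^sub>M j\<in>{..<n}. lborel)"
  proof (rule PiM_eqI)
    fix A :: "nat \<Rightarrow> (real^'r) set" assume "\<And>j. j \<in> {..<n} \<Longrightarrow> A j \<in> sets lborel"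
    then have A: "\<And>j. j < n \<Longrightarrow> A j \<in> sets borel" by simp
    have v: "(\<lambda>x. x + c j) -` A j \<in> sets borel" if "j < n" for j
      using measurable_sets[of "\<lambda>x. x + c j" borel borel "A j"] A[OF that] by simp
    have "emeasure (distr (block_lborel n) (block_lborel n) (block_shift n c)) (Pi\<^sub>E {..<n} A)
       = emeasure (block_lborel n) (block_shift n c -` (Pi\<^sub>E {..<n} A) \<inter> space (block_lborel n))"
      using A by (intro emeasure_distr) (auto simp: sets_block_lborel intro!: sets_PiM_I_finite)
    also have "block_shift n c -` (Pi\<^sub>E {..<n} A) \<inter> space (block_lborel n) = (\<Pi>\<^sub>E j\<in>{..<n}. (\<lambda>x. x + c j) -` A j)"
    proof (intro set_eqI)
      fix x show "x \<in> block_shift n c -` (Pi\<^sub>E {..<n} A) \<inter> space (block_lborel n) \<longleftrightarrow> x \<in> (\<Pi>\<^sub>E j\<in>{..<n}. (\<lambda>x. x + c j) -` A j)"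
        by (simp add: space_block block_shift_def PiE_iff conj_commute)
    qed
    also have "emeasure (block_lborel n) \<dots> = (\<Prod>j<n. emeasure lborel ((\<lambda>x. x + c j) -` A j))"
      unfolding block_lborel_def using v by (intro emeasure_PiM) auto
    also have "\<dots> = (\<Prod>j<n. emeasure lborel (A j))"
    proof (intro prod.cong refl)
      fix j assume "j \<in> {..<n}"
      with A have [measurable]: "A j \<in> sets borel" by simp
      have "emeasure lborel (A j) = emeasure (distr lborel borel ((+) (c j))) (A j)" by (simp add: lborel_distr_plus)
      also have "\<dots> = emeasure lborel ((\<lambda>x. x + c j) -` A j)" by (subst emeasure_distr) (simp_all add: vimage_def add.commute)
      finally show "emeasure lborel ((\<lambda>x. x + c j) -` A j) = emeasure lborel (A j)" by simp
    qed
    finally show "emeasure (distr (block_lborel n) (block_lborel n) (block_shift n c)) (Pi\<^sub>E {..<n} A) = (\<Prod>j<n. emeasure lborel (A j))" .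
  qed (simp_all add: block_lborel_def)
  then show ?thesis by (simp add: block_lborel_def)
qed

lemma nn_integral_block_shift:
  assumes [measurable]: "h \<in> borel_measurable (\<Pi>\<^sub>M j\<in>{..<n}. borel)"
  shows "(\<integral>\<^sup>+x. h (block_shift n c x) \<partial>block_lborel n) = (\<integral>\<^sup>+x. h x \<partial>block_lborel n)"
  by (subst (2) block_lborel_shift[of n c, symmetric], subst nn_integral_distr) simp_all

lemma nn_integral_block_prod:
  fixes f :: "nat \<Rightarrow> real^'r \<Rightarrow> ennreal"
  assumes "\<And>j. j < n \<Longrightarrow> f j \<in> borel_measurable borel"
  shows "(\<integral>\<^sup>+x. (\<Prod>j<n. f j (x j)) \<partial>block_lborel n) = (\<Prod>j<n. \<integral>\<^sup>+x. f j x \<partial>lborel)"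
proof -
  interpret product_sigma_finite "\<lambda>_::nat. lborel :: (real^'r) measure" ..
  show ?thesis unfolding block_lborel_def using assms by (subst product_nn_integral_prod) auto
qed


lemma gauss_block_eq_density:
  fixes S :: "real^'r^'r"
  assumes S: "posdef S"
  shows "gauss_block n S = density (block_lborel n) (\<lambda>x. ennreal (block_density n S x))"
proof -
  interpret prob_space "gauss_measure S" using S by (rule prob_space_gauss_measure)
  interpret product_sigma_finite "\<lambda>_::nat. gauss_measure S" ..
  have "density (block_lborel n) (\<lambda>x. ennreal (block_density n S x)) = (\<Pi>\<^sub>M j\<in>{..<n}. gauss_measure S)"
  proof (rule PiM_eqI)
    show "sets (density (block_lborel n) (\<lambda>x. ennreal (block_density n S x))) = sets (\<Pi>\<^sub>M j\<in>{..<n}. gauss_measure S)"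
      using sets_gauss_block[of n S] by (simp add: sets_block_lborel gauss_block_def)
    fix A :: "nat \<Rightarrow> (real^'r) set" assume "\<And>j. j \<in> {..<n} \<Longrightarrow> A j \<in> sets (gauss_measure S)"
    then have A: "\<And>j. j < n \<Longrightarrow> A j \<in> sets borel" by simp
    have "emeasure (density (block_lborel n) (\<lambda>x. ennreal (block_density n S x))) (Pi\<^sub>E {..<n} A)
      = (\<integral>\<^sup>+x. ennreal (block_density n S x) * indicator (Pi\<^sub>E {..<n} A) x \<partial>block_lborel n)"
      using A by (intro emeasure_density) (auto simp: sets_block_lborel intro!: sets_PiM_I_finite)
    also have "\<dots> = (\<integral>\<^sup>+x. (\<Prod>j<n. ennreal (gauss_density S (x j)) * indicator (A j) (x j)) \<partial>block_lborel n)"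
    proof (intro nn_integral_cong)
      fix x :: "nat \<Rightarrow> real^'r" assume "x \<in> space (block_lborel n)"
      then have "indicator (Pi\<^sub>E {..<n} A) x = (\<Prod>j<n. indicator (A j) (x j) :: ennreal)"
        by (auto simp: indicator_def space_block PiE_iff prod_eq_1_iff)
      then show "ennreal (block_density n S x) * indicator (Pi\<^sub>E {..<n} A) x
         = (\<Prod>j<n. ennreal (gauss_density S (x j)) * indicator (A j) (x j))"
        by (simp add: block_density_def prod.distrib prod_ennreal gauss_density_nonneg S)
    qed
    also have "\<dots> = (\<Prod>j<n. emeasure (gauss_measure S) (A j))"
      using A by (subst nn_integral_block_prod) (auto intro!: prod.cong simp: gauss_measure_def emeasure_density)
    finally show "emeasure (density (block_lborel n) (\<lambda>x. ennreal (block_density n S x))) (Pi\<^sub>E {..<n} A)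
      = (\<Prod>j<n. emeasure (gauss_measure S) (A j))" .
  qed simp
  then show ?thesis by (simp add: gauss_block_def)
qed

lemma gauss_block_shift:
  fixes S :: "real^'r^'r"
  assumes S: "posdef S"
  shows "distr (gauss_block n S) (block_lborel n) (block_shift n c)
     = density (block_lborel n) (\<lambda>y. ennreal (block_density n S (\<lambda>j. y j - c j)))"
proof (rule measure_eqI)
  fix A assume "A \<in> sets (distr (gauss_block n S) (block_lborel n) (block_shift n c))"
  then have A[measurable]: "A \<in> sets (\<Pi>\<^sub>M j\<in>{..<n}. borel)" by (simp add: sets_block_lborel)
  have [measurable]: "A \<in> sets (block_lborel n)" by (simp add: sets_block_lborel)
  define h where "h y = ennreal (block_density n S (\<lambda>j. y j - c j)) * indicator A y" for y
  have [measurable]: "h \<in> borel_measurable (\<Pi>\<^sub>M j\<in>{..<n}. borel)" unfolding h_def by measurable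
  have "emeasure (distr (gauss_block n S) (block_lborel n) (block_shift n c)) A
     = (\<integral>\<^sup>+x. indicator A x \<partial>distr (gauss_block n S) (block_lborel n) (block_shift n c))" by simp
  also have "\<dots> = (\<integral>\<^sup>+x. indicator A (block_shift n c x) \<partial>gauss_block n S)" by (subst nn_integral_distr) simp_all
  also have "\<dots> = (\<integral>\<^sup>+x. ennreal (block_density n S x) * indicator A (block_shift n c x) \<partial>block_lborel n)"
    unfolding gauss_block_eq_density[OF S] by (subst nn_integral_density) simp_all
  also have "\<dots> = (\<integral>\<^sup>+x. h (block_shift n c x) \<partial>block_lborel n)"
    by (intro nn_integral_cong arg_cong2[where f = "(*)"] arg_cong[where f = ennreal])
       (auto simp: h_def block_shift_def intro!: block_density_cong arg_cong2[where f = "(*)"] arg_cong[where f = ennreal])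
  also have "\<dots> = (\<integral>\<^sup>+x. h x \<partial>block_lborel n)" by (rule nn_integral_block_shift) simp
  also have "\<dots> = emeasure (density (block_lborel n) (\<lambda>y. ennreal (block_density n S (\<lambda>j. y j - c j)))) A"
    unfolding h_def by (subst emeasure_density) simp_all
  finally show "emeasure (distr (gauss_block n S) (block_lborel n) (block_shift n c)) A
    = emeasure (density (block_lborel n) (\<lambda>y. ennreal (block_density n S (\<lambda>j. y j - c j)))) A" .
qed simp

lemma nn_integral_block_density_shift:
  assumes S: "posdef S"
  shows "(\<integral>\<^sup>+y. ennreal (block_density n S (\<lambda>j. y j - c j)) \<partial>block_lborel n) = 1"
proof -
  interpret prob_space "gauss_block n S" using S by (rule prob_space_gauss_block)
  have "emeasure (distr (gauss_block n S) (block_lborel n) (block_shift n c)) (space (block_lborel n)) = 1"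
    using prob_space.emeasure_space_1[OF prob_space_distr[of "block_shift n c" "block_lborel n"]] by simp
  then show ?thesis unfolding gauss_block_shift[OF S] by (subst (asm) emeasure_density) (simp_all cong: nn_integral_cong)
qed

lemma
  fixes h :: "(nat \<Rightarrow> real^'r) \<Rightarrow> real"
  assumes S: "posdef S" and I: "finite I"
    and [measurable]: "h \<in> borel_measurable (\<Pi>\<^sub>M j\<in>{..<n}. borel)"
    and int: "\<And>i. i \<in> I \<Longrightarrow> integrable (gauss_block n S) (\<lambda>z. h (block_shift n (c i) z))"
  shows integrable_mixture: "integrable (mixture n S I c) h"
    and integral_mixture: "(\<integral>y. h y \<partial>mixture n S I c) = (\<Sum>i\<in>I. \<integral>z. h (block_shift n (c i) z) \<partial>gauss_block n S) / real (card I)"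
proof -
  note S' = block_density_nonneg[OF S] mixture_density_nonneg[OF S]
  have 1: "integrable (block_lborel n) (\<lambda>y. block_density n S (\<lambda>j. y j - c i j) * h y)"
    "(\<integral>y. block_density n S (\<lambda>j. y j - c i j) * h y \<partial>block_lborel n) = (\<integral>z. h (block_shift n (c i) z) \<partial>gauss_block n S)"
    if "i \<in> I" for i
  proof -
    have "integrable (distr (gauss_block n S) (block_lborel n) (block_shift n (c i))) h"
      using int[OF that] by (subst integrable_distr_eq) simp_all
    then show "integrable (block_lborel n) (\<lambda>y. block_density n S (\<lambda>j. y j - c i j) * h y)"
      unfolding gauss_block_shift[OF S] by (subst (asm) integrable_density) (simp_all add: S')
    have "(\<integral>y. h y \<partial>distr (gauss_block n S) (block_lborel n) (block_shift n (c i))) = (\<integral>z. h (block_shift n (c i) z) \<partial>gauss_block n S)"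
      by (subst integral_distr) simp_all
    then show "(\<integral>y. block_density n S (\<lambda>j. y j - c i j) * h y \<partial>block_lborel n) = (\<integral>z. h (block_shift n (c i) z) \<partial>gauss_block n S)"
      unfolding gauss_block_shift[OF S] by (subst (asm) integral_density) (simp_all add: S')
  qed
  have eq: "mixture_density n S I c y * h y = (\<Sum>i\<in>I. block_density n S (\<lambda>j. y j - c i j) * h y) / real (card I)" for y
    by (simp add: mixture_density_def sum_distrib_right)
  show "integrable (mixture n S I c) h"
    unfolding mixture_def by (subst integrable_density) (simp_all add: S' eq 1)
  show "(\<integral>y. h y \<partial>mixture n S I c) = (\<Sum>i\<in>I. \<integral>z. h (block_shift n (c i) z) \<partial>gauss_block n S) / real (card I)"
    unfolding mixture_def by (subst integral_density) (simp_all add: S' eq 1)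
qed

lemma prob_space_mixture:
  assumes S: "posdef S" and I: "finite I" "I \<noteq> {}"
  shows "prob_space (mixture n S I c)"
proof (rule prob_spaceI)
  have "emeasure (mixture n S I c) (space (mixture n S I c)) = (\<integral>\<^sup>+y. ennreal (mixture_density n S I c y) \<partial>block_lborel n)"
    unfolding mixture_def by (subst emeasure_density) (simp_all cong: nn_integral_cong)
  also have "\<dots> = (\<integral>\<^sup>+y. ennreal (1 / real (card I)) * (\<Sum>i\<in>I. ennreal (block_density n S (\<lambda>j. y j - c i j))) \<partial>block_lborel n)"
    by (intro nn_integral_cong) (simp add: mixture_density_def sum_ennreal block_density_nonneg S sum_nonneg flip: ennreal_mult)
  also have "\<dots> = ennreal (1 / real (card I)) * of_nat (card I)"
    by (simp add: nn_integral_cmult nn_integral_sum nn_integral_block_density_shift[OF S])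
  also have "\<dots> = 1"
    using I by (simp add: ennreal_of_nat_eq_real_of_nat flip: ennreal_mult)
  finally show "emeasure (mixture n S I c) (space (mixture n S I c)) = 1" .
qed


lemma
  assumes S: "posdef S" and j: "j < n" and f: "integrable (gauss_measure S) (f :: real^'r \<Rightarrow> real)"
  shows integrable_gauss_block_component: "integrable (gauss_block n S) (\<lambda>z. f (z j))"
    and integral_gauss_block_component: "(\<integral>z. f (z j) \<partial>gauss_block n S) = (\<integral>z. f z \<partial>gauss_measure S)"
proof -
  have m: "(\<lambda>z. z j) \<in> gauss_block n S \<rightarrow>\<^sub>M gauss_measure S" using j unfolding gauss_block_def by simp
  have d: "distr (gauss_block n S) (gauss_measure S) (\<lambda>z. z j) = gauss_measure S"
    unfolding gauss_block_def using j S by (intro distr_PiM_component prob_space_gauss_measure) auto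
  note [measurable] = borel_measurable_integrable[OF f]
  show "integrable (gauss_block n S) (\<lambda>z. f (z j))"
    using integrable_distr_eq[OF m, of f] f by (simp add: d)
  show "(\<integral>z. f (z j) \<partial>gauss_block n S) = (\<integral>z. f z \<partial>gauss_measure S)"
    using integral_distr[OF m, of f] f by (simp add: d)
qed

lemma integrable_gauss_measure_quadratic:
  fixes S Q :: "real^'r^'r"
  assumes S: "posdef S"
  shows "integrable (gauss_measure S) (\<lambda>z. (z + e) \<bullet> (Q *v (z + e)))"
proof -
  obtain L :: "real^'r^'r" where L: "S = L ** transpose L" "invertible L" by (rule posdef_factor[OF S])
  show ?thesis unfolding L(1) gauss_measure_eq_distr[OF L(2)]
    by (subst integrable_distr_eq)
      (simp_all add: integrable_std_gaussian_vec_quadratic measurable_cong_sets[OF sets_std_gaussian_vec refl])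
qed

lemma ln_gauss_density:
  fixes S :: "real^'r^'r"
  assumes S: "posdef S"
  shows "ln (gauss_density S x) = - (x \<bullet> (matrix_inv S *v x)) / 2 - ln ((2*pi) ^ CARD('r) * det S) / 2"
  using posdef_det_pos[OF S] by (simp add: gauss_density_def ln_div ln_sqrt)

lemma ln_block_density:
  fixes G :: "real^'r^'r"
  assumes G: "posdef G"
  shows "ln (block_density n G y) = - (\<Sum>j<n. y j \<bullet> (matrix_inv G *v y j)) / 2 - real n * ln ((2*pi) ^ CARD('r) * det G) / 2"
proof -
  have "ln (block_density n G y) = (\<Sum>j<n. ln (gauss_density G (y j)))"
    unfolding block_density_def by (rule ln_prod) (use gauss_density_pos[OF G, THEN less_imp_neq] in auto)
  then show ?thesis by (simp add: ln_gauss_density[OF G] sum_subtractf sum_negf sum_divide_distrib)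
qed

lemma integrable_mixture_quadratic:
  fixes S Q :: "real^'r^'r"
  assumes S: "posdef S" and I: "finite I"
  shows "integrable (mixture n S I c) (\<lambda>y. \<Sum>j<n. (y j - d j) \<bullet> (Q *v (y j - d j)))"
proof (rule integrable_mixture[OF S I])
  fix i
  have "integrable (gauss_block n S) (\<lambda>z. \<Sum>j<n. (z j + (c i j - d j)) \<bullet> (Q *v (z j + (c i j - d j))))"
    using integrable_gauss_block_component[OF S _ integrable_gauss_measure_quadratic[OF S]]
    by (intro Bochner_Integration.integrable_sum) simp
  then show "integrable (gauss_block n S) (\<lambda>z. \<Sum>j<n. (block_shift n (c i) z j - d j) \<bullet> (Q *v (block_shift n (c i) z j - d j)))"
    by (rule back_subst[where P = "integrable _"])
       (auto simp: block_shift_def algebra_simps fun_eq_iff intro!: sum.cong)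
qed measurable

text \<open>The noise has mean zero, so a quadratic form sees the codewords only through their
  second moments. This is how the Gaussian reference densities are evaluated under the true
  law.\<close>

lemma integral_mixture_quadratic:
  fixes Q :: "real^'r^'r"
  assumes I: "finite I" "I \<noteq> {}"
  shows "(\<integral>y. (\<Sum>j<n. y j \<bullet> (Q *v y j)) \<partial>mixture n (mat 1) I c)
    = real n * trace Q + (\<Sum>i\<in>I. \<Sum>j<n. c i j \<bullet> (Q *v c i j)) / real (card I)"
proof -
  note S = posdef_mat_1
  have e: "(\<Sum>j<n. block_shift n (c i) z j \<bullet> (Q *v block_shift n (c i) z j)) = (\<Sum>j<n. (z j + c i j) \<bullet> (Q *v (z j + c i j)))" for i z
    by (auto simp: block_shift_def intro!: sum.cong)
  have int: "integrable (gauss_measure (mat 1)) (\<lambda>z. (z + e) \<bullet> (Q *v (z + e)))" for e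
    by (rule integrable_gauss_measure_quadratic[OF S])
  have iv: "(\<integral>z. (z + e) \<bullet> (Q *v (z + e)) \<partial>gauss_measure (mat 1)) = trace Q + e \<bullet> (Q *v e)" for e
    using integral_std_gaussian_vec_quadratic[of "mat 1" e Q] by (simp add: std_gaussian_vec_eq)
  have "(\<integral>y. (\<Sum>j<n. y j \<bullet> (Q *v y j)) \<partial>mixture n (mat 1) I c)
    = (\<Sum>i\<in>I. \<integral>z. (\<Sum>j<n. (z j + c i j) \<bullet> (Q *v (z j + c i j))) \<partial>gauss_block n (mat 1)) / real (card I)"
    unfolding e[symmetric]
    by (rule integral_mixture[OF S I(1)])
       (auto simp: e intro!: Bochner_Integration.integrable_sum integrable_gauss_block_component[OF S _ int])
  also have "\<dots> = (\<Sum>i\<in>I. \<Sum>j<n. trace Q + c i j \<bullet> (Q *v c i j)) / real (card I)"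
    by (subst Bochner_Integration.integral_sum)
       (auto intro!: integrable_gauss_block_component[OF S _ int] simp: integral_gauss_block_component[OF S _ int] iv)
  also have "\<dots> = real n * trace Q + (\<Sum>i\<in>I. \<Sum>j<n. c i j \<bullet> (Q *v c i j)) / real (card I)"
    using I by (simp add: sum.distrib add_divide_distrib)
  finally show ?thesis .
qed

lemma integrable_mixture_ln_block_density:
  fixes S G :: "real^'r^'r"
  assumes S: "posdef S" and I: "finite I" "I \<noteq> {}" and G: "posdef G"
  shows "integrable (mixture n S I c) (\<lambda>y. ln (block_density n G (\<lambda>j. y j - d j)))"
proof -
  interpret prob_space "mixture n S I c" using S I by (rule prob_space_mixture)
  show ?thesis unfolding ln_block_density[OF G]
    using integrable_mixture_quadratic[OF S I(1), of n c d "matrix_inv G"] by simp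
qed

text \<open>The density is at most the peak value of one component, and at least one component
  divided by \<open>card J\<close>. The logarithm of the first bound is constant and that of the
  second is quadratic, so both are integrable.\<close>

lemma integrable_mixture_ln_mixture_density:
  fixes S T :: "real^'r^'r"
  assumes S: "posdef S" and I: "finite I" "I \<noteq> {}" and T: "posdef T" and J: "finite J" "J \<noteq> {}"
  shows "integrable (mixture n S I c) (\<lambda>y. ln (mixture_density n T J d y))"
proof -
  interpret prob_space "mixture n S I c" using S I by (rule prob_space_mixture)
  obtain i0 where i0: "i0 \<in> J" using J by auto
  define k where "k = (1 / sqrt ((2*pi) ^ CARD('r) * det T)) ^ n"
  have k0: "0 < k" unfolding k_def using posdef_det_pos[OF T] by simp
  have k: "block_density n T z \<le> k" for z
  proof -
    have "(\<Prod>j<n. gauss_density T (z j)) \<le> (\<Prod>j<n. 1 / sqrt ((2*pi) ^ CARD('r) * det T))"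
    proof (intro prod_mono conjI gauss_density_nonneg[OF T])
      fix j
      have "exp (- (z j \<bullet> (matrix_inv T *v z j)) / 2) \<le> 1"
        using posdef_imp_psd[OF posdef_matrix_inv[OF T]] by (simp add: psd_def)
      then show "gauss_density T (z j) \<le> 1 / sqrt ((2*pi) ^ CARD('r) * det T)"
        unfolding gauss_density_def using posdef_det_pos[OF T] by (intro divide_right_mono) auto
    qed
    then show ?thesis by (simp add: block_density_def k_def)
  qed
  define lo where "lo y = ln (block_density n T (\<lambda>j. y j - d i0 j)) - ln (real (card J))" for y
  have cJ: "0 < real (card J)" using J by (simp add: card_gt_0_iff)
  have low: "lo y \<le> ln (mixture_density n T J d y)" for y
  proof -
    have "lo y = ln (block_density n T (\<lambda>j. y j - d i0 j) / real (card J))"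
      using cJ block_density_pos[OF T, THEN less_imp_neq, of n "\<lambda>j. y j - d i0 j"] by (simp add: lo_def ln_div)
    also have "\<dots> \<le> ln (mixture_density n T J d y)"
    proof (rule ln_mono)
      show "block_density n T (\<lambda>j. y j - d i0 j) / real (card J) \<le> mixture_density n T J d y"
        unfolding mixture_density_def using i0 J block_density_nonneg[OF T]
        by (intro divide_right_mono member_le_sum) auto
    qed (use cJ block_density_pos[OF T] mixture_density_pos[OF T J] in auto)
    finally show ?thesis .
  qed
  have up: "ln (mixture_density n T J d y) \<le> ln k" for y
  proof (rule ln_mono)
    have "(\<Sum>i\<in>J. block_density n T (\<lambda>j. y j - d i j)) \<le> (\<Sum>i\<in>J. k)" by (intro sum_mono k)
    then show "mixture_density n T J d y \<le> k"
      unfolding mixture_density_def using cJ by (simp add: divide_le_eq mult.commute)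
  qed (use k0 mixture_density_pos[OF T J] in auto)
  show ?thesis
  proof (rule Bochner_Integration.integrable_bound)
    show "integrable (mixture n S I c) (\<lambda>y. \<bar>lo y\<bar> + \<bar>ln k\<bar>)"
      unfolding lo_def using integrable_mixture_ln_block_density[OF S I T, of n c "d i0"] by simp
    show "AE y in mixture n S I c. norm (ln (mixture_density n T J d y)) \<le> norm (\<bar>lo y\<bar> + \<bar>ln k\<bar>)"
      using low up by (intro AE_I2) (smt (verit) real_norm_def)
  qed measurable
qed

text \<open>
  Every entropy inequality of the converse is an instance, with \<open>r\<close> the quotient of a second
  probability density by the true one.
\<close>

lemma expectation_ln_le_0:
  assumes P: "prob_space P" and I: "finite I"
    and r: "\<And>i x. i \<in> I \<Longrightarrow> 0 < r i x" and [measurable]: "\<And>i. i \<in> I \<Longrightarrow> r i \<in> borel_measurable P"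
    and int: "\<And>i. i \<in> I \<Longrightarrow> integrable P (\<lambda>x. ln (r i x))"
    and le: "(\<Sum>i\<in>I. \<integral>\<^sup>+x. ennreal (r i x) \<partial>P) \<le> of_nat (card I)"
  shows "(\<Sum>i\<in>I. \<integral>x. ln (r i x) \<partial>P) \<le> 0"
proof -
  interpret prob_space P by fact
  have fin: "(\<integral>\<^sup>+x. ennreal (r i x) \<partial>P) < \<infinity>" if "i \<in> I" for i
  proof -
    have "(\<integral>\<^sup>+x. ennreal (r i x) \<partial>P) \<le> (\<Sum>i\<in>I. \<integral>\<^sup>+x. ennreal (r i x) \<partial>P)"
      using that I by (intro member_le_sum) auto
    also have "\<dots> \<le> of_nat (card I)" by (rule le)
    finally show ?thesis by (metis ennreal_of_nat_neq_top infinity_ennreal_def less_top top.not_eq_extremum top_unique)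
  qed
  have ir: "integrable P (r i)" if "i \<in> I" for i
    using fin[OF that] r[OF that] that by (intro integrableI_nonneg) (auto intro!: AE_I2 less_imp_le)
  have "(\<Sum>i\<in>I. \<integral>x. ln (r i x) \<partial>P) \<le> (\<Sum>i\<in>I. (\<integral>x. r i x \<partial>P) - 1)"
  proof (rule sum_mono)
    fix i assume i: "i \<in> I"
    have "(\<integral>x. ln (r i x) \<partial>P) \<le> (\<integral>x. r i x - 1 \<partial>P)"
      using i r ir int by (intro integral_mono) (auto intro!: ln_le_minus_one)
    then show "(\<integral>x. ln (r i x) \<partial>P) \<le> (\<integral>x. r i x \<partial>P) - 1"
      using ir[OF i] by (simp add: prob_space)
  qed
  also have "\<dots> = (\<Sum>i\<in>I. \<integral>x. r i x \<partial>P) - real (card I)" by (simp add: sum_subtractf)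
  also have "\<dots> \<le> 0"
  proof -
    have "ennreal (\<Sum>i\<in>I. \<integral>x. r i x \<partial>P) = (\<Sum>i\<in>I. ennreal (\<integral>x. r i x \<partial>P))"
      using r by (intro sum_ennreal[symmetric] integral_nonneg_AE) (auto intro!: AE_I2 less_imp_le)
    also have "\<dots> = (\<Sum>i\<in>I. \<integral>\<^sup>+x. ennreal (r i x) \<partial>P)"
      using r ir by (intro sum.cong refl nn_integral_eq_integral[symmetric]) (auto intro!: AE_I2 less_imp_le)
    also note le
    finally show ?thesis by (simp add: ennreal_of_nat_eq_real_of_nat)
  qed
  finally show ?thesis .
qed


section \<open>Relative entropies of Gaussian mixtures\<close>

lemma block_bayes:
  fixes S :: "real^'n^'n" and T :: "real^'m^'m" and C :: "real^'n^'m"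
  assumes S: "posdef S" and T: "posdef T"
  defines "G \<equiv> T + C ** S ** transpose C"
  defines "B \<equiv> S ** transpose C ** matrix_inv G"
  defines "V \<equiv> S - B ** G ** transpose B"
  shows "block_density n S \<nu> * block_density n T (\<lambda>j. w j - C *v \<nu> j)
    = block_density n G w * block_density n V (\<lambda>j. \<nu> j - B *v w j)"
  unfolding block_density_def prod.distrib[symmetric] G_def B_def V_def
  by (intro prod.cong refl gauss_bayes S T)

text \<open>By \<open>block_bayes\<close> the integrand is the density of the sum at
  \<open>w\<close> times a translated probability density in \<open>\<nu>\<close>.\<close>

lemma nn_integral_block_conv:
  fixes S :: "real^'n^'n" and T :: "real^'m^'m" and C :: "real^'n^'m"
  assumes S: "posdef S" and T: "posdef T"
  shows "(\<integral>\<^sup>+\<nu>. ennreal (block_density n S \<nu> * block_density n T (\<lambda>j. w j - C *v \<nu> j)) \<partial>block_lborel n)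
    = ennreal (block_density n (T + C ** S ** transpose C) w)"
  unfolding block_bayes[OF S T]
  by (simp add: ennreal_mult block_density_nonneg gauss_bayes_posdef[OF S T] nn_integral_cmult
      nn_integral_block_density_shift)

lemma nn_integral_mixture_conv:
  fixes S :: "real^'n^'n" and T :: "real^'m^'m" and C :: "real^'n^'m"
  assumes S: "posdef S" and T: "posdef T"
  shows "(\<integral>\<^sup>+\<nu>. ennreal (block_density n S \<nu> * mixture_density n T J c (\<lambda>j. w j - C *v \<nu> j)) \<partial>block_lborel n)
    = ennreal (mixture_density n (T + C ** S ** transpose C) J c w)"
proof -
  have "ennreal (block_density n S \<nu> * mixture_density n T J c (\<lambda>j. w j - C *v \<nu> j))
    = ennreal (1 / real (card J)) * (\<Sum>i\<in>J. ennreal (block_density n S \<nu> * block_density n T (\<lambda>j. (w j - c i j) - C *v \<nu> j)))" for \<nu>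
    by (simp add: mixture_density_def sum_ennreal block_density_nonneg S T sum_nonneg sum_distrib_left sum_divide_distrib algebra_simps flip: ennreal_mult)
  then have "(\<integral>\<^sup>+\<nu>. ennreal (block_density n S \<nu> * mixture_density n T J c (\<lambda>j. w j - C *v \<nu> j)) \<partial>block_lborel n)
    = ennreal (1 / real (card J)) * (\<Sum>i\<in>J. ennreal (block_density n (T + C ** S ** transpose C) (\<lambda>j. w j - c i j)))"
    by (simp add: nn_integral_cmult nn_integral_sum nn_integral_block_conv[OF S T])
  also have "\<dots> = ennreal (mixture_density n (T + C ** S ** transpose C) J c w)"
    by (simp add: mixture_density_def sum_ennreal block_density_nonneg gauss_bayes_posdef[OF S T] sum_nonneg flip: ennreal_mult)
  finally show ?thesis .
qed

text \<open>Passing to Lebesgue integrals makes translations and the exchange of the order of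
  integration available for the quotients below.\<close>

lemma nn_integral_gauss_block_mixture:
  fixes S :: "real^'n^'n" and T :: "real^'m^'m"
  assumes S: "posdef S" and T: "posdef T" and J: "finite J" "J \<noteq> {}"
    and [measurable]: "h \<in> borel_measurable ((\<Pi>\<^sub>M j\<in>{..<n}. borel) \<Otimes>\<^sub>M (\<Pi>\<^sub>M j\<in>{..<n}. borel))"
  shows "(\<integral>\<^sup>+x. h x \<partial>(gauss_block n S \<Otimes>\<^sub>M mixture n T J c))
    = (\<integral>\<^sup>+\<nu>. \<integral>\<^sup>+t. ennreal (block_density n S \<nu> * mixture_density n T J c t) * h (\<nu>, t) \<partial>block_lborel n \<partial>block_lborel n)"
proof -
  interpret sigma_finite_measure "block_lborel n :: (nat \<Rightarrow> real^'m) measure" by (rule sigma_finite_block_lborel)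
  interpret M: prob_space "mixture n T J c" using T J by (rule prob_space_mixture)
  have hm: "(\<lambda>t. h (\<nu>, t)) \<in> borel_measurable (\<Pi>\<^sub>M j\<in>{..<n}. borel)" if "\<nu> \<in> extensional {..<n}" for \<nu>
    using that by (intro measurable_compose[OF measurable_Pair1' assms(5)]) (simp add: space_PiM PiE_def)
  have hm': "(\<lambda>t. h (\<nu>, t)) \<in> borel_measurable (block_lborel n)" if "\<nu> \<in> extensional {..<n}" for \<nu>
    using hm[OF that] by (simp add: measurable_cong_sets[OF sets_block_lborel refl])
  have "(\<integral>\<^sup>+x. h x \<partial>(gauss_block n S \<Otimes>\<^sub>M mixture n T J c))
     = (\<integral>\<^sup>+\<nu>. \<integral>\<^sup>+t. h (\<nu>, t) \<partial>mixture n T J c \<partial>gauss_block n S)"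
    by (rule M.nn_integral_fst[symmetric]) simp
  also have "\<dots> = (\<integral>\<^sup>+\<nu>. \<integral>\<^sup>+t. ennreal (mixture_density n T J c t) * h (\<nu>, t) \<partial>block_lborel n \<partial>gauss_block n S)"
    unfolding mixture_def by (intro nn_integral_cong, subst nn_integral_density) (simp_all add: space_block hm')
  also have "\<dots> = (\<integral>\<^sup>+\<nu>. ennreal (block_density n S \<nu>) * (\<integral>\<^sup>+t. ennreal (mixture_density n T J c t) * h (\<nu>, t) \<partial>block_lborel n) \<partial>block_lborel n)"
    unfolding gauss_block_eq_density[OF S] by (subst nn_integral_density) simp_all
  also have "\<dots> = (\<integral>\<^sup>+\<nu>. \<integral>\<^sup>+t. ennreal (block_density n S \<nu> * mixture_density n T J c t) * h (\<nu>, t) \<partial>block_lborel n \<partial>block_lborel n)"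
    by (intro nn_integral_cong, subst nn_integral_cmult[symmetric])
       (auto simp: ennreal_mult block_density_nonneg mixture_density_nonneg S T mult.assoc space_block intro!: borel_measurable_times_ennreal hm')
  finally show ?thesis .
qed

text \<open>Noise can be split without touching the codewords: by
  \<open>nn_integral_mixture_conv\<close>, adding \<open>C *v \<nu>\<close> widens every component.
  Integrals under the law of interference plus noise can then be taken on a space that also carries
  the genie noise.\<close>

lemma distr_gauss_block_mixture:
  fixes S :: "real^'n^'n" and T :: "real^'m^'m" and C :: "real^'n^'m"
  assumes S: "posdef S" and T: "posdef T" and J: "finite J" "J \<noteq> {}"
  shows "distr (gauss_block n S \<Otimes>\<^sub>M mixture n T J c) (block_lborel n) (\<lambda>x. block_shift n (\<lambda>j. C *v fst x j) (snd x))
    = mixture n (T + C ** S ** transpose C) J c"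
    (is "distr ?P _ ?w = ?Q")
proof (rule measure_eqI)
  interpret p: pair_sigma_finite "block_lborel n :: (nat \<Rightarrow> real^'m) measure" "block_lborel n :: (nat \<Rightarrow> real^'n) measure"
    by (simp add: pair_sigma_finite_def sigma_finite_block_lborel)
  fix A assume "A \<in> sets (distr ?P (block_lborel n) ?w)"
  then have A[measurable]: "A \<in> sets (\<Pi>\<^sub>M j\<in>{..<n}. borel)" by (simp add: sets_block_lborel)
  have [measurable]: "A \<in> sets (block_lborel n)" by (simp add: sets_block_lborel)
  have [measurable]: "?w \<in> ?P \<rightarrow>\<^sub>M (\<Pi>\<^sub>M j\<in>{..<n}. borel)" unfolding block_shift_def by measurable
  have [measurable]: "(\<lambda>x. block_shift n (\<lambda>j. C *v fst x j) (snd x)) \<in> ((\<Pi>\<^sub>M j\<in>{..<n}. borel) \<Otimes>\<^sub>M (\<Pi>\<^sub>M j\<in>{..<n}. borel)) \<rightarrow>\<^sub>M (\<Pi>\<^sub>M j\<in>{..<n}. borel)"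
    unfolding block_shift_def by measurable
  have "emeasure (distr ?P (block_lborel n) ?w) A = (\<integral>\<^sup>+x. indicator A (?w x) \<partial>?P)"
    by (subst nn_integral_indicator[symmetric], simp, subst nn_integral_distr) simp_all
  also have "\<dots> = (\<integral>\<^sup>+\<nu>. \<integral>\<^sup>+t. ennreal (block_density n S \<nu> * mixture_density n T J c t) * indicator A (block_shift n (\<lambda>j. C *v \<nu> j) t) \<partial>block_lborel n \<partial>block_lborel n)"
    by (subst nn_integral_gauss_block_mixture[OF S T J]) simp_all
  also have "\<dots> = (\<integral>\<^sup>+\<nu>. \<integral>\<^sup>+w. ennreal (block_density n S \<nu> * mixture_density n T J c (\<lambda>j. w j - C *v \<nu> j)) * indicator A w \<partial>block_lborel n \<partial>block_lborel n)"
  proof (rule nn_integral_cong)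
    fix \<nu> :: "nat \<Rightarrow> real^'n"
    have "(\<integral>\<^sup>+t. ennreal (block_density n S \<nu> * mixture_density n T J c t) * indicator A (block_shift n (\<lambda>j. C *v \<nu> j) t) \<partial>block_lborel n)
      = (\<integral>\<^sup>+t. ennreal (block_density n S \<nu> * mixture_density n T J c (\<lambda>j. block_shift n (\<lambda>j. C *v \<nu> j) t j - C *v \<nu> j)) * indicator A (block_shift n (\<lambda>j. C *v \<nu> j) t) \<partial>block_lborel n)"
      by (intro nn_integral_cong arg_cong2[where f = "(*)"] arg_cong[where f = ennreal] refl mixture_density_cong)
         (simp add: block_shift_def)
    also have "\<dots> = (\<integral>\<^sup>+w. ennreal (block_density n S \<nu> * mixture_density n T J c (\<lambda>j. w j - C *v \<nu> j)) * indicator A w \<partial>block_lborel n)"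
      by (rule nn_integral_block_shift) simp
    finally show "(\<integral>\<^sup>+t. ennreal (block_density n S \<nu> * mixture_density n T J c t) * indicator A (block_shift n (\<lambda>j. C *v \<nu> j) t) \<partial>block_lborel n) = \<dots>" .
  qed
  also have "\<dots> = (\<integral>\<^sup>+w. \<integral>\<^sup>+\<nu>. ennreal (block_density n S \<nu> * mixture_density n T J c (\<lambda>j. w j - C *v \<nu> j)) * indicator A w \<partial>block_lborel n \<partial>block_lborel n)"
    by (rule p.Fubini') simp
  also have "\<dots> = (\<integral>\<^sup>+w. ennreal (mixture_density n (T + C ** S ** transpose C) J c w) * indicator A w \<partial>block_lborel n)"
    by (intro nn_integral_cong) (simp add: nn_integral_multc nn_integral_mixture_conv[OF S T])
  also have "\<dots> = emeasure ?Q A" unfolding mixture_def by (subst emeasure_density) simp_all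
  finally show "emeasure (distr ?P (block_lborel n) ?w) A = emeasure ?Q A" .
qed (simp add: sets_block_lborel sets_mixture)

text \<open>Relative entropy of the mixture to \<open>n\<close> independent copies of the centered
  Gaussian of covariance \<open>G\<close>; this is the \<open>D\<close> of the overview.\<close>

definition mixture_kl ::
  "nat \<Rightarrow> real^'r^'r \<Rightarrow> 'i set \<Rightarrow> ('i \<Rightarrow> nat \<Rightarrow> real^'r) \<Rightarrow> real^'r^'r \<Rightarrow> real" where
  "mixture_kl n S I c G = (\<integral>y. ln (mixture_density n S I c y) - ln (block_density n G y) \<partial>mixture n S I c)"

lemma integrable_mixture_ln_ratio:
  fixes S G :: "real^'r^'r"
  assumes "posdef S" "finite I" "I \<noteq> {}" "posdef T" "finite J" "J \<noteq> {}" "posdef G"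
  shows "integrable (mixture n S I c) (\<lambda>y. ln (mixture_density n T J d y) - ln (block_density n G y))"
  using integrable_mixture_ln_mixture_density[OF assms(1-6)] integrable_mixture_ln_block_density[OF assms(1-3,7), of n c "\<lambda>_. 0"]
  by simp

text \<open>Conditioned on the desired codeword, the received signal is a translate of interference
  plus noise; its law averages these translates.\<close>

lemma mixture_density_shift:
  "mixture_density n S (I \<times> J) (\<lambda>(i, l) j. a i j + c l j) y = (\<Sum>i\<in>I. mixture_density n S J c (\<lambda>j. y j - a i j)) / real (card I)"
  by (simp add: mixture_density_def sum.cartesian_product card_cartesian_product case_prod_unfold algebra_simps
      flip: sum_divide_distrib)

lemma
  fixes h :: "(nat \<Rightarrow> real^'r) \<Rightarrow> real"
  assumes S: "posdef S" and I: "finite I" "I \<noteq> {}" and J: "finite J" "J \<noteq> {}"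
    and [measurable]: "h \<in> borel_measurable (\<Pi>\<^sub>M j\<in>{..<n}. borel)"
    and h: "integrable (mixture n S (I \<times> J) (\<lambda>(i, l) j. a i j + c l j)) h"
  shows integrable_mixture_shift: "i \<in> I \<Longrightarrow> integrable (mixture n S J c) (\<lambda>w. h (block_shift n (a i) w))"
    and integral_mixture_shift: "(\<Sum>i\<in>I. \<integral>w. h (block_shift n (a i) w) \<partial>mixture n S J c)
      = real (card I) * (\<integral>y. h y \<partial>mixture n S (I \<times> J) (\<lambda>(i, l) j. a i j + c l j))"
proof -
  note nn = mixture_density_nonneg[OF S] block_density_nonneg[OF S]
  have cI: "0 < real (card I)" using I by (simp add: card_gt_0_iff)
  have iy: "integrable (block_lborel n) (\<lambda>y. mixture_density n S (I \<times> J) (\<lambda>(i, l) j. a i j + c l j) y * h y)"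
    using h unfolding mixture_def by (subst (asm) integrable_density) (simp_all add: nn)
  \<comment> \<open>A single translate is at most \<open>card I\<close> times their average, so
    integrability under the received law passes to each codeword.\<close>
  have i1: "integrable (block_lborel n) (\<lambda>y. mixture_density n S J c (\<lambda>j. y j - a i j) * h y)" if "i \<in> I" for i
  proof (rule Bochner_Integration.integrable_bound)
    show "integrable (block_lborel n) (\<lambda>y. real (card I) * (mixture_density n S (I \<times> J) (\<lambda>(i, l) j. a i j + c l j) y * h y))"
      using iy by simp
    show "AE y in block_lborel n. norm (mixture_density n S J c (\<lambda>j. y j - a i j) * h y)
      \<le> norm (real (card I) * (mixture_density n S (I \<times> J) (\<lambda>(i, l) j. a i j + c l j) y * h y))"
    proof (intro AE_I2)
      fix y
      have "mixture_density n S J c (\<lambda>j. y j - a i j) \<le> (\<Sum>i\<in>I. mixture_density n S J c (\<lambda>j. y j - a i j))"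
        using that I nn by (intro member_le_sum) auto
      also have "\<dots> = real (card I) * mixture_density n S (I \<times> J) (\<lambda>(i, l) j. a i j + c l j) y"
        using cI by (simp add: mixture_density_shift)
      finally show "norm (mixture_density n S J c (\<lambda>j. y j - a i j) * h y)
        \<le> norm (real (card I) * (mixture_density n S (I \<times> J) (\<lambda>(i, l) j. a i j + c l j) y * h y))"
        by (simp add: abs_mult mult.assoc[symmetric] mult_right_mono abs_of_nonneg nn)
    qed
  qed measurable
  have sh: "mixture_density n S J c w = mixture_density n S J c (\<lambda>j. block_shift n (a i) w j - a i j)" for w i
    by (rule mixture_density_cong) (simp add: block_shift_def)
  have i2: "integrable (mixture n S J c) (\<lambda>w. h (block_shift n (a i) w))"
    "(\<integral>w. h (block_shift n (a i) w) \<partial>mixture n S J c) = (\<integral>y. mixture_density n S J c (\<lambda>j. y j - a i j) * h y \<partial>block_lborel n)"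
    if "i \<in> I" for i
  proof -
    have "integrable (distr (block_lborel n) (block_lborel n) (block_shift n (a i))) (\<lambda>y. mixture_density n S J c (\<lambda>j. y j - a i j) * h y)"
      unfolding block_lborel_shift using i1[OF that] .
    then have "integrable (block_lborel n) (\<lambda>w. mixture_density n S J c w * h (block_shift n (a i) w))"
      by (subst (asm) integrable_distr_eq) (simp_all flip: sh)
    then show "integrable (mixture n S J c) (\<lambda>w. h (block_shift n (a i) w))"
      unfolding mixture_def by (subst integrable_density) (simp_all add: nn)
    have "(\<integral>y. mixture_density n S J c (\<lambda>j. y j - a i j) * h y \<partial>distr (block_lborel n) (block_lborel n) (block_shift n (a i)))
      = (\<integral>w. mixture_density n S J c w * h (block_shift n (a i) w) \<partial>block_lborel n)"
      by (subst integral_distr) (simp_all flip: sh)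
    then show "(\<integral>w. h (block_shift n (a i) w) \<partial>mixture n S J c) = (\<integral>y. mixture_density n S J c (\<lambda>j. y j - a i j) * h y \<partial>block_lborel n)"
      unfolding mixture_def block_lborel_shift by (subst integral_density) (simp_all add: nn)
  qed
  show "i \<in> I \<Longrightarrow> integrable (mixture n S J c) (\<lambda>w. h (block_shift n (a i) w))" by (rule i2)
  have "(\<Sum>i\<in>I. \<integral>w. h (block_shift n (a i) w) \<partial>mixture n S J c)
     = (\<integral>y. (\<Sum>i\<in>I. mixture_density n S J c (\<lambda>j. y j - a i j) * h y) \<partial>block_lborel n)"
    by (subst Bochner_Integration.integral_sum) (simp_all add: i1 i2)
  also have "\<dots> = (\<integral>y. real (card I) * (mixture_density n S (I \<times> J) (\<lambda>(i, l) j. a i j + c l j) y * h y) \<partial>block_lborel n)"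
    using cI by (simp add: mixture_density_shift sum_distrib_right)
  also have "\<dots> = real (card I) * (\<integral>y. h y \<partial>mixture n S (I \<times> J) (\<lambda>(i, l) j. a i j + c l j))"
    unfolding mixture_def by (subst integral_density) (simp_all add: nn)
  finally show "(\<Sum>i\<in>I. \<integral>w. h (block_shift n (a i) w) \<partial>mixture n S J c)
      = real (card I) * (\<integral>y. h y \<partial>mixture n S (I \<times> J) (\<lambda>(i, l) j. a i j + c l j))" .
qed


lemma block_density_block_shift: "block_density n S (block_shift n c x) = block_density n S (\<lambda>j. x j + c j)"
  by (rule block_density_cong) (simp add: block_shift_def)

lemma mixture_density_block_shift: "mixture_density n S I d (block_shift n c x) = mixture_density n S I d (\<lambda>j. x j + c j)"
  by (rule mixture_density_cong) (simp add: block_shift_def)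


lemma block_shift_inverse: "t \<in> extensional {..<n} \<Longrightarrow> block_shift n c (block_shift n (\<lambda>j. - c j) t) = t"
  by (auto simp: block_shift_def fun_eq_iff extensional_def)


lemma nn_integral_mixture_density:
  assumes S: "posdef S" and I: "finite I" "I \<noteq> {}"
  shows "(\<integral>\<^sup>+y. ennreal (mixture_density n S I c y) \<partial>block_lborel n) = 1"
  using prob_space.emeasure_space_1[OF prob_space_mixture[OF S I, of n c]]
  unfolding mixture_def by (subst (asm) emeasure_density) (simp_all cong: nn_integral_cong)

lemma mixture_singleton:
  "posdef S \<Longrightarrow> mixture n S {i} b = distr (gauss_block n S) (block_lborel n) (block_shift n (b i))"
  by (simp add: mixture_def mixture_density_def gauss_block_shift)

lemma
  fixes h :: "(nat \<Rightarrow> real^'m) \<Rightarrow> real" and S :: "real^'n^'n" and T :: "real^'m^'m" and C :: "real^'n^'m"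
  assumes S: "posdef S" and T: "posdef T" and J: "finite J" "J \<noteq> {}"
    and [measurable]: "h \<in> borel_measurable (\<Pi>\<^sub>M j\<in>{..<n}. borel)"
    and h: "integrable (mixture n (T + C ** S ** transpose C) J c) h"
  shows integrable_gauss_block_mixture: "integrable (gauss_block n S \<Otimes>\<^sub>M mixture n T J c) (\<lambda>x. h (block_shift n (\<lambda>j. C *v fst x j) (snd x)))"
    and integral_gauss_block_mixture: "(\<integral>x. h (block_shift n (\<lambda>j. C *v fst x j) (snd x)) \<partial>(gauss_block n S \<Otimes>\<^sub>M mixture n T J c))
      = (\<integral>w. h w \<partial>mixture n (T + C ** S ** transpose C) J c)"
proof -
  have w: "(\<lambda>x. block_shift n (\<lambda>j. C *v fst x j) (snd x)) \<in> gauss_block n S \<Otimes>\<^sub>M mixture n T J c \<rightarrow>\<^sub>M block_lborel n"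
    unfolding block_shift_def by measurable
  note d = distr_gauss_block_mixture[OF S T J, of n c C]
  show "integrable (gauss_block n S \<Otimes>\<^sub>M mixture n T J c) (\<lambda>x. h (block_shift n (\<lambda>j. C *v fst x j) (snd x)))"
    using integrable_distr_eq[OF w, of h] h by (simp add: d)
  show "(\<integral>x. h (block_shift n (\<lambda>j. C *v fst x j) (snd x)) \<partial>(gauss_block n S \<Otimes>\<^sub>M mixture n T J c))
      = (\<integral>w. h w \<partial>mixture n (T + C ** S ** transpose C) J c)"
    using integral_distr[OF w, of h] by (simp add: d)
qed

lemma integral_pair_snd:
  fixes h :: "'b \<Rightarrow> real"
  assumes M: "prob_space M" and N: "prob_space N" and h: "integrable N h"
  shows "integrable (M \<Otimes>\<^sub>M N) (\<lambda>x. h (snd x))" "(\<integral>x. h (snd x) \<partial>(M \<Otimes>\<^sub>M N)) = (\<integral>x. h x \<partial>N)"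
proof -
  interpret M: prob_space M by fact
  interpret N: prob_space N by fact
  interpret pair_sigma_finite M N ..
  have d: "distr (M \<Otimes>\<^sub>M N) N snd = N"
  proof (rule measure_eqI)
    fix A assume "A \<in> sets (distr (M \<Otimes>\<^sub>M N) N snd)"
    then have A: "A \<in> sets N" by simp
    then have "snd -` A \<inter> space (M \<Otimes>\<^sub>M N) = space M \<times> A"
      using sets.sets_into_space by (fastforce simp: space_pair_measure)
    then show "emeasure (distr (M \<Otimes>\<^sub>M N) N snd) A = emeasure N A"
      using A by (simp add: emeasure_distr N.emeasure_pair_measure_Times M.emeasure_space_1)
  qed simp
  note [measurable] = borel_measurable_integrable[OF h]
  show "integrable (M \<Otimes>\<^sub>M N) (\<lambda>x. h (snd x))" using integrable_distr_eq[of snd "M \<Otimes>\<^sub>M N" N h] h by (simp add: d)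
  show "(\<integral>x. h (snd x) \<partial>(M \<Otimes>\<^sub>M N)) = (\<integral>x. h x \<partial>N)" using integral_distr[of snd "M \<Otimes>\<^sub>M N" N h] by (simp add: d)
qed

lemma integral_pair_fst:
  fixes h :: "'a \<Rightarrow> real"
  assumes M: "prob_space M" and N: "prob_space N" and h: "integrable M h"
  shows "integrable (M \<Otimes>\<^sub>M N) (\<lambda>x. h (fst x))" "(\<integral>x. h (fst x) \<partial>(M \<Otimes>\<^sub>M N)) = (\<integral>x. h x \<partial>M)"
proof -
  interpret M: prob_space M by fact
  interpret N: prob_space N by fact
  note d = N.distr_pair_fst[of M]
  note [measurable] = borel_measurable_integrable[OF h]
  show "integrable (M \<Otimes>\<^sub>M N) (\<lambda>x. h (fst x))" using integrable_distr_eq[of fst "M \<Otimes>\<^sub>M N" M h] h by (simp add: d)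
  show "(\<integral>x. h (fst x) \<partial>(M \<Otimes>\<^sub>M N)) = (\<integral>x. h x \<partial>M)" using integral_distr[of fst "M \<Otimes>\<^sub>M N" M h] by (simp add: d)
qed

text \<open>Data processing for the channel that adds independent noise of covariance
  \<open>L ** transpose L\<close>. The quotient \<open>r\<close> divides the likelihood ratio after
  the noise by the one before it, so the mean of \<open>ln r\<close> is the change of the relative
  entropy, and \<open>r\<close> has mean one.\<close>

lemma mixture_kl_add_noise:
  fixes S G L :: "real^'r^'r"
  assumes S: "posdef S" and G: "posdef G" and J: "finite J" "J \<noteq> {}"
  shows "mixture_kl n (S + L ** transpose L) J c (G + L ** transpose L) \<le> mixture_kl n S J c G"
proof -
  define S' G' where "S' = S + L ** transpose L" and "G' = G + L ** transpose L"
  have S': "posdef S'" and G': "posdef G'"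
    unfolding S'_def G'_def using S G by (auto intro!: posdef_add_psd psd_mult_transpose)
  \<comment> \<open>An opaque name for the identity, so that simp leaves
    \<open>L ** one ** transpose L\<close> in the shape of the convolution rules.\<close>
  define one where "one = (mat 1 :: real^'r^'r)"
  have o: "posdef one" by (simp add: one_def posdef_mat_1)
  have S'1: "S + L ** one ** transpose L = S'" and G'1: "G + L ** one ** transpose L = G'"
    by (simp_all add: S'_def G'_def one_def)
  let ?P = "gauss_block n one \<Otimes>\<^sub>M mixture n S J c"
  define t where "t x = block_shift n (\<lambda>j. L *v fst x j) (snd x)" for x :: "(nat \<Rightarrow> real^'r) \<times> (nat \<Rightarrow> real^'r)"
  have [measurable]: "t \<in> (\<Pi>\<^sub>M j\<in>{..<n}. borel) \<Otimes>\<^sub>M (\<Pi>\<^sub>M j\<in>{..<n}. borel) \<rightarrow>\<^sub>M (\<Pi>\<^sub>M j\<in>{..<n}. borel)"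
    unfolding t_def[abs_def] block_shift_def by measurable
  note pos = mixture_density_pos[OF S' J] mixture_density_pos[OF S J] block_density_pos[OF G] block_density_pos[OF G'] block_density_pos[OF o]
  define q where "q y = mixture_density n S' J c y / block_density n G' y" for y
  have [measurable]: "q \<in> borel_measurable (\<Pi>\<^sub>M j\<in>{..<n}. borel)" unfolding q_def by measurable
  have qpos: "0 < q y" for y unfolding q_def using pos by simp
  define r where "r x = q (t x) * (block_density n G (snd x) / mixture_density n S J c (snd x))" for x
  have r_meas: "r \<in> borel_measurable ((\<Pi>\<^sub>M j\<in>{..<n}. borel) \<Otimes>\<^sub>M (\<Pi>\<^sub>M j\<in>{..<n}. borel))" unfolding r_def by measurable
  have rpos: "0 < r x" for x unfolding r_def using pos qpos by simp
  have lnr: "ln (r x) = (ln (mixture_density n S' J c (t x)) - ln (block_density n G' (t x)))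
      - (ln (mixture_density n S J c (snd x)) - ln (block_density n G (snd x)))" for x
    unfolding r_def q_def using pos[THEN less_imp_neq] by (simp add: ln_mult ln_div)
  have iA: "integrable (mixture n (S + L ** one ** transpose L) J c) (\<lambda>y. ln (mixture_density n S' J c y) - ln (block_density n G' y))"
    unfolding S'1 by (rule integrable_mixture_ln_ratio[OF S' J S' J G'])
  have iB: "integrable (mixture n S J c) (\<lambda>y. ln (mixture_density n S J c y) - ln (block_density n G y))"
    by (rule integrable_mixture_ln_ratio[OF S J S J G])
  have hm: "(\<lambda>y. ln (mixture_density n S' J c y) - ln (block_density n G' y)) \<in> borel_measurable (\<Pi>\<^sub>M j\<in>{..<n}. borel)"
    by measurable
  note A = integrable_gauss_block_mixture[OF o S J hm iA] integral_gauss_block_mixture[OF o S J hm iA]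
  note B = integral_pair_snd[OF prob_space_gauss_block[OF o] prob_space_mixture[OF S J] iB, of n]
  interpret p: pair_sigma_finite "block_lborel n :: (nat \<Rightarrow> real^'r) measure" "block_lborel n :: (nat \<Rightarrow> real^'r) measure"
    by (simp add: pair_sigma_finite_def sigma_finite_block_lborel)
  \<comment> \<open>The factor \<open>r\<close> exchanges the mixture density of the second
    component for \<open>block_density n G\<close>. Then \<open>t\<close> has density
    \<open>block_density n G'\<close>, and against this \<open>q\<close> integrates to one.\<close>
  have "(\<integral>\<^sup>+x. ennreal (r x) \<partial>?P)
    = (\<integral>\<^sup>+\<nu>. \<integral>\<^sup>+s. ennreal (block_density n one \<nu> * block_density n G s * q (t (\<nu>, s))) \<partial>block_lborel n \<partial>block_lborel n)"
    using r_meas pos[THEN less_imp_neq] pos[THEN less_imp_le] qpos[THEN less_imp_le]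
    by (subst nn_integral_gauss_block_mixture[OF o S J], simp)
       (auto intro!: nn_integral_cong arg_cong[where f = ennreal] simp: r_def field_simps simp flip: ennreal_mult)
  also have "\<dots> = (\<integral>\<^sup>+\<nu>. \<integral>\<^sup>+y. ennreal (block_density n one \<nu> * block_density n G (\<lambda>j. y j - L *v \<nu> j) * q y) \<partial>block_lborel n \<partial>block_lborel n)"
  proof (rule nn_integral_cong)
    fix \<nu> :: "nat \<Rightarrow> real^'r"
    have [measurable]: "(\<lambda>s. t (\<nu>, s)) \<in> (\<Pi>\<^sub>M j\<in>{..<n}. borel) \<rightarrow>\<^sub>M (\<Pi>\<^sub>M j\<in>{..<n}. borel)"
      unfolding t_def[abs_def] block_shift_def fst_conv snd_conv by measurable
    have "(\<integral>\<^sup>+s. ennreal (block_density n one \<nu> * block_density n G s * q (t (\<nu>, s))) \<partial>block_lborel n)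
      = (\<integral>\<^sup>+y. ennreal (block_density n one \<nu> * block_density n G (block_shift n (\<lambda>j. - (L *v \<nu> j)) y) * q (t (\<nu>, block_shift n (\<lambda>j. - (L *v \<nu> j)) y))) \<partial>block_lborel n)"
      by (rule nn_integral_block_shift[symmetric]) measurable
    also have "\<dots> = (\<integral>\<^sup>+y. ennreal (block_density n one \<nu> * block_density n G (\<lambda>j. y j - L *v \<nu> j) * q y) \<partial>block_lborel n)"
      by (intro nn_integral_cong) (simp add: t_def block_shift_inverse space_block block_density_block_shift)
    finally show "(\<integral>\<^sup>+s. ennreal (block_density n one \<nu> * block_density n G s * q (t (\<nu>, s))) \<partial>block_lborel n) = \<dots>" .
  qed
  also have "\<dots> = (\<integral>\<^sup>+y. \<integral>\<^sup>+\<nu>. ennreal (block_density n one \<nu> * block_density n G (\<lambda>j. y j - L *v \<nu> j) * q y) \<partial>block_lborel n \<partial>block_lborel n)"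
    by (rule p.Fubini') measurable
  also have "\<dots> = (\<integral>\<^sup>+y. \<integral>\<^sup>+\<nu>. ennreal (block_density n one \<nu> * block_density n G (\<lambda>j. y j - L *v \<nu> j)) * ennreal (q y) \<partial>block_lborel n \<partial>block_lborel n)"
    by (intro nn_integral_cong ennreal_mult mult_nonneg_nonneg) (use pos[THEN less_imp_le] qpos[THEN less_imp_le] in simp_all)
  also have "\<dots> = (\<integral>\<^sup>+y. ennreal (block_density n G' y) * ennreal (q y) \<partial>block_lborel n)"
    by (simp add: nn_integral_multc nn_integral_block_conv[OF o G] G'1)
  also have "\<dots> = (\<integral>\<^sup>+y. ennreal (mixture_density n S' J c y) \<partial>block_lborel n)"
    using pos[THEN less_imp_neq] pos[THEN less_imp_le] qpos[THEN less_imp_le]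
    by (auto intro!: nn_integral_cong simp: q_def simp flip: ennreal_mult)
  also have "\<dots> = 1" by (rule nn_integral_mixture_density[OF S' J])
  finally have r1: "(\<integral>\<^sup>+x. ennreal (r x) \<partial>?P) = 1" .
  have P: "prob_space ?P"
    by (intro prob_space_pair prob_space_gauss_block prob_space_mixture o S J)
  have "(\<Sum>i\<in>{()}. \<integral>x. ln (r x) \<partial>?P) \<le> 0"
  proof (rule expectation_ln_le_0[OF P])
    show "integrable ?P (\<lambda>x. ln (r x))"
      unfolding lnr t_def by (rule Bochner_Integration.integrable_diff[OF A(1) B(1)])
  qed (use rpos r1 r_meas in simp_all)
  moreover have "(\<integral>x. ln (r x) \<partial>?P) = mixture_kl n S' J c G' - mixture_kl n S J c G"
    unfolding lnr t_def by (subst Bochner_Integration.integral_diff[OF A(1) B(1)]) (simp add: A(2) B(2) mixture_kl_def S'1)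
  ultimately show ?thesis by (simp add: S'_def G'_def)
qed


text \<open>
  Here \<open>w = t + C \<nu>\<close> splits the interference plus noise of a receiver into the genie noise \<open>\<nu>\<close> and an
  independent rest.  The choice of \<open>B\<close> makes \<open>\<nu> - B w\<close> independent of \<open>w\<close> for Gaussian
  interference, so that the genie signal \<open>s = \<nu> + B a\<close> is useless when the interference and the input
  \<open>a\<close> are Gaussian.
\<close>

lemma mixture_kl_genie:
  fixes S :: "real^'s^'s" and T GT GY :: "real^'r^'r" and C :: "real^'s^'r"
    and a :: "'i \<Rightarrow> nat \<Rightarrow> real^'r" and c :: "'l \<Rightarrow> nat \<Rightarrow> real^'r"
  assumes S: "posdef S" and T: "posdef T" and GT: "posdef GT" and GY: "posdef GY"
    and I: "finite I" "I \<noteq> {}" and J: "finite J" "J \<noteq> {}"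
  defines "W \<equiv> T + C ** S ** transpose C"
  defines "GW \<equiv> GT + C ** S ** transpose C"
  defines "B \<equiv> S ** transpose C ** matrix_inv GW"
  defines "V \<equiv> S - B ** GW ** transpose B"
  defines "GS \<equiv> V + B ** GY ** transpose B"
  shows "mixture_kl n W J c GW + mixture_kl n S I (\<lambda>i j. B *v a i j) GS
    \<le> mixture_kl n W (I \<times> J) (\<lambda>(i, l) j. a i j + c l j) GY + mixture_kl n T J c GT"
proof -
  define b where "b i j = B *v a i j" for i j
  define cc where "cc = (\<lambda>(i, l) j. a i j + c l j)"
  have W: "posdef W" and GW: "posdef GW" and V: "posdef V"
    using gauss_bayes_posdef[OF S T, of C] gauss_bayes_posdef[OF S GT, of C] by (auto simp: W_def GW_def V_def B_def)
  have GS: "posdef GS" unfolding GS_def by (intro posdef_add_psd V psd_congruence posdef_imp_psd GY)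
  have IJ: "finite (I \<times> J)" "I \<times> J \<noteq> {}" using I J by auto
  have cI: "0 < real (card I)" using I by (simp add: card_gt_0_iff)
  let ?P = "gauss_block n S \<Otimes>\<^sub>M mixture n T J c"
  have P: "prob_space ?P" by (intro prob_space_pair prob_space_gauss_block prob_space_mixture S T J)
  define qW where "qW y = mixture_density n W J c y / block_density n GW y" for y
  define qT where "qT y = mixture_density n T J c y / block_density n GT y" for y
  define qY where "qY y = mixture_density n W (I \<times> J) cc y / block_density n GY y" for y
  define qS where "qS y = mixture_density n S I b y / block_density n GS y" for y
  have [measurable]: "qW \<in> borel_measurable (\<Pi>\<^sub>M j\<in>{..<n}. borel)" "qT \<in> borel_measurable (\<Pi>\<^sub>M j\<in>{..<n}. borel)"
    "qY \<in> borel_measurable (\<Pi>\<^sub>M j\<in>{..<n}. borel)" "qS \<in> borel_measurable (\<Pi>\<^sub>M j\<in>{..<n}. borel)"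
    unfolding qW_def qT_def qY_def qS_def by measurable
  note pos = mixture_density_pos[OF T J] mixture_density_pos[OF W J] mixture_density_pos[OF W IJ] mixture_density_pos[OF S I]
    block_density_pos[OF S] block_density_pos[OF GT] block_density_pos[OF GW] block_density_pos[OF GY] block_density_pos[OF GS] block_density_pos[OF V]
  have qpos: "0 < qW y" "0 < qT y" "0 < qY y" "0 < qS y'" for y y'
    unfolding qW_def qT_def qY_def qS_def using pos by simp_all
  define w where "w x = block_shift n (\<lambda>j. C *v fst x j) (snd x)" for x :: "(nat \<Rightarrow> real^'s) \<times> (nat \<Rightarrow> real^'r)"
  have [measurable]: "w \<in> (\<Pi>\<^sub>M j\<in>{..<n}. borel) \<Otimes>\<^sub>M (\<Pi>\<^sub>M j\<in>{..<n}. borel) \<rightarrow>\<^sub>M (\<Pi>\<^sub>M j\<in>{..<n}. borel)"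
    unfolding w_def[abs_def] block_shift_def by measurable
  \<comment> \<open>Put \<open>y = w + a i\<close> and \<open>s = \<nu> + b i\<close>. Averaged over
    \<open>i\<close>, the mean of \<open>ln (r i x)\<close> is the left side of the claim minus its
    right side; it remains to bound the average of the means of \<open>r i\<close> by one.\<close>
  define r where "r i x = qW (w x) * qS (block_shift n (b i) (fst x)) / (qY (block_shift n (a i) (w x)) * qT (snd x))" for i x
  have rm: "r i \<in> borel_measurable ((\<Pi>\<^sub>M j\<in>{..<n}. borel) \<Otimes>\<^sub>M (\<Pi>\<^sub>M j\<in>{..<n}. borel))" for i
    unfolding r_def[abs_def] by measurable
  have rpos: "0 < r i x" for i x unfolding r_def using qpos by simp
  have lnr: "ln (r i x) = ln (qW (w x)) + ln (qS (block_shift n (b i) (fst x))) - ln (qY (block_shift n (a i) (w x))) - ln (qT (snd x))" for i x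
    unfolding r_def using qpos[THEN less_imp_neq] by (simp add: ln_mult ln_div)
  have lnq: "ln (qW y) = ln (mixture_density n W J c y) - ln (block_density n GW y)"
    "ln (qT y) = ln (mixture_density n T J c y) - ln (block_density n GT y)"
    "ln (qY y) = ln (mixture_density n W (I \<times> J) cc y) - ln (block_density n GY y)"
    "ln (qS s) = ln (mixture_density n S I b s) - ln (block_density n GS s)" for y s
    unfolding qW_def qT_def qY_def qS_def using pos[THEN less_imp_neq] by (simp_all add: ln_div)
  have iW: "integrable (mixture n (T + C ** S ** transpose C) J c) (\<lambda>y. ln (qW y))"
    and iT: "integrable (mixture n T J c) (\<lambda>y. ln (qT y))"
    and iY: "integrable (mixture n W (I \<times> J) cc) (\<lambda>y. ln (qY y))"
    and iS: "integrable (mixture n S I b) (\<lambda>y. ln (qS y))"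
    and iS1: "\<And>i. integrable (mixture n S {i} b) (\<lambda>y. ln (qS y))"
    unfolding lnq W_def[symmetric]
    by (rule integrable_mixture_ln_ratio; use W T S GW GT GY GS I J in simp)+
  have iS2: "integrable (gauss_block n S) (\<lambda>z. ln (qS (block_shift n (b i) z)))" for i
    using iS1[of i] unfolding mixture_singleton[OF S] by (subst (asm) integrable_distr_eq) simp_all
  have iY2: "integrable (mixture n (T + C ** S ** transpose C) J c) (\<lambda>y. ln (qY (block_shift n (a i) y)))" if "i \<in> I" for i
    using integrable_mixture_shift[OF W I J _ iY[unfolded cc_def] that] by (simp add: W_def)
  note prs = prob_space_gauss_block[OF S, of n] prob_space_mixture[OF T J, of n c]
  note FW = integrable_gauss_block_mixture[OF S T J _ iW, folded w_def] integral_gauss_block_mixture[OF S T J _ iW, folded w_def]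
  note FT = integral_pair_snd[OF prs iT]
  note FS = integral_pair_fst[OF prs iS2]
  have FY: "integrable ?P (\<lambda>x. ln (qY (block_shift n (a i) (w x))))"
    "(\<integral>x. ln (qY (block_shift n (a i) (w x))) \<partial>?P) = (\<integral>y. ln (qY (block_shift n (a i) y)) \<partial>mixture n W J c)" if "i \<in> I" for i
    using integrable_gauss_block_mixture[OF S T J _ iY2[OF that], folded w_def]
      integral_gauss_block_mixture[OF S T J _ iY2[OF that], folded w_def] by (simp_all add: W_def)
  have intr: "integrable ?P (\<lambda>x. ln (r i x))"
    "(\<integral>x. ln (r i x) \<partial>?P) = (\<integral>y. ln (qW y) \<partial>mixture n W J c) + (\<integral>z. ln (qS (block_shift n (b i) z)) \<partial>gauss_block n S)
       - (\<integral>y. ln (qY (block_shift n (a i) y)) \<partial>mixture n W J c) - (\<integral>y. ln (qT y) \<partial>mixture n T J c)" if "i \<in> I" for i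
    unfolding lnr using FW FT FS[of i] FY[OF that] by (simp_all add: W_def)
  have sumr: "(\<Sum>i\<in>I. \<integral>x. ln (r i x) \<partial>?P) = real (card I) * (mixture_kl n W J c GW + mixture_kl n S I b GS
       - mixture_kl n W (I \<times> J) cc GY - mixture_kl n T J c GT)"
  proof -
    have "(\<Sum>i\<in>I. \<integral>z. ln (qS (block_shift n (b i) z)) \<partial>gauss_block n S) = real (card I) * (\<integral>y. ln (qS y) \<partial>mixture n S I b)"
      using integral_mixture[OF S I(1) _ iS2] cI by simp
    moreover have "(\<Sum>i\<in>I. \<integral>y. ln (qY (block_shift n (a i) y)) \<partial>mixture n W J c) = real (card I) * (\<integral>y. ln (qY y) \<partial>mixture n W (I \<times> J) cc)"
      using integral_mixture_shift[OF W I J _ iY[unfolded cc_def]] by (simp add: cc_def)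
    ultimately have "(\<Sum>i\<in>I. \<integral>x. ln (r i x) \<partial>?P) = real (card I) * ((\<integral>y. ln (qW y) \<partial>mixture n W J c) + (\<integral>y. ln (qS y) \<partial>mixture n S I b)
       - (\<integral>y. ln (qY y) \<partial>mixture n W (I \<times> J) cc) - (\<integral>y. ln (qT y) \<partial>mixture n T J c))"
      by (simp add: intr sum.distrib sum_subtractf algebra_simps)
    then show ?thesis by (simp add: mixture_kl_def lnq)
  qed
  \<comment> \<open>What remains of the joint density times \<open>r i\<close> once the law of
    \<open>w\<close> is split off. Since \<open>b i\<close> is \<open>B\<close> applied to
    \<open>a i\<close>, the difference \<open>\<nu> - B w\<close> equals \<open>s - B y\<close>, so
    \<open>F\<close> depends on \<open>i\<close> only through \<open>y\<close> and
    \<open>s\<close>.\<close>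
  define F where "F y s = qS s * block_density n GY y * block_density n V (\<lambda>j. s j - B *v y j) / mixture_density n W (I \<times> J) cc y" for y s
  have F0: "0 \<le> F y s" for y s
    unfolding F_def using pos[THEN less_imp_le] qpos[THEN less_imp_le] by simp
  have [measurable (raw)]: "(\<lambda>\<omega>. F (x \<omega>) (s \<omega>)) \<in> borel_measurable M"
    if "\<And>j. j < n \<Longrightarrow> (\<lambda>\<omega>. x \<omega> j) \<in> borel_measurable M" "s \<in> M \<rightarrow>\<^sub>M (\<Pi>\<^sub>M j\<in>{..<n}. borel)" for x s and M :: "'w measure"
  proof -
    note [measurable] = that
    show ?thesis unfolding F_def by measurable
  qed
  interpret p: pair_sigma_finite "block_lborel n :: (nat \<Rightarrow> real^'r) measure" "block_lborel n :: (nat \<Rightarrow> real^'s) measure"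
    by (simp add: pair_sigma_finite_def sigma_finite_block_lborel)
  have point: "block_density n S \<nu> * mixture_density n T J c t * r i (\<nu>, t)
     = mixture_density n W J c (w (\<nu>, t)) * F (block_shift n (a i) (w (\<nu>, t))) (block_shift n (b i) \<nu>)"
    if "t \<in> extensional {..<n}" for \<nu> t i
  proof -
    let ?w = "w (\<nu>, t)"
    have "block_density n S \<nu> * block_density n GT t = block_density n S \<nu> * block_density n GT (\<lambda>j. ?w j - C *v \<nu> j)"
      by (intro arg_cong2[where f = "(*)"] refl block_density_cong) (simp add: w_def block_shift_def)
    also have "\<dots> = block_density n GW ?w * block_density n V (\<lambda>j. \<nu> j - B *v ?w j)"
      unfolding GW_def V_def B_def by (rule block_bayes[OF S GT])
    also have "block_density n V (\<lambda>j. \<nu> j - B *v ?w j) = block_density n V (\<lambda>j. block_shift n (b i) \<nu> j - B *v block_shift n (a i) ?w j)"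
      by (rule block_density_cong) (simp add: block_shift_def b_def matrix_vector_right_distrib)
    finally have bayes: "block_density n S \<nu> * block_density n GT t
       = block_density n GW ?w * block_density n V (\<lambda>j. block_shift n (b i) \<nu> j - B *v block_shift n (a i) ?w j)" .
    have eT: "mixture_density n T J c t / qT t = block_density n GT t"
      using pos(1)[of n c t] unfolding qT_def by simp
    have eW: "block_density n GW ?w * qW ?w = mixture_density n W J c ?w"
      using pos(7)[of n ?w] unfolding qW_def by simp
    have "block_density n S \<nu> * mixture_density n T J c t * r i (\<nu>, t)
       = (block_density n S \<nu> * (mixture_density n T J c t / qT t)) * qW ?w * qS (block_shift n (b i) \<nu>) / qY (block_shift n (a i) ?w)"
      by (simp add: r_def mult_ac)
    also have "\<dots> = (block_density n GW ?w * qW ?w) * qS (block_shift n (b i) \<nu>)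
        * block_density n V (\<lambda>j. block_shift n (b i) \<nu> j - B *v block_shift n (a i) ?w j) / qY (block_shift n (a i) ?w)"
      unfolding eT bayes by (simp add: mult_ac)
    also have "\<dots> = mixture_density n W J c ?w * F (block_shift n (a i) ?w) (block_shift n (b i) \<nu>)"
      unfolding eW by (simp add: F_def qY_def)
    finally show ?thesis .
  qed
  have ri: "(\<integral>\<^sup>+x. ennreal (r i x) \<partial>?P) = (\<integral>\<^sup>+y. \<integral>\<^sup>+s. ennreal (mixture_density n W J c (\<lambda>j. y j - a i j) * F y s) \<partial>block_lborel n \<partial>block_lborel n)" for i
  proof -
    have "(\<integral>\<^sup>+x. ennreal (r i x) \<partial>?P)
      = (\<integral>\<^sup>+\<nu>. \<integral>\<^sup>+t. ennreal (mixture_density n W J c (w (\<nu>, t)) * F (block_shift n (a i) (w (\<nu>, t))) (block_shift n (b i) \<nu>)) \<partial>block_lborel n \<partial>block_lborel n)"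
      using rm[of i] rpos[THEN less_imp_le] pos[THEN less_imp_le]
      by (subst nn_integral_gauss_block_mixture[OF S T J], simp)
         (auto intro!: nn_integral_cong arg_cong[where f = ennreal] simp: space_block point simp flip: ennreal_mult)
    also have "\<dots> = (\<integral>\<^sup>+\<nu>. \<integral>\<^sup>+y. ennreal (mixture_density n W J c (\<lambda>j. y j - a i j) * F y (block_shift n (b i) \<nu>)) \<partial>block_lborel n \<partial>block_lborel n)"
    proof (rule nn_integral_cong)
      fix \<nu> :: "nat \<Rightarrow> real^'s" assume nu: "\<nu> \<in> space (block_lborel n)"
      \<comment> \<open>For fixed \<open>\<nu>\<close> this translation expresses \<open>t\<close>
        through the received signal: t = y - a i - C \<nu>.\<close>
      define e where "e j = - (C *v \<nu> j + a i j)" for j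
      have [measurable]: "(\<lambda>t. w (\<nu>, t)) \<in> (\<Pi>\<^sub>M j\<in>{..<n}. borel) \<rightarrow>\<^sub>M (\<Pi>\<^sub>M j\<in>{..<n}. borel)"
        unfolding w_def[abs_def] block_shift_def fst_conv snd_conv by measurable
      have [measurable]: "(\<lambda>t::nat \<Rightarrow> real^'r. block_shift n (b i) \<nu>) \<in> (\<Pi>\<^sub>M j\<in>{..<n}. borel) \<rightarrow>\<^sub>M (\<Pi>\<^sub>M j\<in>{..<n}. borel)"
        by (rule measurable_const) (simp add: block_shift_def space_PiM)
      have "(\<integral>\<^sup>+t. ennreal (mixture_density n W J c (w (\<nu>, t)) * F (block_shift n (a i) (w (\<nu>, t))) (block_shift n (b i) \<nu>)) \<partial>block_lborel n)
        = (\<integral>\<^sup>+y. ennreal (mixture_density n W J c (w (\<nu>, block_shift n e y)) * F (block_shift n (a i) (w (\<nu>, block_shift n e y))) (block_shift n (b i) \<nu>)) \<partial>block_lborel n)"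
        by (rule nn_integral_block_shift[symmetric]) measurable
      also have "\<dots> = (\<integral>\<^sup>+y. ennreal (mixture_density n W J c (\<lambda>j. y j - a i j) * F y (block_shift n (b i) \<nu>)) \<partial>block_lborel n)"
      proof (rule nn_integral_cong)
        fix y :: "nat \<Rightarrow> real^'r" assume y: "y \<in> space (block_lborel n)"
        have 1: "w (\<nu>, block_shift n e y) = block_shift n (\<lambda>j. - a i j) y"
          by (auto simp: w_def e_def block_shift_def fun_eq_iff)
        have 2: "block_shift n (a i) (w (\<nu>, block_shift n e y)) = y"
          unfolding 1 using y by (simp add: block_shift_inverse space_block)
        show "ennreal (mixture_density n W J c (w (\<nu>, block_shift n e y)) * F (block_shift n (a i) (w (\<nu>, block_shift n e y))) (block_shift n (b i) \<nu>))
          = ennreal (mixture_density n W J c (\<lambda>j. y j - a i j) * F y (block_shift n (b i) \<nu>))"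
          unfolding 2 unfolding 1 by (simp add: mixture_density_block_shift)
      qed
      finally show "(\<integral>\<^sup>+t. ennreal (mixture_density n W J c (w (\<nu>, t)) * F (block_shift n (a i) (w (\<nu>, t))) (block_shift n (b i) \<nu>)) \<partial>block_lborel n) = \<dots>" .
    qed
    also have "\<dots> = (\<integral>\<^sup>+y. \<integral>\<^sup>+\<nu>. ennreal (mixture_density n W J c (\<lambda>j. y j - a i j) * F y (block_shift n (b i) \<nu>)) \<partial>block_lborel n \<partial>block_lborel n)"
      by (rule p.Fubini') measurable
    also have "\<dots> = (\<integral>\<^sup>+y. \<integral>\<^sup>+s. ennreal (mixture_density n W J c (\<lambda>j. y j - a i j) * F y s) \<partial>block_lborel n \<partial>block_lborel n)"
      by (rule nn_integral_cong, rule nn_integral_block_shift) measurable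
    finally show ?thesis .
  qed
  \<comment> \<open>Summed over the codewords, the translated laws of \<open>w\<close> give
    \<open>card I\<close> times the law of \<open>y\<close>, which cancels the denominator of
    \<open>F\<close>. The remaining dependence on \<open>y\<close> is Gaussian; integrating it out
    leaves the density of covariance \<open>GS\<close>, the denominator of
    \<open>qS\<close>.\<close>
  have "(\<Sum>i\<in>I. \<integral>\<^sup>+x. ennreal (r i x) \<partial>?P)
     = (\<integral>\<^sup>+y. \<integral>\<^sup>+s. (\<Sum>i\<in>I. ennreal (mixture_density n W J c (\<lambda>j. y j - a i j) * F y s)) \<partial>block_lborel n \<partial>block_lborel n)"
    unfolding ri
    by (subst nn_integral_sum[symmetric], measurable, intro nn_integral_cong, subst nn_integral_sum[symmetric]) auto
  also have "\<dots> = (\<integral>\<^sup>+y. \<integral>\<^sup>+s. ennreal (real (card I)) * (ennreal (qS s) * ennreal (block_density n GY y * block_density n V (\<lambda>j. s j - B *v y j))) \<partial>block_lborel n \<partial>block_lborel n)"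
  proof (intro nn_integral_cong)
    fix y :: "nat \<Rightarrow> real^'r" and s :: "nat \<Rightarrow> real^'s"
    have "(\<Sum>i\<in>I. ennreal (mixture_density n W J c (\<lambda>j. y j - a i j) * F y s)) = ennreal ((\<Sum>i\<in>I. mixture_density n W J c (\<lambda>j. y j - a i j)) * F y s)"
      using pos[THEN less_imp_le] F0 by (subst sum_ennreal) (auto simp: sum_distrib_right)
    also have "(\<Sum>i\<in>I. mixture_density n W J c (\<lambda>j. y j - a i j)) = real (card I) * mixture_density n W (I \<times> J) cc y"
      unfolding cc_def mixture_density_shift using cI by simp
    also have "real (card I) * mixture_density n W (I \<times> J) cc y * F y s = real (card I) * (qS s * (block_density n GY y * block_density n V (\<lambda>j. s j - B *v y j)))"
      using pos(3)[of n cc y] by (simp add: F_def)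
    finally show "(\<Sum>i\<in>I. ennreal (mixture_density n W J c (\<lambda>j. y j - a i j) * F y s))
      = ennreal (real (card I)) * (ennreal (qS s) * ennreal (block_density n GY y * block_density n V (\<lambda>j. s j - B *v y j)))"
      using pos[THEN less_imp_le] qpos[THEN less_imp_le] by (simp add: ennreal_mult)
  qed
  also have "\<dots> = (\<integral>\<^sup>+s. \<integral>\<^sup>+y. ennreal (real (card I)) * (ennreal (qS s) * ennreal (block_density n GY y * block_density n V (\<lambda>j. s j - B *v y j))) \<partial>block_lborel n \<partial>block_lborel n)"
    by (rule p.Fubini'[symmetric]) measurable
  also have "\<dots> = ennreal (real (card I)) * (\<integral>\<^sup>+s. ennreal (qS s) * ennreal (block_density n GS s) \<partial>block_lborel n)"
    by (simp add: nn_integral_cmult nn_integral_block_conv[OF GY V, of n _ B, folded GS_def])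
  also have "(\<integral>\<^sup>+s. ennreal (qS s) * ennreal (block_density n GS s) \<partial>block_lborel n) = (\<integral>\<^sup>+s. ennreal (mixture_density n S I b s) \<partial>block_lborel n)"
    using pos[THEN less_imp_neq] pos[THEN less_imp_le] qpos[THEN less_imp_le]
    by (auto intro!: nn_integral_cong simp: qS_def simp flip: ennreal_mult)
  also have "\<dots> = 1" by (rule nn_integral_mixture_density[OF S I])
  finally have "(\<Sum>i\<in>I. \<integral>\<^sup>+x. ennreal (r i x) \<partial>?P) \<le> of_nat (card I)" by (simp add: ennreal_of_nat_eq_real_of_nat)
  then have "(\<Sum>i\<in>I. \<integral>x. ln (r i x) \<partial>?P) \<le> 0"
    using rpos rm intr by (intro expectation_ln_le_0[OF P I(1)]) simp_all
  then have "mixture_kl n W J c GW + mixture_kl n S I b GS - mixture_kl n W (I \<times> J) cc GY - mixture_kl n T J c GT \<le> 0"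
    using cI unfolding sumr by (simp add: mult_le_0_iff)
  then show ?thesis by (simp add: b_def[abs_def] cc_def)
qed


section \<open>The converse\<close>

text \<open>Fano's inequality, by comparing the joint law with the one in which the output is independent of the message.\<close>

lemma mixture_fano:
  fixes S :: "real^'r^'r" and a :: "nat \<Rightarrow> nat \<Rightarrow> real^'r" and c :: "'l \<Rightarrow> nat \<Rightarrow> real^'r"
  assumes S: "posdef S" and M: "0 < M" and J: "finite J" "J \<noteq> {}"
    and dec: "dec \<in> (\<Pi>\<^sub>M j\<in>{..<n}. borel) \<rightarrow>\<^sub>M count_space {..<M}"
  shows "(\<Sum>m<M. measure (mixture n S J c) {w \<in> space (mixture n S J c). dec (block_shift n (a m) w) = m}) / real M * ln (real M) - ln 2
    \<le> (\<integral>w. ln (mixture_density n S J c w) \<partial>mixture n S J c)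
      - (\<integral>y. ln (mixture_density n S ({..<M} \<times> J) (\<lambda>(m, l) j. a m j + c l j) y)
           \<partial>mixture n S ({..<M} \<times> J) (\<lambda>(m, l) j. a m j + c l j))"
proof -
  let ?P = "mixture n S J c"
  define cc where "cc = (\<lambda>(m, l) j. a m j + c l j)"
  have I: "finite {..<M}" "{..<M} \<noteq> {}" using M by auto
  have IJ: "finite ({..<M} \<times> J)" "{..<M} \<times> J \<noteq> {}" using I J by auto
  have P: "prob_space ?P" by (rule prob_space_mixture[OF S J])
  interpret prob_space ?P by fact
  note [measurable] = dec
  define fW where "fW = mixture_density n S J c"
  define fY where "fY = mixture_density n S ({..<M} \<times> J) cc"
  have [measurable]: "fW \<in> borel_measurable (\<Pi>\<^sub>M j\<in>{..<n}. borel)" "fY \<in> borel_measurable (\<Pi>\<^sub>M j\<in>{..<n}. borel)"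
    unfolding fW_def fY_def by measurable
  have fpos: "0 < fW y" "0 < fY y" for y unfolding fW_def fY_def by (intro mixture_density_pos S J IJ)+
  \<comment> \<open>Read \<open>\<phi> m y / M\<close> as a law of the message given the output:
    mass 1/2 on the decoded message and 1/(2M) on every other one. The floor keeps the logarithm
    finite, and \<open>ln \<phi>\<close> is \<open>ln M\<close> on a correct decision, minus
    \<open>ln 2\<close> always; this \<open>ln 2\<close> stands in for the binary entropy in the
    usual form of the inequality.\<close>
  define \<phi> where "\<phi> m y = (if dec y = m then real M / 2 else 1 / 2)" for m y
  have [measurable]: "(\<lambda>y. dec (f y) = m) \<in> measurable N (count_space UNIV)"
    if "f \<in> N \<rightarrow>\<^sub>M (\<Pi>\<^sub>M j\<in>{..<n}. borel)" for f m and N :: "'w measure"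
    using measurable_compose[OF that measurable_compose[OF dec, of "\<lambda>k. k = m" "count_space UNIV"]] by simp
  have [measurable]: "\<phi> m \<in> borel_measurable (\<Pi>\<^sub>M j\<in>{..<n}. borel)" for m
    unfolding \<phi>_def by measurable
  have phpos: "0 < \<phi> m y" for m y using M by (simp add: \<phi>_def)
  \<comment> \<open>The quotient of two joint laws: the numerator draws the output from its own law
    and then the message from \<open>\<phi>\<close>, the denominator draws a uniform message and
    sends it.\<close>
  define r where "r m w = \<phi> m (block_shift n (a m) w) * fY (block_shift n (a m) w) / fW w" for m w
  have rm: "r m \<in> borel_measurable (\<Pi>\<^sub>M j\<in>{..<n}. borel)" for m unfolding r_def[abs_def] by measurable
  have rpos: "0 < r m w" for m w unfolding r_def using fpos phpos by simp
  have lnr: "ln (r m w) = ln (\<phi> m (block_shift n (a m) w)) + (ln (fY (block_shift n (a m) w)) - ln (fW w))" for m w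
    unfolding r_def using fpos[THEN less_imp_neq] phpos[THEN less_imp_neq] by (simp add: ln_mult ln_div)
  define E where "E m = {w \<in> space ?P. dec (block_shift n (a m) w) = m}" for m
  have [measurable]: "E m \<in> sets ?P" for m unfolding E_def by measurable
  have lnphi: "ln (\<phi> m (block_shift n (a m) w)) = indicator (E m) w * ln (real M) - ln 2" if "w \<in> space ?P" for m w
    using M that by (auto simp: \<phi>_def E_def ln_div indicator_def)
  have iphi: "integrable ?P (\<lambda>w. ln (\<phi> m (block_shift n (a m) w)))"
    "(\<integral>w. ln (\<phi> m (block_shift n (a m) w)) \<partial>?P) = measure ?P (E m) * ln (real M) - ln 2" for m
  proof -
    show "integrable ?P (\<lambda>w. ln (\<phi> m (block_shift n (a m) w)))"
      by (subst Bochner_Integration.integrable_cong[OF refl lnphi]) (auto intro!: integrable_mult_left integrable_real_indicator simp: emeasure_eq_measure)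
    show "(\<integral>w. ln (\<phi> m (block_shift n (a m) w)) \<partial>?P) = measure ?P (E m) * ln (real M) - ln 2"
      by (subst Bochner_Integration.integral_cong[OF refl lnphi]) (auto simp: emeasure_eq_measure prob_space)
  qed
  have iW: "integrable ?P (\<lambda>w. ln (fW w))" unfolding fW_def by (rule integrable_mixture_ln_mixture_density[OF S J S J])
  have iY: "integrable (mixture n S ({..<M} \<times> J) cc) (\<lambda>w. ln (fY w))"
    unfolding fY_def by (rule integrable_mixture_ln_mixture_density[OF S IJ S IJ])
  have iY2: "integrable ?P (\<lambda>w. ln (fY (block_shift n (a m) w)))" if "m < M" for m
    using integrable_mixture_shift[OF S I J _ iY[unfolded cc_def]] that by simp
  have nn: "(\<integral>\<^sup>+w. ennreal (r m w) \<partial>?P) = (\<integral>\<^sup>+y. ennreal (\<phi> m y * fY y) \<partial>block_lborel n)" for m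
  proof -
    have "(\<integral>\<^sup>+w. ennreal (r m w) \<partial>?P) = (\<integral>\<^sup>+w. ennreal (fW w) * ennreal (r m w) \<partial>block_lborel n)"
      unfolding mixture_def fW_def using rm[of m] by (subst nn_integral_density) simp_all
    also have "\<dots> = (\<integral>\<^sup>+w. ennreal (\<phi> m (block_shift n (a m) w) * fY (block_shift n (a m) w)) \<partial>block_lborel n)"
      using fpos[THEN less_imp_neq] fpos[THEN less_imp_le] rpos[THEN less_imp_le]
      by (intro nn_integral_cong) (simp add: r_def flip: ennreal_mult)
    also have "\<dots> = (\<integral>\<^sup>+y. ennreal (\<phi> m y * fY y) \<partial>block_lborel n)"
      by (rule nn_integral_block_shift) measurable
    finally show ?thesis .
  qed
  have "(\<Sum>m<M. \<integral>\<^sup>+w. ennreal (r m w) \<partial>?P) = (\<integral>\<^sup>+y. (\<Sum>m<M. ennreal (\<phi> m y * fY y)) \<partial>block_lborel n)"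
    unfolding nn by (rule nn_integral_sum[symmetric]) measurable
  also have "\<dots> \<le> (\<integral>\<^sup>+y. ennreal (real M) * ennreal (fY y) \<partial>block_lborel n)"
  proof (rule nn_integral_mono)
    fix y :: "nat \<Rightarrow> real^'r" assume "y \<in> space (block_lborel n)"
    then have "y \<in> space (\<Pi>\<^sub>M j\<in>{..<n}. borel)" by (simp add: space_block space_PiM PiE_def)
    then have d: "dec y < M" using measurable_space[OF dec] by auto
    \<comment> \<open>Exactly one message is the decoded one, so the total weight is M -
      1/2.\<close>
    have "(\<Sum>m<M. \<phi> m y) = (\<Sum>m<M. 1 / 2 + (if m = dec y then (real M - 1) / 2 else 0))"
      by (intro sum.cong refl) (auto simp: \<phi>_def diff_divide_distrib)
    also have "\<dots> = real M / 2 + (real M - 1) / 2" using d by (simp add: sum.distrib)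
    finally have "(\<Sum>m<M. \<phi> m y) \<le> real M" by (simp add: field_simps)
    then have "(\<Sum>m<M. \<phi> m y) * fY y \<le> real M * fY y" using fpos(2)[of y] by simp
    then show "(\<Sum>m<M. ennreal (\<phi> m y * fY y)) \<le> ennreal (real M) * ennreal (fY y)"
      using fpos[THEN less_imp_le] phpos[THEN less_imp_le]
      by (subst sum_ennreal) (simp_all add: sum_distrib_right flip: ennreal_mult)
  qed
  also have "\<dots> = of_nat (card {..<M})"
    unfolding fY_def by (simp add: nn_integral_cmult nn_integral_mixture_density[OF S IJ] ennreal_of_nat_eq_real_of_nat)
  finally have "(\<Sum>m<M. \<integral>w. ln (r m w) \<partial>?P) \<le> 0"
    using rpos rm iphi(1) iY2 iW
    by (intro expectation_ln_le_0[OF P I(1)]) (auto simp: lnr)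
  moreover have "(\<Sum>m<M. \<integral>w. ln (r m w) \<partial>?P) = (\<Sum>m<M. (measure ?P (E m) * ln (real M) - ln 2)
      + (\<integral>w. ln (fY (block_shift n (a m) w)) \<partial>?P) - (\<integral>w. ln (fW w) \<partial>?P))"
    using iphi iY2 iW by (intro sum.cong refl) (simp add: lnr)
  moreover have "(\<Sum>m<M. \<integral>w. ln (fY (block_shift n (a m) w)) \<partial>?P) = real M * (\<integral>y. ln (fY y) \<partial>mixture n S ({..<M} \<times> J) cc)"
    using integral_mixture_shift[OF S I J _ iY[unfolded cc_def]] by (simp add: cc_def)
  ultimately have "(\<Sum>m<M. measure ?P (E m)) * ln (real M) - real M * ln 2 + real M * (\<integral>y. ln (fY y) \<partial>mixture n S ({..<M} \<times> J) cc)
      - real M * (\<integral>w. ln (fW w) \<partial>?P) \<le> 0"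
    by (simp add: sum.distrib sum_subtractf sum_distrib_right)
  then have "(\<Sum>m<M. measure ?P (E m)) / real M * ln (real M) - ln 2 \<le> (\<integral>w. ln (fW w) \<partial>?P) - (\<integral>y. ln (fY y) \<partial>mixture n S ({..<M} \<times> J) cc)"
    using M by (simp add: field_simps)
  then show ?thesis by (simp add: fW_def fY_def E_def cc_def)
qed

section \<open>Error probabilities as averages over messages\<close>

lemma measure_mixture:
  assumes S: "posdef S" and I: "finite I" and A: "A \<in> sets (\<Pi>\<^sub>M j\<in>{..<n}. borel)"
  shows "measure (mixture n S I c) A = (\<Sum>i\<in>I. measure (gauss_block n S) {z \<in> space (gauss_block n S). block_shift n (c i) z \<in> A}) / real (card I)"
proof -
  interpret prob_space "gauss_block n S" by (rule prob_space_gauss_block[OF S])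
  note [measurable] = A
  have *: "indicator A (block_shift n (c i) z) = indicator {z \<in> space (gauss_block n S). block_shift n (c i) z \<in> A} z"
    if "z \<in> space (gauss_block n S)" for i and z
    using that by (auto simp: indicator_def)
  have E: "{z \<in> space (gauss_block n S). block_shift n (c i) z \<in> A} \<in> sets (gauss_block n S)" for i by measurable
  have "measure (mixture n S I c) A = (\<integral>y. indicator A y \<partial>mixture n S I c)"
    using sets.sets_into_space[OF A] by (simp add: space_block space_PiM PiE_def Int_absorb2)
  also have "\<dots> = (\<Sum>i\<in>I. \<integral>z. indicator A (block_shift n (c i) z) \<partial>gauss_block n S) / real (card I)"
    by (rule integral_mixture[OF S I])
       (auto simp: emeasure_eq_measure Bochner_Integration.integrable_cong[OF refl *] intro!: integrable_real_indicator E)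
  also have "(\<Sum>i\<in>I. \<integral>z. indicator A (block_shift n (c i) z) \<partial>gauss_block n S)
     = (\<Sum>i\<in>I. measure (gauss_block n S) {z \<in> space (gauss_block n S). block_shift n (c i) z \<in> A})"
    by (intro sum.cong refl) (subst Bochner_Integration.integral_cong[OF refl *], auto intro!: arg_cong2[where f = measure])
  finally show ?thesis .
qed

lemma num_messages_pos: "0 < num_messages n R"
  unfolding num_messages_def by simp

lemma error_prob_eq:
  fixes G :: "real^'t^'r" and K :: "real^'s^'r"
  assumes M: "0 < M" and N: "0 < N" and dec: "decoder n M dec"
  shows "error_prob n M N G K enc enc' dec
    = (\<Sum>m<M. \<Sum>l<N. measure (noise_block n) {z \<in> space (noise_block n). dec (received n G K (enc m) (enc' l) z) \<noteq> m}) / (real M * real N)"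
proof -
  interpret nb: prob_space "noise_block n :: (nat \<Rightarrow> real^'r) measure"
    unfolding noise_block_eq by (rule prob_space_gauss_block[OF posdef_mat_1])
  let ?pm = "pair_pmf (pmf_of_set {..<M}) (pmf_of_set {..<N})"
  let ?O = "measure_pmf ?pm \<Otimes>\<^sub>M (noise_block n :: (nat \<Rightarrow> real^'r) measure)"
  have ne: "{..<M} \<noteq> {}" "{..<N} \<noteq> {}" using M N by auto
  have pm: "?pm = pmf_of_set ({..<M} \<times> {..<N})"
    using M N by (intro pmf_eqI) (auto simp: pmf_pair pmf_of_set indicator_def card_cartesian_product lessThan_empty_iff)
  have [measurable_cong]: "sets (noise_block n :: (nat \<Rightarrow> real^'r) measure) = sets (\<Pi>\<^sub>M j\<in>{..<n}. borel)"
    unfolding noise_block_eq by (rule sets_gauss_block)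
  have [measurable]: "dec \<in> (\<Pi>\<^sub>M j\<in>{..<n}. borel) \<rightarrow>\<^sub>M count_space {..<M}" using dec by (simp add: decoder_def)
  define bad where "bad m l = {z \<in> space (noise_block n). dec (received n G K (enc m) (enc' l) z) \<noteq> m}" for m l
  have [measurable]: "received n G K x w \<in> (\<Pi>\<^sub>M j\<in>{..<n}. borel) \<rightarrow>\<^sub>M (\<Pi>\<^sub>M j\<in>{..<n}. borel)" for x w
    unfolding received_def[abs_def] by measurable
  have bad[measurable]: "bad m l \<in> sets (noise_block n)" for m l
  proof -
    have "(\<lambda>z. dec (received n G K (enc m) (enc' l) z)) \<in> noise_block n \<rightarrow>\<^sub>M count_space {..<M}" by measurable
    then have "(\<lambda>z. dec (received n G K (enc m) (enc' l) z)) \<in> noise_block n \<rightarrow>\<^sub>M count_space UNIV"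
      by (rule measurable_compose) simp
    then show ?thesis unfolding bad_def by measurable
  qed
  define A where "A = {((m, l), z) \<in> space ?O. dec (received n G K (enc m) (enc' l) z) \<noteq> m}"
  \<comment> \<open>Message pairs form a countable discrete space, so the error event is a countable
    union of rectangles. This gives both its measurability and its sections.\<close>
  have A_Un: "A = (\<Union>p. {p} \<times> bad (fst p) (snd p))"
    by (auto simp: A_def bad_def space_pair_measure)
  have Am: "A \<in> sets ?O"
    unfolding A_Un by (intro sets.countable_UN') auto
  have "emeasure ?O A = (\<integral>\<^sup>+p. emeasure (noise_block n) (Pair p -` A) \<partial>measure_pmf ?pm)"
    by (rule nb.emeasure_pair_measure_alt[OF Am])
  also have "\<dots> = (\<integral>\<^sup>+p. emeasure (noise_block n) (bad (fst p) (snd p)) \<partial>measure_pmf ?pm)"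
    by (intro nn_integral_cong arg_cong2[where f = emeasure] refl) (auto simp: A_Un)
  also have "\<dots> = (\<Sum>p\<in>{..<M} \<times> {..<N}. emeasure (noise_block n) (bad (fst p) (snd p))) / of_nat (M * N)"
    unfolding pm using ne by (subst nn_integral_pmf_of_set) (auto simp: card_cartesian_product)
  also have "\<dots> = ennreal ((\<Sum>p\<in>{..<M} \<times> {..<N}. measure (noise_block n) (bad (fst p) (snd p))) / (real M * real N))"
    using M N by (simp add: nb.emeasure_eq_measure sum_ennreal divide_ennreal sum_nonneg ennreal_of_nat_eq_real_of_nat flip: ennreal_mult)
  finally have "measure ?O A = (\<Sum>p\<in>{..<M} \<times> {..<N}. measure (noise_block n) (bad (fst p) (snd p))) / (real M * real N)"
    by (simp add: measure_def sum_nonneg)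
  also have "(\<Sum>p\<in>{..<M} \<times> {..<N}. measure (noise_block n) (bad (fst p) (snd p))) = (\<Sum>m<M. \<Sum>l<N. measure (noise_block n) (bad m l))"
    by (simp add: sum.cartesian_product case_prod_unfold)
  finally show ?thesis by (simp add: error_prob_def A_def bad_def Let_def)
qed


section \<open>Second moments of a code\<close>

definition outer :: "real^'n \<Rightarrow> real^'n^'n" where
  "outer x = (\<chi> i k. x $ i * x $ k)"

text \<open>Uncentered second moments, averaged over messages and channel uses, because the
  reference Gaussians have mean zero. The trace is the average power of the code.\<close>

definition empirical_cov :: "nat \<Rightarrow> nat \<Rightarrow> (nat \<Rightarrow> nat \<Rightarrow> real^'t) \<Rightarrow> real^'t^'t" where
  "empirical_cov n M x = (1 / (real n * real M)) *\<^sub>R (\<Sum>m<M. \<Sum>j<n. outer (x m j))"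

lemma outer_mult: "outer x *v y = (x \<bullet> y) *\<^sub>R x"
  by (simp add: outer_def matrix_vector_mult_def inner_vec_def vec_eq_iff sum_distrib_left mult_ac)

lemma psd_outer: "psd (outer x)"
proof -
  have "transpose (outer x) = outer x" by (simp add: outer_def transpose_def vec_eq_iff mult.commute)
  then show ?thesis by (simp add: psd_def outer_mult) (simp add: inner_commute)
qed

lemma psd_sum: "finite I \<Longrightarrow> (\<And>i. i \<in> I \<Longrightarrow> psd (f i)) \<Longrightarrow> psd (\<Sum>i\<in>I. f i)"
  by (induction rule: finite_induct) (auto simp: psd_0 psd_add)

lemma psd_empirical_cov: "psd (empirical_cov n M x)"
  unfolding empirical_cov_def by (intro psd_scaleR psd_sum psd_outer) auto

lemma trace_sum: "trace (\<Sum>i\<in>I. f i) = (\<Sum>i\<in>I. trace (f i :: real^'n^'n))"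
  by (simp add: trace_def) (rule sum.swap)

lemma trace_scaleR: "trace (c *\<^sub>R A) = c * trace (A :: real^'n^'n)"
  by (simp add: trace_def sum_distrib_left)

lemma trace_mult_outer: "trace (Q ** outer x) = x \<bullet> (Q *v x)"
  by (simp add: trace_def outer_def matrix_matrix_mult_def inner_vec_def matrix_vector_mult_def sum_distrib_left mult_ac)

lemma trace_outer: "trace (outer x) = (norm x)\<^sup>2"
  using trace_mult_outer[of "mat 1" x] by (simp add: power2_norm_eq_inner)

lemma matrix_mul_scaleR_right: "A ** (c *\<^sub>R B) = c *\<^sub>R (A ** B)" for A :: "real^'n^'m"
  by (simp add: matrix_matrix_mult_def vec_eq_iff sum_distrib_left mult_ac)


lemma matrix_mul_sum_right: "A ** (\<Sum>i\<in>I. f i) = (\<Sum>i\<in>I. A ** f i)" for A :: "real^'n^'m"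
  by (simp add: matrix_matrix_mult_def vec_eq_iff sum_distrib_left) (intro allI sum.swap)

lemma trace_empirical_cov:
  fixes Q :: "real^'r^'r" and A :: "real^'t^'r"
  assumes "0 < n" "0 < M"
  shows "(\<Sum>m<M. \<Sum>j<n. (A *v x m j) \<bullet> (Q *v (A *v x m j))) / real M = real n * trace (Q ** (A ** empirical_cov n M x ** transpose A))"
proof -
  have 1: "trace (Q ** (A ** X ** transpose A)) = trace ((transpose A ** Q ** A) ** X)" for X
    by (metis matrix_mul_assoc trace_mul_sym)
  have 2: "(A *v x) \<bullet> (Q *v (A *v x)) = x \<bullet> ((transpose A ** Q ** A) *v x)" for x
    by (simp add: inner_matrix_vector_left matrix_vector_mul_assoc matrix_mul_assoc)
  show ?thesis using assms unfolding 1 2 empirical_cov_def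
    by (simp add: matrix_mul_scaleR_right matrix_mul_sum_right trace_scaleR trace_sum trace_mult_outer)
qed

section \<open>Fano bound and genie inequality for one user\<close>

lemma tin_rate_eq:
  fixes G :: "real^'t^'r" and K :: "real^'s^'r"
  assumes S: "psd S" and T: "psd T"
  shows "tin_rate G K S T = (ln (det (mat 1 + K ** T ** transpose K + G ** S ** transpose G)) - ln (det (mat 1 + K ** T ** transpose K))) / 2"
proof -
  define W where "W = mat 1 + K ** T ** transpose K"
  have W: "posdef W" unfolding W_def by (intro posdef_add_psd posdef_mat_1 psd_congruence T)
  have Y: "posdef (W + G ** S ** transpose G)" by (intro posdef_add_psd W psd_congruence S)
  \<comment> \<open>Factoring out the inverse of \<open>W\<close> turns the rate into a difference
    of log-determinants, that is, of the Gaussian entropies of the received signal and of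
    interference plus noise.\<close>
  have "mat 1 + G ** S ** transpose G ** matrix_inv W = (W + G ** S ** transpose G) ** matrix_inv W"
    using W by (simp add: matrix_add_rdistrib' matrix_inv_right' posdef_invertible)
  moreover have "det (matrix_inv W) = 1 / det W"
  proof -
    have "det W * det (matrix_inv W) = 1"
      using W by (simp add: det_mul[symmetric] matrix_inv_right' posdef_invertible)
    then show ?thesis using posdef_det_pos[OF W] by (simp add: field_simps)
  qed
  ultimately show ?thesis
    using posdef_det_pos[OF W] posdef_det_pos[OF Y]
    by (simp add: tin_rate_def W_def[symmetric] det_mul ln_div)
qed

text \<open>\<open>mixture_fano\<close> leaves a difference of entropies. Each splits into a
  relative entropy to a Gaussian and an expected Gaussian log density. As the second moments match,
  the latter depends only on dimension and determinant, and the two combine to the rate.\<close>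

lemma user_fano:
  fixes G :: "real^'t^'r" and K :: "real^'s^'r" and x :: "nat \<Rightarrow> nat \<Rightarrow> real^'t" and w :: "nat \<Rightarrow> nat \<Rightarrow> real^'s"
  assumes n: "0 < n" and M: "0 < M" and N: "0 < N" and dec: "decoder n M dec"
    and centered: "\<And>j. j < n \<Longrightarrow> (\<Sum>m<M. x m j) = 0 \<or> (\<Sum>l<N. w l j) = 0"
  defines "S \<equiv> empirical_cov n M x" and "T \<equiv> empirical_cov n N w"
  defines "GW \<equiv> mat 1 + K ** T ** transpose K"
  defines "GY \<equiv> GW + G ** S ** transpose G"
  shows "(1 - error_prob n M N G K x w dec) * ln (real M) - ln 2
    \<le> mixture_kl n (mat 1) {..<N} (\<lambda>l j. K *v w l j) GW
      - mixture_kl n (mat 1) ({..<M} \<times> {..<N}) (\<lambda>(m, l) j. G *v x m j + K *v w l j) GY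
      + real n * tin_rate G K S T"
proof -
  have I: "finite {..<M}" "{..<M} \<noteq> {}" and J: "finite {..<N}" "{..<N} \<noteq> {}" using M N by auto
  have IJ: "finite ({..<M} \<times> {..<N})" "{..<M} \<times> {..<N} \<noteq> {}" using I J by auto
  have S: "psd S" and T: "psd T" unfolding S_def T_def by (rule psd_empirical_cov)+
  have GW: "posdef GW" unfolding GW_def by (intro posdef_add_psd posdef_mat_1 psd_congruence T)
  have GY: "posdef GY" unfolding GY_def by (intro posdef_add_psd GW psd_congruence S)
  define a where "a m j = G *v x m j" for m j
  define c where "c l j = K *v w l j" for l j
  define cc where "cc = (\<lambda>(m, l) j. a m j + c l j)"
  have dm: "dec \<in> (\<Pi>\<^sub>M j\<in>{..<n}. borel) \<rightarrow>\<^sub>M count_space {..<M}" using dec by (simp add: decoder_def)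
  let ?W = "mixture n (mat 1) {..<N} c" and ?Y = "mixture n (mat 1) ({..<M} \<times> {..<N}) cc"
  interpret W: prob_space ?W by (rule prob_space_mixture[OF posdef_mat_1 J])
  interpret nb: prob_space "noise_block n :: (nat \<Rightarrow> real^'r) measure"
    unfolding noise_block_eq by (rule prob_space_gauss_block[OF posdef_mat_1])
  have meas: "measure ?W {w \<in> space ?W. dec (block_shift n (a m) w) = m}
     = (\<Sum>l<N. 1 - measure (noise_block n) {z \<in> space (noise_block n). dec (received n G K (x m) (w l) z) \<noteq> m}) / real N" for m
  proof -
    have "(\<lambda>z. dec (block_shift n (a m) z)) \<in> (\<Pi>\<^sub>M j\<in>{..<n}. borel) \<rightarrow>\<^sub>M count_space {..<M}"
      using dm by measurable
    then have m1: "(\<lambda>z. dec (block_shift n (a m) z)) \<in> (\<Pi>\<^sub>M j\<in>{..<n}. borel) \<rightarrow>\<^sub>M count_space UNIV"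
      by (rule measurable_compose) simp
    define A where "A = {w \<in> space (\<Pi>\<^sub>M j\<in>{..<n}. borel). dec (block_shift n (a m) w) = m}"
    have A: "A \<in> sets (\<Pi>\<^sub>M j\<in>{..<n}. borel)" unfolding A_def using m1 by measurable
    have Aeq: "{w \<in> space ?W. dec (block_shift n (a m) w) = m} = A"
      by (simp add: A_def space_block space_PiM PiE_def)
    have "measure (gauss_block n (mat 1)) {z \<in> space (gauss_block n (mat 1)). block_shift n (c l) z \<in> A}
       = 1 - measure (noise_block n) {z \<in> space (noise_block n). dec (received n G K (x m) (w l) z) \<noteq> m}" for l
    proof -
      have r: "block_shift n (a m) (block_shift n (c l) z) = received n G K (x m) (w l) z" for z
        by (auto simp: block_shift_def received_def a_def c_def fun_eq_iff)
      have ext: "block_shift n (c l) z \<in> extensional {..<n}" for z by (simp add: block_shift_def)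
      have e: "{z \<in> space (gauss_block n (mat 1)). block_shift n (c l) z \<in> A}
        = {z \<in> space (noise_block n). dec (received n G K (x m) (w l) z) = m}"
        using ext by (auto simp: A_def noise_block_eq r space_PiM PiE_def)
      have "{z \<in> space (gauss_block n (mat 1)). block_shift n (c l) z \<in> A} \<in> sets (gauss_block n (mat 1))"
        using A by measurable
      then have "{z \<in> space (noise_block n). dec (received n G K (x m) (w l) z) = m} \<in> sets (noise_block n)"
        unfolding e by (simp add: noise_block_eq)
      from nb.prob_compl[OF this] have "measure (noise_block n) {z \<in> space (noise_block n). dec (received n G K (x m) (w l) z) \<noteq> m}
          = 1 - measure (noise_block n) {z \<in> space (noise_block n). dec (received n G K (x m) (w l) z) = m}"
        by (rule back_subst[where P = "\<lambda>A. measure _ A = _"]) auto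
      then show ?thesis unfolding e by (simp add: noise_block_eq)
    qed
    then show ?thesis unfolding Aeq by (subst measure_mixture[OF posdef_mat_1 J(1) A]) simp
  qed
  have err: "(\<Sum>m<M. measure ?W {w \<in> space ?W. dec (block_shift n (a m) w) = m}) / real M = 1 - error_prob n M N G K x w dec"
    unfolding meas error_prob_eq[OF M N dec] using M N
    by (simp add: sum_subtractf sum_divide_distrib[symmetric] diff_divide_distrib)
  have fano: "(1 - error_prob n M N G K x w dec) * ln (real M) - ln 2
    \<le> (\<integral>w. ln (mixture_density n (mat 1) {..<N} c w) \<partial>?W) - (\<integral>y. ln (mixture_density n (mat 1) ({..<M} \<times> {..<N}) cc y) \<partial>?Y)"
    using mixture_fano[OF posdef_mat_1 M J dm, of c a] unfolding err cc_def .
  define d :: real where "d = real CARD('r)"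
  have tr: "trace (matrix_inv Z ** Z) = d" if "posdef Z" for Z :: "real^'r^'r"
    using that by (simp add: matrix_inv_left' posdef_invertible trace_I d_def)
  have lnint: "(\<integral>y. ln (block_density n Z y) \<partial>mixture n (mat 1) L e)
     = - (real n * trace (matrix_inv Z) + (\<Sum>i\<in>L. \<Sum>j<n. e i j \<bullet> (matrix_inv Z *v e i j)) / real (card L)) / 2
       - real n * ln ((2*pi) ^ CARD('r) * det Z) / 2"
    if Z: "posdef Z" and L: "finite L" "L \<noteq> {}" for Z :: "real^'r^'r" and L :: "'l set" and e
  proof -
    interpret prob_space "mixture n (mat 1) L e" by (rule prob_space_mixture[OF posdef_mat_1 L])
    have "integrable (mixture n (mat 1) L e) (\<lambda>y. \<Sum>j<n. y j \<bullet> (matrix_inv Z *v y j))"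
      using integrable_mixture_quadratic[OF posdef_mat_1 L(1), of n e "\<lambda>_. 0"] by simp
    then show ?thesis
      unfolding ln_block_density[OF Z] by (simp add: integral_mixture_quadratic[OF L] prob_space add_divide_distrib)
  qed
  have gW: "(\<integral>y. ln (block_density n GW y) \<partial>?W) = - (real n * d) / 2 - real n * ln ((2*pi) ^ CARD('r) * det GW) / 2"
  proof -
    \<comment> \<open>With matching second moments the expected quadratic form is the trace of the
      identity, that is, the dimension.\<close>
    have "real n * trace (matrix_inv GW) + (\<Sum>l<N. \<Sum>j<n. c l j \<bullet> (matrix_inv GW *v c l j)) / real (card {..<N})
       = real n * trace (matrix_inv GW ** GW)"
      unfolding c_def T_def GW_def using trace_empirical_cov[OF n N, of K w]
      by (simp add: matrix_add_ldistrib trace_add algebra_simps)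
    then show ?thesis by (simp add: lnint[OF GW J] tr[OF GW])
  qed
  have gY: "(\<integral>y. ln (block_density n GY y) \<partial>?Y) = - (real n * d) / 2 - real n * ln ((2*pi) ^ CARD('r) * det GY) / 2"
  proof -
    define Q where "Q = matrix_inv GY"
    have symQ: "transpose Q = Q" unfolding Q_def by (rule posdef_inv_sym[OF GY])
    \<comment> \<open>The messages are independent, so the double sum is a bilinear form in the two
      codeword sums, one of which is zero.\<close>
    have cross: "(\<Sum>m<M. \<Sum>l<N. a m j \<bullet> (Q *v c l j)) = 0" if "j < n" for j
    proof -
      have "(\<Sum>m<M. \<Sum>l<N. a m j \<bullet> (Q *v c l j)) = (G *v (\<Sum>m<M. x m j)) \<bullet> (Q *v (K *v (\<Sum>l<N. w l j)))"
        by (simp add: a_def c_def inner_sum_left inner_sum_right linear_sum[OF matrix_vector_mul_linear]) (rule sum.swap)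
      then show ?thesis using centered[OF that] by auto
    qed
    have ex: "cc (m, l) j \<bullet> (Q *v cc (m, l) j) = a m j \<bullet> (Q *v a m j) + c l j \<bullet> (Q *v c l j) + 2 * (a m j \<bullet> (Q *v c l j))" for m l j
    proof -
      have "c l j \<bullet> (Q *v a m j) = a m j \<bullet> (Q *v c l j)"
        by (metis inner_commute inner_matrix_vector_left symQ)
      then show ?thesis by (simp add: cc_def matrix_vector_right_distrib inner_add_left inner_add_right)
    qed
    have "(\<Sum>i\<in>{..<M} \<times> {..<N}. \<Sum>j<n. cc i j \<bullet> (Q *v cc i j)) = (\<Sum>m<M. \<Sum>l<N. \<Sum>j<n. cc (m, l) j \<bullet> (Q *v cc (m, l) j))"
      using sum.cartesian_product[of "\<lambda>m l. \<Sum>j<n. cc (m, l) j \<bullet> (Q *v cc (m, l) j)" "{..<N}" "{..<M}"]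
      by (simp add: case_prod_unfold)
    also have "\<dots> = real N * (\<Sum>m<M. \<Sum>j<n. a m j \<bullet> (Q *v a m j)) + real M * (\<Sum>l<N. \<Sum>j<n. c l j \<bullet> (Q *v c l j))
        + 2 * (\<Sum>m<M. \<Sum>l<N. \<Sum>j<n. a m j \<bullet> (Q *v c l j))"
      by (simp add: ex sum.distrib sum_distrib_left)
    also have "(\<Sum>m<M. \<Sum>l<N. \<Sum>j<n. a m j \<bullet> (Q *v c l j)) = (\<Sum>j<n. \<Sum>m<M. \<Sum>l<N. a m j \<bullet> (Q *v c l j))"
    proof -
      have "(\<Sum>m<M. \<Sum>l<N. \<Sum>j<n. a m j \<bullet> (Q *v c l j)) = (\<Sum>m<M. \<Sum>j<n. \<Sum>l<N. a m j \<bullet> (Q *v c l j))"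
        by (intro sum.cong refl sum.swap)
      then show ?thesis using sum.swap[of "\<lambda>m j. \<Sum>l<N. a m j \<bullet> (Q *v c l j)" "{..<n}" "{..<M}"] by simp
    qed
    also have "\<dots> = 0" by (simp add: cross)
    finally have "(\<Sum>i\<in>{..<M} \<times> {..<N}. \<Sum>j<n. cc i j \<bullet> (Q *v cc i j)) / real (card ({..<M} \<times> {..<N}))
      = (\<Sum>m<M. \<Sum>j<n. a m j \<bullet> (Q *v a m j)) / real M + (\<Sum>l<N. \<Sum>j<n. c l j \<bullet> (Q *v c l j)) / real N"
      using M N by (simp add: card_cartesian_product field_simps)
    also have "\<dots> = real n * trace (Q ** (G ** S ** transpose G)) + real n * trace (Q ** (K ** T ** transpose K))"
      unfolding a_def c_def S_def T_def by (simp add: trace_empirical_cov[OF n M] trace_empirical_cov[OF n N])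
    finally have "real n * trace Q + (\<Sum>i\<in>{..<M} \<times> {..<N}. \<Sum>j<n. cc i j \<bullet> (Q *v cc i j)) / real (card ({..<M} \<times> {..<N})) = real n * trace (Q ** GY)"
      unfolding GY_def GW_def by (simp add: matrix_add_ldistrib trace_add algebra_simps)
    then show ?thesis by (simp add: lnint[OF GY IJ] tr[OF GY] Q_def)
  qed
  have "mixture_kl n (mat 1) {..<N} c GW = (\<integral>w. ln (mixture_density n (mat 1) {..<N} c w) \<partial>?W) - (\<integral>y. ln (block_density n GW y) \<partial>?W)"
    unfolding mixture_kl_def using integrable_mixture_ln_block_density[OF posdef_mat_1 J GW, of n c "\<lambda>_. 0"]
    by (intro Bochner_Integration.integral_diff integrable_mixture_ln_mixture_density posdef_mat_1 J) simp
  moreover have "mixture_kl n (mat 1) ({..<M} \<times> {..<N}) cc GY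
      = (\<integral>y. ln (mixture_density n (mat 1) ({..<M} \<times> {..<N}) cc y) \<partial>?Y) - (\<integral>y. ln (block_density n GY y) \<partial>?Y)"
    unfolding mixture_kl_def using integrable_mixture_ln_block_density[OF posdef_mat_1 IJ GY, of n cc "\<lambda>_. 0"]
    by (intro Bochner_Integration.integral_diff integrable_mixture_ln_mixture_density posdef_mat_1 IJ) simp
  moreover have "real n * tin_rate G K S T = (\<integral>y. ln (block_density n GW y) \<partial>?W) - (\<integral>y. ln (block_density n GY y) \<partial>?Y)"
    unfolding gW gY tin_rate_eq[OF S T] GY_def[symmetric] GW_def[symmetric]
    using posdef_det_pos[OF GW] posdef_det_pos[OF GY] by (simp add: ln_mult algebra_simps diff_divide_distrib)
  ultimately show ?thesis using fano unfolding cc_def a_def[abs_def] c_def[abs_def] by linarith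
qed

text \<open>\<open>mixture_kl_genie\<close> with genie noise of covariance \<open>R\<close> and
  \<open>C = A ** matrix_inv R\<close> leaves a rest of covariance
  \<open>mat 1 - A ** matrix_inv R ** transpose A\<close>; \<open>mixture_kl_add_noise\<close> then
  passes from this covariance to the smaller \<open>R'\<close>. In this form the last term is the
  genie term of the other user.\<close>

lemma user_genie:
  fixes G :: "real^'r^'r" and K :: "real^'s^'r" and L :: "real^'r^'q" and R :: "real^'q^'q" and R' :: "real^'r^'r"
    and x :: "'i \<Rightarrow> nat \<Rightarrow> real^'r" and w :: "'l \<Rightarrow> nat \<Rightarrow> real^'s"
  assumes G: "invertible G" and S: "psd S" and T: "psd T" and R: "posdef R" and R': "posdef R'"
    and I: "finite I" "I \<noteq> {}" and J: "finite J" "J \<noteq> {}"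
  defines "A \<equiv> genie_matrix G K L T"
  assumes le: "R' \<preceq>\<^sub>L mat 1 - A ** matrix_inv R ** transpose A"
  defines "GW \<equiv> mat 1 + K ** T ** transpose K"
  defines "GY \<equiv> GW + G ** S ** transpose G"
  shows "mixture_kl n (mat 1) J (\<lambda>l j. K *v w l j) GW + mixture_kl n R I (\<lambda>i j. L *v x i j) (R + L ** S ** transpose L)
    \<le> mixture_kl n (mat 1) (I \<times> J) (\<lambda>(i, l) j. G *v x i j + K *v w l j) GY + mixture_kl n R' J (\<lambda>l j. K *v w l j) (R' + K ** T ** transpose K)"
proof -
  define C where "C = A ** matrix_inv R"
  define Z where "Z = mat 1 - A ** matrix_inv R ** transpose A"
  have Z: "posdef Z" using posdef_le[OF R' le] by (simp add: Z_def)
  have pK: "psd (K ** T ** transpose K)" by (rule psd_congruence[OF T])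
  have GW: "posdef GW" unfolding GW_def by (intro posdef_add_psd posdef_mat_1 pK)
  have GY: "posdef GY" unfolding GY_def by (intro posdef_add_psd GW psd_congruence S)
  have GT: "posdef (Z + K ** T ** transpose K)" by (intro posdef_add_psd Z pK)
  have tC: "transpose C = matrix_inv R ** transpose A"
    by (simp add: C_def matrix_transpose_mul posdef_inv_sym R)
  have RtC: "R ** transpose C = transpose A"
    using R by (simp add: tC matrix_mul_assoc matrix_inv_right' posdef_invertible)
  have CRC: "C ** R ** transpose C = A ** matrix_inv R ** transpose A"
    by (metis C_def RtC matrix_mul_assoc)
  have one: "Z + C ** R ** transpose C = mat 1" by (simp add: CRC Z_def)
  have W: "Z + K ** T ** transpose K + C ** R ** transpose C = GW" by (simp add: CRC Z_def GW_def)
  have tA: "transpose A = L ** matrix_inv G ** GW"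
    using posdef_sym[OF GW] by (simp add: A_def genie_matrix_def GW_def matrix_transpose_mul matrix_mul_assoc)
  \<comment> \<open>The form of \<open>A\<close> is chosen for this: the linear estimate of the
    genie noise from interference plus noise is \<open>L ** matrix_inv G\<close>. Applied to
    \<open>G *v x\<close> it returns \<open>L *v x\<close>, the codeword part of the genie
    signal.\<close>
  have B: "R ** transpose C ** matrix_inv GW = L ** matrix_inv G"
    using GW by (simp add: RtC tA matrix_mul_cancel matrix_inv_right' posdef_invertible)
  have BG: "L ** matrix_inv G ** G = L" using G by (simp add: matrix_mul_cancel matrix_inv_left')
  have BG': "transpose G ** transpose (L ** matrix_inv G) = transpose L"
    by (simp add: matrix_transpose_mul[symmetric] BG)
  have BGS: "L ** matrix_inv G ** (G ** S ** transpose G) ** transpose (L ** matrix_inv G) = L ** S ** transpose L"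
  proof -
    have "L ** matrix_inv G ** (G ** S ** transpose G) ** transpose (L ** matrix_inv G)
       = (L ** matrix_inv G ** G) ** S ** (transpose G ** transpose (L ** matrix_inv G))"
      by (simp add: matrix_mul_assoc)
    then show ?thesis by (simp only: BG BG')
  qed
  have GS: "R - L ** matrix_inv G ** GW ** transpose (L ** matrix_inv G) + L ** matrix_inv G ** GY ** transpose (L ** matrix_inv G)
     = R + L ** S ** transpose L"
    unfolding GY_def by (simp add: matrix_add_ldistrib matrix_add_rdistrib' BGS)
  have Bx: "(L ** matrix_inv G) *v (G *v x) = L *v x" for x
    by (simp add: matrix_vector_mul_assoc BG)
  have "mixture_kl n (mat 1) J (\<lambda>l j. K *v w l j) GW + mixture_kl n R I (\<lambda>i j. L *v x i j) (R + L ** S ** transpose L)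
    \<le> mixture_kl n (mat 1) (I \<times> J) (\<lambda>(i, l) j. G *v x i j + K *v w l j) GY + mixture_kl n Z J (\<lambda>l j. K *v w l j) (Z + K ** T ** transpose K)"
    using mixture_kl_genie[OF R Z GT GY I J, of n C "\<lambda>l j. K *v w l j" "\<lambda>i j. G *v x i j"]
    unfolding one W B GS Bx .
  also have "mixture_kl n Z J (\<lambda>l j. K *v w l j) (Z + K ** T ** transpose K) \<le> mixture_kl n R' J (\<lambda>l j. K *v w l j) (R' + K ** T ** transpose K)"
  proof -
    \<comment> \<open>The gap between the two covariances is positive semidefinite, so it is the
      covariance of an added independent noise.\<close>
    obtain F :: "real^'r^'r" where F: "Z - R' = F ** transpose F"
      using le psd_factor unfolding loewner_le_def Z_def by blast
    have 1: "R' + F ** transpose F = Z" and 2: "R' + K ** T ** transpose K + F ** transpose F = Z + K ** T ** transpose K"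
      by (simp_all flip: F)
    show ?thesis using mixture_kl_add_noise[OF R' posdef_add_psd[OF R' pK] J, of n F "\<lambda>l j. K *v w l j"] unfolding 1 2 .
  qed
  finally show ?thesis by simp
qed


section \<open>The sum-rate bound\<close>

lemma converse_block:
  fixes H1 :: "real^'a^'a" and H2 :: "real^'b^'a" and H3 :: "real^'a^'b" and H4 :: "real^'b^'b"
    and x :: "nat \<Rightarrow> nat \<Rightarrow> real^'a" and w :: "nat \<Rightarrow> nat \<Rightarrow> real^'b"
  assumes inv: "invertible H1" "invertible H4"
    and n: "0 < n" and M: "0 < M" and N: "0 < N" and dec: "decoder n M dec1" "decoder n N dec2"
    and centered: "\<And>j. j < n \<Longrightarrow> (\<Sum>m<M. x m j) = 0"
  defines "S1 \<equiv> empirical_cov n M x" and "S2 \<equiv> empirical_cov n N w"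
  defines "A1 \<equiv> genie_matrix H1 H2 H3 S2" and "A2 \<equiv> genie_matrix H4 H3 H2 S1"
  assumes R: "posdef R1" "posdef R2" "R1 \<preceq>\<^sub>L mat 1 - A2 ** matrix_inv R2 ** transpose A2"
      "R2 \<preceq>\<^sub>L mat 1 - A1 ** matrix_inv R1 ** transpose A1"
  shows "(1 - error_prob n M N H1 H2 x w dec1) * ln (real M) + (1 - error_prob n N M H4 H3 w x dec2) * ln (real N) - 2 * ln 2
    \<le> real n * tin_sum_rate H1 H2 H3 H4 S1 S2"
proof -
  have I: "finite {..<M}" "{..<M} \<noteq> {}" and J: "finite {..<N}" "{..<N} \<noteq> {}" using M N by auto
  have S: "psd S1" "psd S2" unfolding S1_def S2_def by (rule psd_empirical_cov)+
  note F1 = user_fano[where G = H1 and K = H2 and x = x and w = w, OF n M N dec(1) disjI1[OF centered], folded S1_def S2_def]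
  note F2 = user_fano[where G = H4 and K = H3 and x = w and w = x, OF n N M dec(2) disjI2[OF centered], folded S1_def S2_def]
  note G1 = user_genie[OF inv(1) S R(1,2) I J R(4)[unfolded A1_def], where n = n and x = x and w = w]
  note G2 = user_genie[OF inv(2) S(2,1) R(2,1) J I R(3)[unfolded A2_def], where n = n and x = w and w = x]
  \<comment> \<open>In \<open>G1 + G2\<close> each genie term stands once on either side and
    cancels. What is left bounds the relative entropies of interference plus noise by those of the
    received signals, which is the excess over the rates in \<open>F1 + F2\<close>.\<close>
  show ?thesis using F1 F2 G1 G2 unfolding tin_sum_rate_def distrib_left by linarith
qed

text \<open>The spread about the mean is the second moment minus the squared mean, so centering
  respects the power constraint.\<close>

lemma sum_norm_diff_mean_le:
  fixes x :: "nat \<Rightarrow> real^'t"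
  assumes M: "0 < M"
  defines "\<mu> \<equiv> (1 / real M) *\<^sub>R (\<Sum>m<M. x m)"
  shows "(\<Sum>m<M. (norm (x m - \<mu>))\<^sup>2) \<le> (\<Sum>m<M. (norm (x m))\<^sup>2)"
proof -
  have s: "(\<Sum>m<M. x m) = real M *\<^sub>R \<mu>" using M by (simp add: \<mu>_def)
  have "(\<Sum>m<M. (norm (x m - \<mu>))\<^sup>2) = (\<Sum>m<M. (norm (x m))\<^sup>2) - 2 * ((\<Sum>m<M. x m) \<bullet> \<mu>) + real M * (norm \<mu>)\<^sup>2"
    by (simp add: power2_norm_eq_inner inner_diff_left inner_diff_right inner_commute sum.distrib sum_subtractf inner_sum_left inner_sum_right sum_distrib_left algebra_simps)
  also have "\<dots> = (\<Sum>m<M. (norm (x m))\<^sup>2) - real M * (norm \<mu>)\<^sup>2"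
    by (simp add: s power2_norm_eq_inner)
  finally show ?thesis by simp
qed

lemma power_constraint_eq:
  assumes "0 < M"
  shows "power_constraint n M P x \<longleftrightarrow> (\<Sum>j<n. (\<Sum>m<M. (norm (x m j))\<^sup>2)) / (real n * real M) \<le> P"
proof -
  have "measure_pmf.expectation (pmf_of_set {..<M}) (\<lambda>m. (norm (x m j))\<^sup>2) = (\<Sum>m<M. (norm (x m j))\<^sup>2) / real M" for j
    using assms by (subst integral_pmf_of_set) (auto simp: lessThan_empty_iff)
  then show ?thesis by (simp add: power_constraint_def sum_divide_distrib[symmetric] mult.commute)
qed

lemma trace_empirical_cov_le:
  assumes M: "0 < M" and "power_constraint n M P x" and le: "\<And>j. (\<Sum>m<M. (norm (y m j))\<^sup>2) \<le> (\<Sum>m<M. (norm (x m j))\<^sup>2)"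
  shows "trace (empirical_cov n M y) \<le> P"
proof -
  have "trace (empirical_cov n M y) = (\<Sum>j<n. \<Sum>m<M. (norm (y m j))\<^sup>2) / (real n * real M)"
    by (simp add: empirical_cov_def trace_scaleR trace_sum trace_outer) (simp add: sum.swap[of _ "{..<M}"])
  also have "\<dots> \<le> (\<Sum>j<n. \<Sum>m<M. (norm (x m j))\<^sup>2) / (real n * real M)"
    by (intro divide_right_mono sum_mono le) simp
  also have "\<dots> \<le> P" using assms(2) unfolding power_constraint_eq[OF M] .
  finally show ?thesis .
qed

lemma decoder_shift:
  fixes e :: "nat \<Rightarrow> real^'r"
  assumes "decoder n M dec" shows "decoder n M (\<lambda>y. dec (block_shift n e y))"
  using assms unfolding decoder_def by measurable

lemma error_prob_cong:
  assumes "\<And>m l z. dec (received n G K (enc m) (enc' l) z) = dec2 (received n G K (enc2 m) (enc2' l) z)"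
  shows "error_prob n M N G K enc enc' dec = error_prob n M N G K enc2 enc2' dec2"
  unfolding error_prob_def assms ..

lemma error_prob_le_1: "error_prob n M N G K enc enc' dec \<le> 1"
proof -
  interpret nb: prob_space "noise_block n" unfolding noise_block_eq by (rule prob_space_gauss_block[OF posdef_mat_1])
  interpret prob_space "measure_pmf (pair_pmf (pmf_of_set {..<M}) (pmf_of_set {..<N})) \<Otimes>\<^sub>M noise_block n"
    by (intro prob_space_pair nb.prob_space_axioms measure_pmf.prob_space_axioms)
  show ?thesis unfolding error_prob_def Let_def by (rule prob_le_1)
qed

lemma num_messages_ge: "real n * R \<le> ln (real (num_messages n R))"
proof -
  have "exp (real n * R) \<le> real (num_messages n R)" unfolding num_messages_def by linarith
  then show ?thesis using num_messages_pos[of n R] by (subst ln_ge_iff) auto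
qed

lemma achievable_sum_rate_le:
  fixes H1 :: "real^'a^'a" and H2 :: "real^'b^'a" and H3 :: "real^'a^'b" and H4 :: "real^'b^'b"
  assumes inv: "invertible H1" "invertible H4"
    and genie: "\<And>S1 S2. feasible_cov P1 S1 \<Longrightarrow> feasible_cov P2 S2 \<Longrightarrow>
      (\<exists>\<Sigma>1 \<Sigma>2.
         let A1 = genie_matrix H1 H2 H3 S2;
             A2 = genie_matrix H4 H3 H2 S1
         in posdef \<Sigma>1 \<and> posdef \<Sigma>2 \<and>
            \<Sigma>1 \<preceq>\<^sub>L mat 1 - A2 ** matrix_inv \<Sigma>2 ** transpose A2 \<and>
            \<Sigma>2 \<preceq>\<^sub>L mat 1 - A1 ** matrix_inv \<Sigma>1 ** transpose A1)"
    and bound: "\<And>S1 S2. feasible_cov P1 S1 \<Longrightarrow> feasible_cov P2 S2 \<Longrightarrow> tin_sum_rate H1 H2 H3 H4 S1 S2 \<le> C"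
    and ach: "achievable H1 H2 H3 H4 P1 P2 R1 R2"
  shows "R1 + R2 \<le> C"
proof -
  obtain enc1 enc2 dec1 dec2 where
    codes: "\<And>n. n > 0 \<Longrightarrow> power_constraint n (num_messages n R1) P1 (enc1 n)"
           "\<And>n. n > 0 \<Longrightarrow> power_constraint n (num_messages n R2) P2 (enc2 n)"
           "\<And>n. n > 0 \<Longrightarrow> decoder n (num_messages n R1) (dec1 n)"
           "\<And>n. n > 0 \<Longrightarrow> decoder n (num_messages n R2) (dec2 n)"
    and lim1: "(\<lambda>n. error_prob n (num_messages n R1) (num_messages n R2) H1 H2 (enc1 n) (enc2 n) (dec1 n)) \<longlonglongrightarrow> 0"
    and lim2: "(\<lambda>n. error_prob n (num_messages n R2) (num_messages n R1) H4 H3 (enc2 n) (enc1 n) (dec2 n)) \<longlonglongrightarrow> 0"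
    using ach unfolding achievable_def by blast
  define e1 where "e1 n = error_prob n (num_messages n R1) (num_messages n R2) H1 H2 (enc1 n) (enc2 n) (dec1 n)" for n
  define e2 where "e2 n = error_prob n (num_messages n R2) (num_messages n R1) H4 H3 (enc2 n) (enc1 n) (dec2 n)" for n
  have main: "(1 - e1 n) * R1 + (1 - e2 n) * R2 - 2 * ln 2 / real n \<le> C" if n: "0 < n" for n
  proof -
    define M N where "M = num_messages n R1" and "N = num_messages n R2"
    have M: "0 < M" and N: "0 < N" unfolding M_def N_def by (rule num_messages_pos)+
    \<comment> \<open>User 1 is centered separately at every channel use, which makes all cross
      moments vanish. User 2 keeps its codewords and their raw second moments.\<close>
    define \<mu> where "\<mu> j = (1 / real M) *\<^sub>R (\<Sum>m<M. enc1 n m j)" for j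
    define x where "x m j = enc1 n m j - \<mu> j" for m j
    define w where "w = enc2 n"
    \<comment> \<open>Each receiver adds back the constant that centering has removed from its
      input, so the error probabilities stay the same.\<close>
    define d1 where "d1 y = dec1 n (block_shift n (\<lambda>j. H1 *v \<mu> j) y)" for y
    define d2 where "d2 y = dec2 n (block_shift n (\<lambda>j. H3 *v \<mu> j) y)" for y
    have dec: "decoder n M d1" "decoder n N d2"
      unfolding d1_def d2_def M_def N_def by (intro decoder_shift codes n)+
    have centered: "(\<Sum>m<M. x m j) = 0" for j
      using M by (simp add: x_def \<mu>_def sum_subtractf sum_constant_scaleR del: sum_constant)
    have err1: "error_prob n M N H1 H2 x w d1 = e1 n"
      unfolding e1_def M_def[symmetric] N_def[symmetric] w_def
      by (intro error_prob_cong) (auto simp: d1_def received_def block_shift_def x_def matrix_vector_mult_diff_distrib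
        intro!: arg_cong[where f = "dec1 n"])
    have err2: "error_prob n N M H4 H3 w x d2 = e2 n"
      unfolding e2_def M_def[symmetric] N_def[symmetric] w_def
      by (intro error_prob_cong) (auto simp: d2_def received_def block_shift_def x_def matrix_vector_mult_diff_distrib
        intro!: arg_cong[where f = "dec2 n"])
    have f1: "feasible_cov P1 (empirical_cov n M x)"
      unfolding feasible_cov_def x_def \<mu>_def
      by (intro conjI psd_empirical_cov trace_empirical_cov_le[OF M, where x = "enc1 n"] sum_norm_diff_mean_le M)
         (simp add: M_def codes n)
    have f2: "feasible_cov P2 (empirical_cov n N w)"
      unfolding feasible_cov_def w_def
      by (intro conjI psd_empirical_cov trace_empirical_cov_le[OF N, where x = "enc2 n"] order_refl) (simp add: N_def codes n)
    from genie[OF f1 f2] obtain \<Sigma>1 \<Sigma>2 where S: "posdef \<Sigma>1" "posdef \<Sigma>2"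
      "\<Sigma>1 \<preceq>\<^sub>L mat 1 - genie_matrix H4 H3 H2 (empirical_cov n M x) ** matrix_inv \<Sigma>2 ** transpose (genie_matrix H4 H3 H2 (empirical_cov n M x))"
      "\<Sigma>2 \<preceq>\<^sub>L mat 1 - genie_matrix H1 H2 H3 (empirical_cov n N w) ** matrix_inv \<Sigma>1 ** transpose (genie_matrix H1 H2 H3 (empirical_cov n N w))"
      unfolding Let_def by blast
    have "(1 - e1 n) * ln (real M) + (1 - e2 n) * ln (real N) - 2 * ln 2 \<le> real n * tin_sum_rate H1 H2 H3 H4 (empirical_cov n M x) (empirical_cov n N w)"
      using converse_block[OF inv n M N dec centered S] unfolding err1 err2 .
    also have "\<dots> \<le> real n * C" using bound[OF f1 f2] by (simp add: mult_left_mono)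
    finally have 1: "(1 - e1 n) * ln (real M) + (1 - e2 n) * ln (real N) - 2 * ln 2 \<le> real n * C" .
    have "(1 - e1 n) * (real n * R1) \<le> (1 - e1 n) * ln (real M)" "(1 - e2 n) * (real n * R2) \<le> (1 - e2 n) * ln (real N)"
      unfolding M_def N_def e1_def e2_def by (intro mult_left_mono num_messages_ge; simp add: error_prob_le_1)+
    with 1 have "real n * ((1 - e1 n) * R1 + (1 - e2 n) * R2) - 2 * ln 2 \<le> real n * C"
      by (simp add: algebra_simps)
    then show ?thesis using n by (simp add: field_simps)
  qed
  \<comment> \<open>The errors tend to zero, and the \<open>ln 2\<close> lost in each of the two
    Fano bounds is divided by \<open>n\<close>.\<close>
  have "(\<lambda>n. (1 - e1 n) * R1 + (1 - e2 n) * R2 - 2 * ln 2 / real n) \<longlonglongrightarrow> (1 - 0) * R1 + (1 - 0) * R2 - 0"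
    using lim1 lim2 unfolding e1_def[symmetric] e2_def[symmetric]
    by (intro tendsto_intros lim_const_over_n)
  then have "(\<lambda>n. (1 - e1 n) * R1 + (1 - e2 n) * R2 - 2 * ln 2 / real n) \<longlonglongrightarrow> R1 + R2" by simp
  then show ?thesis
    by (rule LIMSEQ_le_const2) (use main in \<open>auto intro!: exI[of _ 1]\<close>)
qed


section \<open>Achievability\<close>

lemma distr_zip_PiM:
  assumes M: "prob_space M" and N: "prob_space N" and I: "finite I"
  shows "distr (PiM I (\<lambda>_. M) \<Otimes>\<^sub>M PiM I (\<lambda>_. N)) (PiM I (\<lambda>_. M \<Otimes>\<^sub>M N)) (\<lambda>x. \<lambda>i\<in>I. (fst x i, snd x i)) = PiM I (\<lambda>_. M \<Otimes>\<^sub>M N)"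
    (is "distr ?P ?Q ?z = ?Q")
proof -
  interpret M: prob_space M by fact
  interpret N: prob_space N by fact
  interpret pM: product_sigma_finite "\<lambda>_. M" ..
  interpret pN: product_sigma_finite "\<lambda>_. N" ..
  interpret MN: prob_space "M \<Otimes>\<^sub>M N" by (intro prob_space_pair M N)
  interpret pMN: product_sigma_finite "\<lambda>_. M \<Otimes>\<^sub>M N" ..
  interpret PN: prob_space "PiM I (\<lambda>_. N)" by (intro prob_space_PiM N)
  have z[measurable]: "?z \<in> ?P \<rightarrow>\<^sub>M ?Q" by measurable
  show ?thesis
  proof (rule pMN.PiM_eqI[OF I])
    fix A assume A: "\<And>i. i \<in> I \<Longrightarrow> A i \<in> sets (M \<Otimes>\<^sub>M N)"
    have B: "Pi\<^sub>E I A \<in> sets ?Q" using A I by (intro sets_PiM_I_finite) auto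
    have ind: "indicator (Pi\<^sub>E I A) (?z (a, b)) = (\<Prod>i\<in>I. indicator (A i) (a i, b i) :: ennreal)" for a b
      using I by (auto simp: indicator_def PiE_iff prod_eq_1_iff)
    have m1: "(\<lambda>y. indicator (A i) (x, y) :: ennreal) \<in> borel_measurable N" if "i \<in> I" "x \<in> space M" for i x
      using measurable_compose[OF measurable_Pair1' borel_measurable_indicator[OF A]] that by blast
    have m2: "(\<lambda>x. \<integral>\<^sup>+y. indicator (A i) (x, y) \<partial>N) \<in> borel_measurable M" if "i \<in> I" for i
      using A[OF that] by measurable
    have "emeasure (distr ?P ?Q ?z) (Pi\<^sub>E I A) = (\<integral>\<^sup>+x. indicator (Pi\<^sub>E I A) (?z x) \<partial>?P)"
      using B by (subst nn_integral_indicator[symmetric], simp, subst nn_integral_distr[OF z]) simp_all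
    also have "\<dots> = (\<integral>\<^sup>+a. \<integral>\<^sup>+b. indicator (Pi\<^sub>E I A) (?z (a, b)) \<partial>PiM I (\<lambda>_. N) \<partial>PiM I (\<lambda>_. M))"
      using B measurable_compose[OF z borel_measurable_indicator[OF B]] by (intro PN.nn_integral_fst[symmetric]) simp
    also have "\<dots> = (\<integral>\<^sup>+a. (\<Prod>i\<in>I. \<integral>\<^sup>+y. indicator (A i) (a i, y) \<partial>N) \<partial>PiM I (\<lambda>_. M))"
      unfolding ind using I by (intro nn_integral_cong pN.product_nn_integral_prod m1) (auto simp: space_PiM)
    also have "\<dots> = (\<Prod>i\<in>I. \<integral>\<^sup>+x. \<integral>\<^sup>+y. indicator (A i) (x, y) \<partial>N \<partial>M)"
      using I m2 by (intro pM.product_nn_integral_prod)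
    also have "\<dots> = (\<Prod>i\<in>I. emeasure (M \<Otimes>\<^sub>M N) (A i))"
      using A by (intro prod.cong refl) (simp add: N.nn_integral_fst)
    finally show "emeasure (distr ?P ?Q ?z) (Pi\<^sub>E I A) = (\<Prod>i\<in>I. emeasure (M \<Otimes>\<^sub>M N) (A i))" .
  qed simp
qed

text \<open>Independent blocks become one block of independent pairs. Applied twice, it makes
  codeword, interference and noise at the channel uses i.i.d. triples, to which the weak law
  applies.\<close>

lemma nn_integral_zip_PiM:
  assumes M: "prob_space M" and N: "prob_space N" and I: "finite I"
    and h: "h \<in> borel_measurable (PiM I (\<lambda>_. M \<Otimes>\<^sub>M N))"
  shows "(\<integral>\<^sup>+a. \<integral>\<^sup>+b. h (\<lambda>i\<in>I. (a i, b i)) \<partial>PiM I (\<lambda>_. N) \<partial>PiM I (\<lambda>_. M)) = (\<integral>\<^sup>+\<omega>. h \<omega> \<partial>PiM I (\<lambda>_. M \<Otimes>\<^sub>M N))"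
proof -
  interpret PN: prob_space "PiM I (\<lambda>_. N)" by (intro prob_space_PiM N)
  let ?z = "\<lambda>x. \<lambda>i\<in>I. (fst x i, snd x i)"
  have z: "?z \<in> PiM I (\<lambda>_. M) \<Otimes>\<^sub>M PiM I (\<lambda>_. N) \<rightarrow>\<^sub>M PiM I (\<lambda>_. M \<Otimes>\<^sub>M N)" by measurable
  have "(\<integral>\<^sup>+\<omega>. h \<omega> \<partial>PiM I (\<lambda>_. M \<Otimes>\<^sub>M N)) = (\<integral>\<^sup>+x. h (?z x) \<partial>(PiM I (\<lambda>_. M) \<Otimes>\<^sub>M PiM I (\<lambda>_. N)))"
    using z h by (subst distr_zip_PiM[OF M N I, symmetric], subst nn_integral_distr) simp_all
  also have "\<dots> = (\<integral>\<^sup>+a. \<integral>\<^sup>+b. h (?z (a, b)) \<partial>PiM I (\<lambda>_. N) \<partial>PiM I (\<lambda>_. M))"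
    using measurable_compose[OF z h] by (intro PN.nn_integral_fst[symmetric]) simp
  finally show ?thesis by simp
qed

lemma PiM_sum_square:
  fixes X :: "'a \<Rightarrow> real"
  assumes N: "prob_space N" and I: "finite I" and X: "integrable N X" "(\<integral>x. X x \<partial>N) = 0" and X2: "integrable N (\<lambda>x. (X x)\<^sup>2)"
  shows "integrable (PiM I (\<lambda>_. N)) (\<lambda>\<omega>. (\<Sum>i\<in>I. X (\<omega> i))\<^sup>2)"
    and "(\<integral>\<omega>. (\<Sum>i\<in>I. X (\<omega> i))\<^sup>2 \<partial>PiM I (\<lambda>_. N)) = real (card I) * (\<integral>x. (X x)\<^sup>2 \<partial>N)"
proof -
  interpret N: prob_space N by fact
  interpret product_sigma_finite "\<lambda>_. N" ..
  \<comment> \<open>Writes \<open>X (\<omega> j) * X (\<omega> k)\<close> as a product over all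
    indices, so that its integral factorizes. For \<open>j \<noteq> k\<close> the factor at
    \<open>j\<close> has mean zero; for \<open>j = k\<close> it is the square of
    \<open>X\<close>.\<close>
  define F where "F j k i x = (if i = j then X x else 1) * (if i = k then X x else 1)" for j k i :: 'b and x
  have F: "(\<Prod>i\<in>I. F j k i (\<omega> i)) = X (\<omega> j) * X (\<omega> k)" if "j \<in> I" "k \<in> I" for j k \<omega>
    using that I by (simp add: F_def prod.distrib prod.delta)
  have intF: "integrable N (F j k i)" for j k i
    using X(1) X2 by (cases "i = j"; cases "i = k") (simp_all add: F_def[abs_def] power2_eq_square)
  have IF: "(\<Prod>i\<in>I. \<integral>x. F j k i x \<partial>N) = (if j = k then (\<integral>x. (X x)\<^sup>2 \<partial>N) else 0)" if "j \<in> I" "k \<in> I" for j k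
  proof (cases "j = k")
    case True
    have "(\<integral>x. F j k i x \<partial>N) = (if i = j then (\<integral>x. (X x)\<^sup>2 \<partial>N) else 1)" for i
      using True by (simp add: F_def power2_eq_square N.prob_space)
    then show ?thesis using True that I by (simp add: prod.delta)
  next
    case False
    then have "(\<integral>x. F j k j x \<partial>N) = 0" by (simp add: F_def X)
    then show ?thesis using False that I by (auto intro!: prod_zero)
  qed
  have e: "(\<Sum>i\<in>I. X (\<omega> i))\<^sup>2 = (\<Sum>j\<in>I. \<Sum>k\<in>I. \<Prod>i\<in>I. F j k i (\<omega> i))" for \<omega>
    by (simp add: power2_eq_square sum_product F)
  show "integrable (PiM I (\<lambda>_. N)) (\<lambda>\<omega>. (\<Sum>i\<in>I. X (\<omega> i))\<^sup>2)"
    unfolding e using I intF by (intro Bochner_Integration.integrable_sum product_integrable_prod)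
  have "(\<integral>\<omega>. (\<Sum>i\<in>I. X (\<omega> i))\<^sup>2 \<partial>PiM I (\<lambda>_. N)) = (\<Sum>j\<in>I. \<Sum>k\<in>I. \<Prod>i\<in>I. \<integral>x. F j k i x \<partial>N)"
    unfolding e using I intF
    by (simp add: Bochner_Integration.integral_sum product_integrable_prod product_integral_prod)
  also have "\<dots> = (\<Sum>j\<in>I. \<Sum>k\<in>I. if j = k then (\<integral>x. (X x)\<^sup>2 \<partial>N) else 0)"
    by (intro sum.cong refl IF)
  also have "\<dots> = real (card I) * (\<integral>x. (X x)\<^sup>2 \<partial>N)" using I by simp
  finally show "(\<integral>\<omega>. (\<Sum>i\<in>I. X (\<omega> i))\<^sup>2 \<partial>PiM I (\<lambda>_. N)) = real (card I) * (\<integral>x. (X x)\<^sup>2 \<partial>N)" .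
qed

text \<open>Chebyshev's inequality for the lower tail: a transmitted codeword is missed when its
  information density is too small.\<close>

lemma PiM_weak_law:
  fixes X :: "'a \<Rightarrow> real"
  assumes N: "prob_space N" and X: "integrable N X" "(\<integral>x. X x \<partial>N) = \<mu>" and X2: "integrable N (\<lambda>x. (X x)\<^sup>2)"
    and n: "0 < n" and \<delta>: "0 < \<delta>"
  shows "emeasure (PiM {..<n} (\<lambda>_. N)) {\<omega> \<in> space (PiM {..<n} (\<lambda>_. N)). (\<Sum>j<n. X (\<omega> j)) \<le> real n * (\<mu> - \<delta>)}
    \<le> ennreal ((\<integral>x. (X x - \<mu>)\<^sup>2 \<partial>N) / (real n * \<delta>\<^sup>2))"
proof -
  interpret N: prob_space N by fact
  let ?P = "PiM {..<n} (\<lambda>_. N)"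
  define Y where "Y x = X x - \<mu>" for x
  have Y: "integrable N Y" "(\<integral>x. Y x \<partial>N) = 0" unfolding Y_def using X by (simp_all add: N.prob_space)
  have Y2: "integrable N (\<lambda>x. (Y x)\<^sup>2)"
    unfolding Y_def power2_diff using X X2 by simp
  note [measurable] = borel_measurable_integrable[OF Y(1)] borel_measurable_integrable[OF X(1)]
  note S = PiM_sum_square[OF N _ Y Y2, of "{..<n}"]
  have c: "0 < (real n * \<delta>)\<^sup>2" using n \<delta> by simp
  have "emeasure ?P {\<omega> \<in> space ?P. (\<Sum>j<n. X (\<omega> j)) \<le> real n * (\<mu> - \<delta>)}
    \<le> emeasure ?P {\<omega> \<in> space ?P. (\<Sum>j<n. Y (\<omega> j))\<^sup>2 \<ge> (real n * \<delta>)\<^sup>2}"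
  proof (rule emeasure_mono)
    show "{\<omega> \<in> space ?P. (\<Sum>j<n. X (\<omega> j)) \<le> real n * (\<mu> - \<delta>)} \<subseteq> {\<omega> \<in> space ?P. (\<Sum>j<n. Y (\<omega> j))\<^sup>2 \<ge> (real n * \<delta>)\<^sup>2}"
    proof safe
      fix \<omega> assume "(\<Sum>j<n. X (\<omega> j)) \<le> real n * (\<mu> - \<delta>)"
      then have "real n * \<delta> \<le> - (\<Sum>j<n. Y (\<omega> j))" by (simp add: Y_def sum_subtractf algebra_simps)
      then have "(real n * \<delta>)\<^sup>2 \<le> (- (\<Sum>j<n. Y (\<omega> j)))\<^sup>2" using \<delta> by (intro power_mono) auto
      then show "(real n * \<delta>)\<^sup>2 \<le> (\<Sum>j<n. Y (\<omega> j))\<^sup>2" by simp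
    qed
  qed measurable
  also have "\<dots> \<le> ennreal (1 / (real n * \<delta>)\<^sup>2 * (\<integral>\<omega>. (\<Sum>j<n. Y (\<omega> j))\<^sup>2 \<partial>?P))"
    by (rule integral_Markov_inequality) (use S c in auto)
  also have "(\<integral>\<omega>. (\<Sum>j<n. Y (\<omega> j))\<^sup>2 \<partial>?P) = real n * (\<integral>x. (Y x)\<^sup>2 \<partial>N)" using S(2) by simp
  also have "1 / (real n * \<delta>)\<^sup>2 * (real n * (\<integral>x. (Y x)\<^sup>2 \<partial>N)) = (\<integral>x. (X x - \<mu>)\<^sup>2 \<partial>N) / (real n * \<delta>\<^sup>2)"
    using n by (simp add: Y_def field_simps power2_eq_square)
  finally show ?thesis .
qed

section \<open>Information density of the Gaussian channel\<close>

text \<open>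
  Gaussian inputs are normalized to unit covariance: a factor \<open>L\<close> of the input covariance
  \<open>L L\<^sup>T\<close> is absorbed into the channel matrices.
\<close>

definition info_density :: "real^'t^'r \<Rightarrow> real^'s^'r \<Rightarrow> (real^'t) \<times> (real^'s) \<times> (real^'r) \<Rightarrow> real" where
  "info_density G K = (\<lambda>(u, v, z).
     ln (gauss_density (mat 1 + K ** transpose K) (K *v v + z))
     - ln (gauss_density (mat 1 + K ** transpose K + G ** transpose G) (G *v u + K *v v + z)))"


abbreviation triple_gauss :: "((real^'t) \<times> (real^'s) \<times> (real^'r)) measure" where
  "triple_gauss \<equiv> std_gaussian_vec \<Otimes>\<^sub>M (std_gaussian_vec \<Otimes>\<^sub>M std_gaussian_vec)"

lemma prob_space_triple_gauss: "prob_space (triple_gauss :: ((real^'t) \<times> (real^'s) \<times> (real^'r)) measure)"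
  by (intro prob_space_pair prob_space_std_gaussian_vec)

lemma integrable_triple_gauss_norm4:
  "integrable (triple_gauss :: ((real^'t) \<times> (real^'s) \<times> (real^'r)) measure) (\<lambda>(u, v, z). a + b * (norm u ^ 4 + norm v ^ 4 + norm z ^ 4))"
proof -
  interpret prob_space "triple_gauss :: ((real^'t) \<times> (real^'s) \<times> (real^'r)) measure" by (rule prob_space_triple_gauss)
  note g = prob_space_std_gaussian_vec
  note 1 = integral_pair_fst(1)[OF g prob_space_pair[OF g g] integrable_std_gaussian_vec_norm4]
  note 2 = integral_pair_snd(1)[OF g prob_space_pair[OF g g] integral_pair_fst(1)[OF g g integrable_std_gaussian_vec_norm4]]
  note 3 = integral_pair_snd(1)[OF g prob_space_pair[OF g g] integral_pair_snd(1)[OF g g integrable_std_gaussian_vec_norm4]]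
  show ?thesis unfolding case_prod_unfold by (intro Bochner_Integration.integrable_add integrable_mult_right 1 2 3) simp
qed

text \<open>Both logarithms of Gaussian densities are quadratic in vectors that are linear in
  \<open>u\<close>, \<open>v\<close>, \<open>z\<close>. Fourth moments then give square
  integrability.\<close>

lemma info_density_quadratic_bound:
  fixes G :: "real^'t^'r" and K :: "real^'s^'r"
  shows "\<exists>a b. (\<forall>u v z. \<bar>info_density G K (u, v, z)\<bar> \<le> a + b * ((norm u)\<^sup>2 + (norm v)\<^sup>2 + (norm z)\<^sup>2))"
proof -
  define W where "W = mat 1 + K ** transpose K"
  define Y where "Y = W + G ** transpose G"
  have W: "posdef W" unfolding W_def by (intro posdef_add_psd posdef_mat_1 psd_mult_transpose)
  have Y: "posdef Y" unfolding Y_def by (intro posdef_add_psd W psd_mult_transpose)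
  define c where "c = \<bar>ln ((2*pi) ^ CARD('r) * det W) / 2\<bar> + \<bar>ln ((2*pi) ^ CARD('r) * det Y) / 2\<bar>"
  define p q where "p = onorm ((*v) (matrix_inv W))" and "q = onorm ((*v) (matrix_inv Y))"
  define g k where "g = onorm ((*v) G)" and "k = onorm ((*v) K)"
  have pq: "0 \<le> p" "0 \<le> q" "0 \<le> g" "0 \<le> k" unfolding p_def q_def g_def k_def by (auto intro!: onorm_pos_le)
  \<comment> \<open>\<open>norm_affine_le\<close>, used once for the interference plus noise and
    twice for the received vector, gives the factors 2 + 2k^2 and 4 + 4k^2 + 2g^2 before the sum of
    squares; the larger one serves for both.\<close>
  define b where "b = (p + q) * (2 + 4 * k\<^sup>2 + 2 * g\<^sup>2 + 2)"
  have b: "0 \<le> b" unfolding b_def using pq by (intro mult_nonneg_nonneg) auto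
  have "\<bar>info_density G K (u, v, z)\<bar> \<le> c + b * ((norm u)\<^sup>2 + (norm v)\<^sup>2 + (norm z)\<^sup>2)" for u v z
  proof -
    let ?w = "K *v v + z" and ?y = "G *v u + (K *v v + z)"
    have w: "(norm ?w)\<^sup>2 \<le> 2 * (norm z)\<^sup>2 + 2 * k\<^sup>2 * (norm v)\<^sup>2" unfolding k_def by (rule norm_affine_le)
    have y: "(norm ?y)\<^sup>2 \<le> 2 * (norm ?w)\<^sup>2 + 2 * g\<^sup>2 * (norm u)\<^sup>2" unfolding g_def by (rule norm_affine_le)
    define N where "N = (norm u)\<^sup>2 + (norm v)\<^sup>2 + (norm z)\<^sup>2"
    have N: "(norm u)\<^sup>2 \<le> N" "(norm v)\<^sup>2 \<le> N" "(norm z)\<^sup>2 \<le> N" "0 \<le> N" by (simp_all add: N_def)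
    have kg: "k\<^sup>2 * (norm v)\<^sup>2 \<le> k\<^sup>2 * N" "g\<^sup>2 * (norm u)\<^sup>2 \<le> g\<^sup>2 * N" using N by (auto intro!: mult_left_mono)
    have w': "(norm ?w)\<^sup>2 \<le> (2 + 2 * k\<^sup>2) * N" using w kg N by (simp add: algebra_simps)
    have y': "(norm ?y)\<^sup>2 \<le> (4 + 4 * k\<^sup>2 + 2 * g\<^sup>2) * N" using y w' kg N by (simp add: algebra_simps)
    have "(2 + 2 * k\<^sup>2) * N \<le> (4 + 4 * k\<^sup>2 + 2 * g\<^sup>2) * N" using N by (intro mult_right_mono) auto
    then have w'': "(norm ?w)\<^sup>2 \<le> (4 + 4 * k\<^sup>2 + 2 * g\<^sup>2) * N" using w' by linarith
    have "\<bar>?w \<bullet> (matrix_inv W *v ?w)\<bar> \<le> p * (norm ?w)\<^sup>2" "\<bar>?y \<bullet> (matrix_inv Y *v ?y)\<bar> \<le> q * (norm ?y)\<^sup>2"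
      unfolding p_def q_def by (rule abs_quadratic_le)+
    moreover have "p * (norm ?w)\<^sup>2 \<le> p * ((4 + 4 * k\<^sup>2 + 2 * g\<^sup>2) * N)" "q * (norm ?y)\<^sup>2 \<le> q * ((4 + 4 * k\<^sup>2 + 2 * g\<^sup>2) * N)"
      using w'' y' pq by (auto intro!: mult_left_mono)
    moreover have "p * ((4 + 4 * k\<^sup>2 + 2 * g\<^sup>2) * N) + q * ((4 + 4 * k\<^sup>2 + 2 * g\<^sup>2) * N) = b * N" by (simp add: b_def algebra_simps)
    moreover have "0 \<le> b * N" using b N by simp
    moreover have "\<bar>info_density G K (u, v, z)\<bar> \<le> c + \<bar>?w \<bullet> (matrix_inv W *v ?w)\<bar> + \<bar>?y \<bullet> (matrix_inv Y *v ?y)\<bar>"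
      unfolding info_density_def case_prod_conv W_def[symmetric] Y_def[symmetric] ln_gauss_density[OF W] ln_gauss_density[OF Y] c_def add.assoc
      by linarith
    ultimately show ?thesis unfolding N_def by linarith
  qed
  then show ?thesis by blast
qed

lemma borel_measurable_info_density [measurable]:
  "info_density G K \<in> borel_measurable (borel \<Otimes>\<^sub>M (borel \<Otimes>\<^sub>M borel))"
  unfolding info_density_def by measurable

text \<open>The mean is the mutual information: each of the two quadratic forms averages to the
  trace of an identity matrix, so they cancel and only the log-determinants remain.\<close>

lemma
  fixes G :: "real^'t^'r" and K :: "real^'s^'r"
  shows integrable_info_density: "integrable triple_gauss (info_density G K)"
    and integrable_info_density_square: "integrable triple_gauss (\<lambda>x. (info_density G K x)\<^sup>2)"
    and integral_info_density: "(\<integral>x. info_density G K x \<partial>triple_gauss) = tin_rate G K (mat 1) (mat 1)"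
proof -
  obtain a b where bd: "\<And>u v z. \<bar>info_density G K (u, v, z)\<bar> \<le> a + b * ((norm u)\<^sup>2 + (norm v)\<^sup>2 + (norm z)\<^sup>2)"
    using info_density_quadratic_bound[of G K] by blast
  \<comment> \<open>Cauchy-Schwarz with four summands, hence the factor 4.\<close>
  have sq: "(a + b * (x + y + z))\<^sup>2 \<le> 4 * a\<^sup>2 + 4 * b\<^sup>2 * (x\<^sup>2 + y\<^sup>2 + z\<^sup>2)" for x y z :: real
    using sum_squared_le_sum_of_squares[of "\<lambda>i::nat. if i = 0 then a else if i = 1 then b * x else if i = 2 then b * y else b * z" "{..<4}"]
    by (simp add: eval_nat_numeral algebra_simps power2_eq_square)
  show i2: "integrable triple_gauss (\<lambda>x. (info_density G K x)\<^sup>2)"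
  proof (rule Bochner_Integration.integrable_bound[OF integrable_triple_gauss_norm4[of "4 * a\<^sup>2" "4 * b\<^sup>2"]])
    show "AE x in triple_gauss. norm ((info_density G K x)\<^sup>2) \<le> norm (case x of (u, v, z) \<Rightarrow> 4 * a\<^sup>2 + 4 * b\<^sup>2 * (norm u ^ 4 + norm v ^ 4 + norm z ^ 4))"
    proof (intro AE_I2, clarify)
      fix u :: "real^'t" and v :: "real^'s" and z :: "real^'r"
      have "(info_density G K (u, v, z))\<^sup>2 = \<bar>info_density G K (u, v, z)\<bar>\<^sup>2" by simp
      also have "\<dots> \<le> (a + b * ((norm u)\<^sup>2 + (norm v)\<^sup>2 + (norm z)\<^sup>2))\<^sup>2" by (intro power_mono bd) simp
      also have "\<dots> \<le> 4 * a\<^sup>2 + 4 * b\<^sup>2 * (norm u ^ 4 + norm v ^ 4 + norm z ^ 4)" using sq[of "(norm u)\<^sup>2" "(norm v)\<^sup>2" "(norm z)\<^sup>2"] by simp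
      finally show "norm ((info_density G K (u, v, z))\<^sup>2) \<le> norm (4 * a\<^sup>2 + 4 * b\<^sup>2 * (norm u ^ 4 + norm v ^ 4 + norm z ^ 4))" by simp
    qed
  qed measurable
  interpret T: prob_space "triple_gauss :: ((real^'t) \<times> (real^'s) \<times> (real^'r)) measure" by (rule prob_space_triple_gauss)
  show i1: "integrable triple_gauss (info_density G K)"
    by (rule T.square_integrable_imp_integrable[OF _ i2]) measurable
  interpret A: prob_space "std_gaussian_vec :: (real^'t) measure" by (rule prob_space_std_gaussian_vec)
  interpret B: prob_space "std_gaussian_vec :: (real^'s) measure" by (rule prob_space_std_gaussian_vec)
  interpret C: prob_space "std_gaussian_vec :: (real^'r) measure" by (rule prob_space_std_gaussian_vec)
  interpret BC: pair_prob_space "std_gaussian_vec :: (real^'s) measure" "std_gaussian_vec :: (real^'r) measure" ..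
  interpret ABC: pair_prob_space "std_gaussian_vec :: (real^'t) measure" "std_gaussian_vec \<Otimes>\<^sub>M std_gaussian_vec :: ((real^'s) \<times> (real^'r)) measure" ..
  define W where "W = mat 1 + K ** transpose K"
  define Y where "Y = W + G ** transpose G"
  have W: "posdef W" unfolding W_def by (intro posdef_add_psd posdef_mat_1 psd_mult_transpose)
  have Y: "posdef Y" unfolding Y_def by (intro posdef_add_psd W psd_mult_transpose)
  define c where "c = (ln (det Y) - ln (det W)) / 2"
  define QW QY where "QW = matrix_inv W" and "QY = matrix_inv Y"
  define d :: real where "d = real CARD('r)"
  have trW: "trace QW + trace (QW ** K ** transpose K) = d"
  proof -
    have "trace QW + trace (QW ** K ** transpose K) = trace (QW ** W)"
      by (simp add: W_def matrix_add_ldistrib trace_add matrix_mul_assoc)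
    then show ?thesis using W by (simp add: QW_def matrix_inv_left' posdef_invertible trace_I d_def)
  qed
  have trY: "trace QY + trace (QY ** K ** transpose K) + trace (QY ** G ** transpose G) = d"
  proof -
    have "trace QY + trace (QY ** K ** transpose K) + trace (QY ** G ** transpose G) = trace (QY ** Y)"
      by (simp add: Y_def W_def matrix_add_ldistrib trace_add matrix_mul_assoc)
    then show ?thesis using Y by (simp add: QY_def matrix_inv_left' posdef_invertible trace_I d_def)
  qed
  \<comment> \<open>Written so that \<open>integral_std_gaussian_vec_quadratic\<close> applies first
    to \<open>z\<close>, then to \<open>v\<close>, then to \<open>u\<close>, with the variables
    still to be integrated as the offset.\<close>
  have ex: "info_density G K (u, v, z) = c + ((mat 1 *v z + (K *v v + G *v u)) \<bullet> (QY *v (mat 1 *v z + (K *v v + G *v u)))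
      - (mat 1 *v z + K *v v) \<bullet> (QW *v (mat 1 *v z + K *v v))) / 2" for u v z
    unfolding info_density_def case_prod_conv W_def[symmetric] Y_def[symmetric] ln_gauss_density[OF W] ln_gauss_density[OF Y] c_def QW_def QY_def
    using posdef_det_pos[OF W] posdef_det_pos[OF Y] by (simp add: ln_mult add_ac diff_divide_distrib add_divide_distrib)
  have e1: "(\<integral>z. info_density G K (u, v, z) \<partial>std_gaussian_vec)
     = c + ((trace QY + (K *v v + G *v u) \<bullet> (QY *v (K *v v + G *v u))) - (trace QW + (K *v v + 0) \<bullet> (QW *v (K *v v + 0)))) / 2" for u v
    unfolding ex using integrable_std_gaussian_vec_quadratic[of "mat 1" "K *v v + G *v u" QY] integrable_std_gaussian_vec_quadratic[of "mat 1" "K *v v" QW]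
      integral_std_gaussian_vec_quadratic[of "mat 1" "K *v v + G *v u" QY] integral_std_gaussian_vec_quadratic[of "mat 1" "K *v v" QW]
    by (simp add: C.prob_space[unfolded space_std_gaussian_vec] del: matrix_vector_mul_lid)
  have e2: "(\<integral>v. (\<integral>z. info_density G K (u, v, z) \<partial>std_gaussian_vec) \<partial>std_gaussian_vec)
     = c + ((trace QY + trace (QY ** K ** transpose K) + (G *v u + 0) \<bullet> (QY *v (G *v u + 0))) - d) / 2" for u
    unfolding e1 trW[symmetric] using integrable_std_gaussian_vec_quadratic[of K "G *v u" QY] integrable_std_gaussian_vec_quadratic[of K 0 QW]
      integral_std_gaussian_vec_quadratic[of K "G *v u" QY] integral_std_gaussian_vec_quadratic[of K 0 QW]
    by (simp add: B.prob_space[unfolded space_std_gaussian_vec] del: add_0_right)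
  have e3: "(\<integral>u. (\<integral>v. (\<integral>z. info_density G K (u, v, z) \<partial>std_gaussian_vec) \<partial>std_gaussian_vec) \<partial>std_gaussian_vec) = c"
    unfolding e2 using integrable_std_gaussian_vec_quadratic[of G 0 QY] integral_std_gaussian_vec_quadratic[of G 0 QY] trY
    by (simp add: A.prob_space[unfolded space_std_gaussian_vec] del: add_0_right)
  have "(\<integral>x. info_density G K x \<partial>triple_gauss) = (\<integral>u. (\<integral>p. info_density G K (u, p) \<partial>(std_gaussian_vec \<Otimes>\<^sub>M std_gaussian_vec)) \<partial>std_gaussian_vec)"
    by (rule ABC.integral_fst'[OF i1, symmetric])
  also have "\<dots> = (\<integral>u. (\<integral>v. (\<integral>z. info_density G K (u, v, z) \<partial>std_gaussian_vec) \<partial>std_gaussian_vec) \<partial>std_gaussian_vec)"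
  proof (rule Bochner_Integration.integral_cong[OF refl])
    fix u :: "real^'t"
    have "integrable (std_gaussian_vec \<Otimes>\<^sub>M std_gaussian_vec) (\<lambda>p. info_density G K (u, p))"
    proof (rule BC.P.square_integrable_imp_integrable)
      show "(\<lambda>p. info_density G K (u, p)) \<in> borel_measurable (std_gaussian_vec \<Otimes>\<^sub>M std_gaussian_vec)"
        unfolding info_density_def case_prod_conv by measurable
      show "integrable (std_gaussian_vec \<Otimes>\<^sub>M std_gaussian_vec) (\<lambda>p. (info_density G K (u, p))\<^sup>2)"
      proof (rule Bochner_Integration.integrable_bound)
        show "integrable (std_gaussian_vec \<Otimes>\<^sub>M std_gaussian_vec) (\<lambda>p::(real^'s) \<times> (real^'r). 4 * a\<^sup>2 + 4 * b\<^sup>2 * (norm u ^ 4 + norm (fst p) ^ 4 + norm (snd p) ^ 4))"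
          by (intro Bochner_Integration.integrable_add integrable_mult_right
            integral_pair_fst(1) integral_pair_snd(1) prob_space_std_gaussian_vec integrable_std_gaussian_vec_norm4) simp_all
        show "(\<lambda>p. (info_density G K (u, p))\<^sup>2) \<in> borel_measurable (std_gaussian_vec \<Otimes>\<^sub>M std_gaussian_vec)"
          unfolding info_density_def case_prod_conv by measurable
        show "AE p in std_gaussian_vec \<Otimes>\<^sub>M std_gaussian_vec. norm ((info_density G K (u, p))\<^sup>2)
          \<le> norm (4 * a\<^sup>2 + 4 * b\<^sup>2 * (norm u ^ 4 + norm (fst p) ^ 4 + norm (snd p) ^ 4))"
        proof (intro AE_I2, clarify)
          fix v :: "real^'s" and z :: "real^'r"
          have "(info_density G K (u, v, z))\<^sup>2 = \<bar>info_density G K (u, v, z)\<bar>\<^sup>2" by simp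
          also have "\<dots> \<le> (a + b * ((norm u)\<^sup>2 + (norm v)\<^sup>2 + (norm z)\<^sup>2))\<^sup>2" by (intro power_mono bd) simp
          also have "\<dots> \<le> 4 * a\<^sup>2 + 4 * b\<^sup>2 * (norm u ^ 4 + norm v ^ 4 + norm z ^ 4)" using sq[of "(norm u)\<^sup>2" "(norm v)\<^sup>2" "(norm z)\<^sup>2"] by simp
          finally show "norm ((info_density G K (u, v, z))\<^sup>2) \<le> norm (4 * a\<^sup>2 + 4 * b\<^sup>2 * (norm u ^ 4 + norm (fst (v, z)) ^ 4 + norm (snd (v, z)) ^ 4))" by simp
        qed
      qed
    qed
    then show "(\<integral>p. info_density G K (u, p) \<partial>(std_gaussian_vec \<Otimes>\<^sub>M std_gaussian_vec)) = (\<integral>v. (\<integral>z. info_density G K (u, v, z) \<partial>std_gaussian_vec) \<partial>std_gaussian_vec)"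
      by (rule BC.integral_fst'[symmetric])
  qed
  also note e3
  also have "c = tin_rate G K (mat 1) (mat 1)"
    by (simp add: c_def tin_rate_eq[OF posdef_imp_psd posdef_imp_psd, OF posdef_mat_1 posdef_mat_1] Y_def W_def)
  finally show "(\<integral>x. info_density G K x \<partial>triple_gauss) = tin_rate G K (mat 1) (mat 1)" .
qed


section \<open>Threshold decoding\<close>

definition tin_test :: "nat \<Rightarrow> real^'t^'r \<Rightarrow> real^'s^'r \<Rightarrow> real \<Rightarrow> (nat \<Rightarrow> real^'t) \<Rightarrow> (nat \<Rightarrow> real^'r) \<Rightarrow> bool" where
  "tin_test n G K \<gamma> u y \<longleftrightarrow>
     exp (real n * \<gamma>) * block_density n (mat 1 + K ** transpose K + G ** transpose G) y
       < block_density n (mat 1 + K ** transpose K) (\<lambda>j. y j - G *v u j)"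

text \<open>The union bound holds whichever of several passing codewords is taken. If none passes,
  the default 0 is still a message.\<close>

definition tin_decoder ::
  "nat \<Rightarrow> nat \<Rightarrow> real^'t^'r \<Rightarrow> real^'s^'r \<Rightarrow> real \<Rightarrow> (nat \<Rightarrow> nat \<Rightarrow> real^'t) \<Rightarrow> (nat \<Rightarrow> real^'r) \<Rightarrow> nat" where
  "tin_decoder n M G K \<gamma> \<xi> y =
     (if \<exists>m<M. tin_test n G K \<gamma> (\<xi> m) y then LEAST m. m < M \<and> tin_test n G K \<gamma> (\<xi> m) y else 0)"

text \<open>As nonnegative integrals with values in \<open>ennreal\<close>, this and
  \<open>alarm_prob\<close> can be averaged over codebooks by Fubini's theorem as soon as they are
  measurable. Here the sent codeword fails the test; there a competitor passes it.\<close>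

definition miss_prob :: "nat \<Rightarrow> real^'t^'r \<Rightarrow> real^'s^'r \<Rightarrow> real \<Rightarrow> (nat \<Rightarrow> real^'t) \<Rightarrow> (nat \<Rightarrow> real^'s) \<Rightarrow> ennreal" where
  "miss_prob n G K \<gamma> u v = (\<integral>\<^sup>+z. (if tin_test n G K \<gamma> u (received n G K u v z) then 0 else 1) \<partial>noise_block n)"

definition alarm_prob ::
  "nat \<Rightarrow> real^'t^'r \<Rightarrow> real^'s^'r \<Rightarrow> real \<Rightarrow> (nat \<Rightarrow> real^'t) \<Rightarrow> (nat \<Rightarrow> real^'t) \<Rightarrow> (nat \<Rightarrow> real^'s) \<Rightarrow> ennreal" where
  "alarm_prob n G K \<gamma> u' u v = (\<integral>\<^sup>+z. (if tin_test n G K \<gamma> u' (received n G K u v z) then 1 else 0) \<partial>noise_block n)"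

lemma sets_noise_block [measurable_cong]: "sets (noise_block n :: (nat \<Rightarrow> real^'r) measure) = sets (\<Pi>\<^sub>M j\<in>{..<n}. borel)"
  unfolding noise_block_eq by (rule sets_gauss_block)

lemma prob_space_noise_block: "prob_space (noise_block n :: (nat \<Rightarrow> real^'r) measure)"
  unfolding noise_block_eq by (rule prob_space_gauss_block[OF posdef_mat_1])

lemma measurable_tin_test [measurable (raw)]:
  assumes [measurable]: "u \<in> \<Omega> \<rightarrow>\<^sub>M (\<Pi>\<^sub>M j\<in>{..<n}. borel)" "y \<in> \<Omega> \<rightarrow>\<^sub>M (\<Pi>\<^sub>M j\<in>{..<n}. borel)"
  shows "Measurable.pred \<Omega> (\<lambda>\<omega>. tin_test n G K \<gamma> (u \<omega>) (y \<omega>))"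
  unfolding tin_test_def by measurable

lemma measurable_received [measurable (raw)]:
  assumes [measurable]: "u \<in> \<Omega> \<rightarrow>\<^sub>M (\<Pi>\<^sub>M j\<in>{..<n}. borel)" "v \<in> \<Omega> \<rightarrow>\<^sub>M (\<Pi>\<^sub>M j\<in>{..<n}. borel)"
    "z \<in> \<Omega> \<rightarrow>\<^sub>M (\<Pi>\<^sub>M j\<in>{..<n}. borel)"
  shows "(\<lambda>\<omega>. received n G K (u \<omega>) (v \<omega>) (z \<omega>)) \<in> \<Omega> \<rightarrow>\<^sub>M (\<Pi>\<^sub>M j\<in>{..<n}. borel)"
  unfolding received_def by measurable

lemma borel_measurable_miss_prob [measurable (raw)]:
  fixes G :: "real^'t^'r"
  assumes [measurable]: "u \<in> \<Omega> \<rightarrow>\<^sub>M (\<Pi>\<^sub>M j\<in>{..<n}. borel)" "v \<in> \<Omega> \<rightarrow>\<^sub>M (\<Pi>\<^sub>M j\<in>{..<n}. borel)"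
  shows "(\<lambda>\<omega>. miss_prob n G K \<gamma> (u \<omega>) (v \<omega>)) \<in> borel_measurable \<Omega>"
proof -
  interpret prob_space "noise_block n :: (nat \<Rightarrow> real^'r) measure" by (rule prob_space_noise_block)
  show ?thesis unfolding miss_prob_def by measurable
qed

lemma borel_measurable_alarm_prob [measurable (raw)]:
  fixes G :: "real^'t^'r"
  assumes [measurable]: "u' \<in> \<Omega> \<rightarrow>\<^sub>M (\<Pi>\<^sub>M j\<in>{..<n}. borel)" "u \<in> \<Omega> \<rightarrow>\<^sub>M (\<Pi>\<^sub>M j\<in>{..<n}. borel)" "v \<in> \<Omega> \<rightarrow>\<^sub>M (\<Pi>\<^sub>M j\<in>{..<n}. borel)"
  shows "(\<lambda>\<omega>. alarm_prob n G K \<gamma> (u' \<omega>) (u \<omega>) (v \<omega>)) \<in> borel_measurable \<Omega>"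
proof -
  interpret prob_space "noise_block n :: (nat \<Rightarrow> real^'r) measure" by (rule prob_space_noise_block)
  show ?thesis unfolding alarm_prob_def by measurable
qed

lemma decoder_tin_decoder:
  assumes M: "0 < M" and \<xi>: "\<And>m. m < M \<Longrightarrow> \<xi> m \<in> space (noise_block n)"
  shows "decoder n M (tin_decoder n M G K \<gamma> \<xi>)"
proof -
  have sp: "space (noise_block n :: (nat \<Rightarrow> real^'t) measure) = space (\<Pi>\<^sub>M j\<in>{..<n}. borel)"
    by (rule sets_eq_imp_space_eq[OF sets_noise_block])
  have t: "Measurable.pred (\<Pi>\<^sub>M j\<in>{..<n}. borel) (\<lambda>y. m < M \<and> tin_test n G K \<gamma> (\<xi> m) y)" for m
  proof (cases "m < M")
    case True
    have "(\<lambda>y. \<xi> m) \<in> (\<Pi>\<^sub>M j\<in>{..<n}. borel) \<rightarrow>\<^sub>M (\<Pi>\<^sub>M j\<in>{..<n}. borel)"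
      using \<xi>[OF True] by (intro measurable_const) (simp add: sp)
    then show ?thesis by measurable
  qed simp
  have "Measurable.pred (\<Pi>\<^sub>M j\<in>{..<n}. borel) (\<lambda>y. \<exists>m<M. tin_test n G K \<gamma> (\<xi> m) y)"
    by (intro pred_intros_countable t)
  moreover have "(\<lambda>y. LEAST m. m < M \<and> tin_test n G K \<gamma> (\<xi> m) y) \<in> (\<Pi>\<^sub>M j\<in>{..<n}. borel) \<rightarrow>\<^sub>M count_space UNIV"
    using t by (rule measurable_Least)
  moreover have "(\<lambda>y. if Q y then f y else 0) \<in> N \<rightarrow>\<^sub>M count_space UNIV"
    if "Measurable.pred N Q" "f \<in> N \<rightarrow>\<^sub>M count_space UNIV" for Q and f :: "'w \<Rightarrow> nat" and N
    using that by measurable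
  ultimately have d: "tin_decoder n M G K \<gamma> \<xi> \<in> (\<Pi>\<^sub>M j\<in>{..<n}. borel) \<rightarrow>\<^sub>M count_space UNIV"
    unfolding tin_decoder_def[abs_def] by blast
  have lt: "tin_decoder n M G K \<gamma> \<xi> y < M" for y
    using M LeastI_ex[of "\<lambda>m. m < M \<and> tin_test n G K \<gamma> (\<xi> m) y"] by (auto simp: tin_decoder_def)
  show ?thesis unfolding decoder_def
    by (rule measurableI) (use lt measurable_sets[OF d] in \<open>auto simp: space_PiM\<close>)
qed

text \<open>Union bound: if the sent codeword passes the test, then the decoded one passes as well,
  so a wrong decision requires a miss or a false alarm.\<close>

lemma error_prob_tin_decoder_le:
  fixes G :: "real^'t^'r" and K :: "real^'s^'r"
  assumes M: "0 < M" and N: "0 < N" and \<xi>: "\<And>m. m < M \<Longrightarrow> \<xi> m \<in> space (noise_block n)" and \<zeta>: "\<And>l. l < N \<Longrightarrow> \<zeta> l \<in> space (noise_block n)"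
  shows "ennreal (error_prob n M N G K \<xi> \<zeta> (tin_decoder n M G K \<gamma> \<xi>))
    \<le> ennreal (1 / (real M * real N)) * (\<Sum>m<M. \<Sum>l<N. miss_prob n G K \<gamma> (\<xi> m) (\<zeta> l) + (\<Sum>m'\<in>{..<M} - {m}. alarm_prob n G K \<gamma> (\<xi> m') (\<xi> m) (\<zeta> l)))"
proof -
  interpret prob_space "noise_block n :: (nat \<Rightarrow> real^'r) measure" by (rule prob_space_noise_block)
  let ?d = "tin_decoder n M G K \<gamma> \<xi>"
  have dec: "decoder n M ?d" by (rule decoder_tin_decoder[OF M \<xi>])
  have sp: "space (noise_block n :: (nat \<Rightarrow> real^'q) measure) = space (\<Pi>\<^sub>M j\<in>{..<n}. borel)"
    by (rule sets_eq_imp_space_eq[OF sets_noise_block])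
  have cm: "(\<lambda>z. w) \<in> (noise_block n :: (nat \<Rightarrow> real^'r) measure) \<rightarrow>\<^sub>M (\<Pi>\<^sub>M j\<in>{..<n}. borel)"
    if "w \<in> space (noise_block n)" for w :: "nat \<Rightarrow> real^'q"
    using that by (intro measurable_const) (simp add: sp)
  have each: "ennreal (prob {z \<in> space (noise_block n). ?d (received n G K (\<xi> m) (\<zeta> l) z) \<noteq> m})
    \<le> miss_prob n G K \<gamma> (\<xi> m) (\<zeta> l) + (\<Sum>m'\<in>{..<M} - {m}. alarm_prob n G K \<gamma> (\<xi> m') (\<xi> m) (\<zeta> l))" if m: "m < M" and l: "l < N" for m l
  proof -
    let ?y = "received n G K (\<xi> m) (\<zeta> l)"
    note [measurable] = cm[OF \<xi>[OF m]] cm[OF \<zeta>[OF l]]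
    have tm[measurable]: "Measurable.pred (noise_block n) (\<lambda>z. tin_test n G K \<gamma> (\<xi> m') (?y z))" if "m' < M" for m'
    proof -
      note [measurable] = cm[OF \<xi>[OF that]]
      show ?thesis by measurable
    qed
    have tmi: "(\<lambda>z. if tin_test n G K \<gamma> (\<xi> m') (?y z) then 1 else 0 :: ennreal) \<in> borel_measurable (noise_block n)" if "m' < M" for m'
    proof -
      note [measurable] = tm[OF that]
      show ?thesis by measurable
    qed
    have B: "{z \<in> space (noise_block n). ?d (?y z) \<noteq> m} \<in> sets (noise_block n)"
    proof -
      have "(\<lambda>z. ?d (?y z)) \<in> noise_block n \<rightarrow>\<^sub>M count_space {..<M}"
        using dec unfolding decoder_def by measurable
      then have "(\<lambda>z. ?d (?y z)) \<in> noise_block n \<rightarrow>\<^sub>M count_space UNIV"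
        by (rule measurable_compose) simp
      then show ?thesis by measurable
    qed
    have "ennreal (prob {z \<in> space (noise_block n). ?d (?y z) \<noteq> m}) = (\<integral>\<^sup>+z. indicator {z \<in> space (noise_block n). ?d (?y z) \<noteq> m} z \<partial>noise_block n)"
      using B by (simp add: emeasure_eq_measure)
    also have "\<dots> \<le> (\<integral>\<^sup>+z. (if tin_test n G K \<gamma> (\<xi> m) (?y z) then 0 else 1) + (\<Sum>m'\<in>{..<M} - {m}. if tin_test n G K \<gamma> (\<xi> m') (?y z) then 1 else 0) \<partial>noise_block n)"
    proof (rule nn_integral_mono)
      fix z :: "nat \<Rightarrow> real^'r"
      show "indicator {z \<in> space (noise_block n). ?d (?y z) \<noteq> m} z
        \<le> ((if tin_test n G K \<gamma> (\<xi> m) (?y z) then 0 else 1) + (\<Sum>m'\<in>{..<M} - {m}. if tin_test n G K \<gamma> (\<xi> m') (?y z) then 1 else 0) :: ennreal)"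
      \<comment> \<open>The only case with content: the sent codeword passes, but another message is
        decoded. Its term in the sum is one.\<close>
      proof (cases "?d (?y z) \<noteq> m \<and> tin_test n G K \<gamma> (\<xi> m) (?y z)")
        case True
        then have ex: "\<exists>m'. m' < M \<and> tin_test n G K \<gamma> (\<xi> m') (?y z)" using m by blast
        then have "?d (?y z) < M" "tin_test n G K \<gamma> (\<xi> (?d (?y z))) (?y z)"
          using LeastI_ex[OF ex] unfolding tin_decoder_def by auto
        then have "(1::ennreal) \<le> (\<Sum>m'\<in>{..<M} - {m}. if tin_test n G K \<gamma> (\<xi> m') (?y z) then 1 else 0)"
          using True member_le_sum[of "?d (?y z)" "{..<M} - {m}" "\<lambda>m'. if tin_test n G K \<gamma> (\<xi> m') (?y z) then 1 else (0::ennreal)"] by simp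
        then show ?thesis using True by (auto simp: indicator_def)
      qed (auto simp: indicator_def)
    qed
    also have "\<dots> = miss_prob n G K \<gamma> (\<xi> m) (\<zeta> l) + (\<Sum>m'\<in>{..<M} - {m}. alarm_prob n G K \<gamma> (\<xi> m') (\<xi> m) (\<zeta> l))"
    proof -
      have 1: "(\<integral>\<^sup>+z. (\<Sum>m'\<in>{..<M} - {m}. if tin_test n G K \<gamma> (\<xi> m') (?y z) then 1 else 0) \<partial>noise_block n)
        = (\<Sum>m'\<in>{..<M} - {m}. alarm_prob n G K \<gamma> (\<xi> m') (\<xi> m) (\<zeta> l))"
        unfolding alarm_prob_def by (rule nn_integral_sum) (rule tmi, simp)
      show ?thesis unfolding 1[symmetric] miss_prob_def using tm[OF m]
        by (intro nn_integral_add borel_measurable_sum tmi) auto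
    qed
    finally show ?thesis .
  qed
  have "ennreal (error_prob n M N G K \<xi> \<zeta> ?d)
    = ennreal (1 / (real M * real N)) * (\<Sum>m<M. \<Sum>l<N. ennreal (prob {z \<in> space (noise_block n). ?d (received n G K (\<xi> m) (\<zeta> l) z) \<noteq> m}))"
    unfolding error_prob_eq[OF M N dec]
    by (simp add: sum_ennreal sum_nonneg flip: ennreal_mult)
  also have "\<dots> \<le> ennreal (1 / (real M * real N)) * (\<Sum>m<M. \<Sum>l<N. miss_prob n G K \<gamma> (\<xi> m) (\<zeta> l) + (\<Sum>m'\<in>{..<M} - {m}. alarm_prob n G K \<gamma> (\<xi> m') (\<xi> m) (\<zeta> l)))"
    by (intro mult_left_mono sum_mono each) auto
  finally show ?thesis .
qed

text \<open>Over a fresh Gaussian codeword, the likelihood of a fixed \<open>y\<close> averages to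
  the reference density of \<open>y\<close>. The ratio in the test thus has mean one, and Markov's
  inequality bounds the chance that it exceeds \<open>exp (n \<gamma>)\<close>, for each
  \<open>y\<close> separately.\<close>

lemma nn_integral_alarm_prob_le:
  fixes G :: "real^'t^'r" and K :: "real^'s^'r"
  assumes u: "u \<in> space (noise_block n)" and v: "v \<in> space (noise_block n)"
  shows "(\<integral>\<^sup>+u'. alarm_prob n G K \<gamma> u' u v \<partial>noise_block n) \<le> ennreal (exp (- (real n * \<gamma>)))"
proof -
  interpret Z: prob_space "noise_block n :: (nat \<Rightarrow> real^'r) measure" by (rule prob_space_noise_block)
  interpret U: prob_space "noise_block n :: (nat \<Rightarrow> real^'t) measure" by (rule prob_space_noise_block)
  interpret p: pair_prob_space "noise_block n :: (nat \<Rightarrow> real^'r) measure" "noise_block n :: (nat \<Rightarrow> real^'t) measure" ..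
  define W where "W = mat 1 + K ** transpose K"
  define Y where "Y = W + G ** transpose G"
  have W: "posdef W" unfolding W_def by (intro posdef_add_psd posdef_mat_1 psd_mult_transpose)
  have Y: "posdef Y" unfolding Y_def by (intro posdef_add_psd W psd_mult_transpose)
  have sp: "space (noise_block n :: (nat \<Rightarrow> real^'q) measure) = space (\<Pi>\<^sub>M j\<in>{..<n}. borel)"
    by (rule sets_eq_imp_space_eq[OF sets_noise_block])
  have [measurable]: "(\<lambda>z. w) \<in> \<Omega> \<rightarrow>\<^sub>M (\<Pi>\<^sub>M j\<in>{..<n}. borel)"
    if "w \<in> space (noise_block n)" for w :: "nat \<Rightarrow> real^'q" and \<Omega> :: "'w measure"
    using that by (intro measurable_const) (simp add: sp)
  note [measurable] = this[OF u] this[OF v]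
  let ?y = "received n G K u v"
  have "(\<integral>\<^sup>+u'. alarm_prob n G K \<gamma> u' u v \<partial>noise_block n)
    = (\<integral>\<^sup>+z. \<integral>\<^sup>+u'. (if tin_test n G K \<gamma> u' (?y z) then 1 else 0) \<partial>noise_block n \<partial>noise_block n)"
    unfolding alarm_prob_def by (rule p.Fubini') measurable
  also have "\<dots> \<le> (\<integral>\<^sup>+z. ennreal (exp (- (real n * \<gamma>))) \<partial>(noise_block n :: (nat \<Rightarrow> real^'r) measure))"
  proof (rule nn_integral_mono)
    fix z :: "nat \<Rightarrow> real^'r" assume z: "z \<in> space (noise_block n)"
    define y where "y = ?y z"
    have yp: "0 < block_density n Y y" by (rule block_density_pos[OF Y])
    \<comment> \<open>Passing the test means that \<open>k\<close> times the likelihood exceeds one,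
      so it dominates the indicator.\<close>
    define k where "k = exp (- (real n * \<gamma>)) / block_density n Y y"
    have k: "0 \<le> k" using yp by (simp add: k_def)
    have "(\<integral>\<^sup>+u'. (if tin_test n G K \<gamma> u' y then 1 else 0) \<partial>(noise_block n :: (nat \<Rightarrow> real^'t) measure))
      \<le> (\<integral>\<^sup>+u'. ennreal k * ennreal (block_density n W (\<lambda>j. y j - G *v u' j)) \<partial>noise_block n)"
    proof (rule nn_integral_mono)
      fix u' :: "nat \<Rightarrow> real^'t"
      have "tin_test n G K \<gamma> u' y \<Longrightarrow> 1 \<le> k * block_density n W (\<lambda>j. y j - G *v u' j)"
        using yp by (simp add: tin_test_def W_def[symmetric] Y_def[symmetric] k_def exp_minus field_simps)
      then show "(if tin_test n G K \<gamma> u' y then 1 else 0) \<le> ennreal k * ennreal (block_density n W (\<lambda>j. y j - G *v u' j))"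
        using k block_density_nonneg[OF W] by (auto simp flip: ennreal_mult)
    qed
    also have "\<dots> = ennreal k * (\<integral>\<^sup>+u'. ennreal (block_density n W (\<lambda>j. y j - G *v u' j)) \<partial>noise_block n)"
      by (rule nn_integral_cmult) measurable
    also have "(\<integral>\<^sup>+u'. ennreal (block_density n W (\<lambda>j. y j - G *v u' j)) \<partial>noise_block n)
      = (\<integral>\<^sup>+u'. ennreal (block_density n (mat 1) u' * block_density n W (\<lambda>j. y j - G *v u' j)) \<partial>block_lborel n)"
      unfolding noise_block_eq gauss_block_eq_density[OF posdef_mat_1]
      by (subst nn_integral_density) (simp_all add: ennreal_mult block_density_nonneg posdef_mat_1 W)
    also have "\<dots> = ennreal (block_density n Y y)"
      using nn_integral_block_conv[OF posdef_mat_1 W, of n y G] by (simp add: Y_def)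
    also have "ennreal k * \<dots> = ennreal (exp (- (real n * \<gamma>)))"
      using yp k by (simp add: k_def flip: ennreal_mult)
    finally show "(\<integral>\<^sup>+u'. (if tin_test n G K \<gamma> u' (?y z) then 1 else 0) \<partial>(noise_block n :: (nat \<Rightarrow> real^'t) measure))
      \<le> ennreal (exp (- (real n * \<gamma>)))" by (simp add: y_def)
  qed
  also have "\<dots> = ennreal (exp (- (real n * \<gamma>)))" by (simp add: Z.emeasure_space_1)
  finally show ?thesis .
qed

text \<open>\<open>tin_test\<close> is a likelihood ratio test with the quotient multiplied out.
  Taking logarithms turns block densities into sums over channel uses.\<close>

lemma tin_test_iff:
  fixes G :: "real^'t^'r" and K :: "real^'s^'r"
  shows "tin_test n G K \<gamma> u (received n G K u v z) \<longleftrightarrow> real n * \<gamma> < (\<Sum>j<n. info_density G K (u j, v j, z j))"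
proof -
  define W where "W = mat 1 + K ** transpose K"
  define Y where "Y = W + G ** transpose G"
  have W: "posdef W" unfolding W_def by (intro posdef_add_psd posdef_mat_1 psd_mult_transpose)
  have Y: "posdef Y" unfolding Y_def by (intro posdef_add_psd W psd_mult_transpose)
  let ?w = "\<lambda>j. K *v v j + z j" and ?y = "\<lambda>j. G *v u j + K *v v j + z j"
  have e1: "block_density n W (\<lambda>j. received n G K u v z j - G *v u j) = block_density n W ?w"
    by (rule block_density_cong) (simp add: received_def)
  have e2: "block_density n Y (received n G K u v z) = block_density n Y ?y"
    by (rule block_density_cong) (simp add: received_def)
  have pos: "0 < block_density n W ?w" "0 < block_density n Y ?y" by (intro block_density_pos W Y)+
  have "(\<Sum>j<n. info_density G K (u j, v j, z j)) = ln (block_density n W ?w) - ln (block_density n Y ?y)"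
    unfolding block_density_def info_density_def case_prod_conv W_def[symmetric] Y_def[symmetric] sum_subtractf
    by (subst (1 2) ln_prod) (use gauss_density_pos[OF W, THEN less_imp_neq] gauss_density_pos[OF Y, THEN less_imp_neq] in auto)
  moreover have "tin_test n G K \<gamma> u (received n G K u v z) \<longleftrightarrow> exp (real n * \<gamma>) * block_density n Y ?y < block_density n W ?w"
    unfolding tin_test_def W_def[symmetric] Y_def[symmetric] e1 e2 ..
  moreover have "\<dots> \<longleftrightarrow> ln (exp (real n * \<gamma>) * block_density n Y ?y) < ln (block_density n W ?w)"
    using pos by (subst ln_less_cancel_iff) auto
  ultimately show ?thesis using pos by (simp add: ln_mult less_diff_eq)
qed

text \<open>Averaged over random codewords of both users, inputs and noise form i.i.d. triples, so
  the interference acts as Gaussian noise. A miss means that information densities of mean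
  \<open>I\<close> sum to at most \<open>n (I - \<delta>)\<close>, and the weak law applies.\<close>

lemma nn_integral_miss_prob_le:
  fixes G :: "real^'t^'r" and K :: "real^'s^'r"
  assumes n: "0 < n" and \<delta>: "0 < \<delta>"
  defines "I \<equiv> tin_rate G K (mat 1) (mat 1)"
  shows "(\<integral>\<^sup>+u. \<integral>\<^sup>+v. miss_prob n G K (I - \<delta>) u v \<partial>noise_block n \<partial>noise_block n)
    \<le> ennreal ((\<integral>x. (info_density G K x - I)\<^sup>2 \<partial>triple_gauss) / (real n * \<delta>\<^sup>2))"
proof -
  let ?T = "triple_gauss :: ((real^'t) \<times> (real^'s) \<times> (real^'r)) measure"
  define A where "A = {\<omega> \<in> space (PiM {..<n} (\<lambda>_. ?T)). (\<Sum>j<n. info_density G K (\<omega> j)) \<le> real n * (I - \<delta>)}"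
  have [measurable]: "info_density G K \<in> borel_measurable ?T"
    using integrable_info_density by (rule borel_measurable_integrable)
  have A[measurable]: "A \<in> sets (PiM {..<n} (\<lambda>_. ?T))" unfolding A_def by measurable
  note g = prob_space_std_gaussian_vec
  have nb: "noise_block n = PiM {..<n} (\<lambda>_. std_gaussian_vec)" by (simp add: noise_block_def)
  have "(\<integral>\<^sup>+u. \<integral>\<^sup>+v. miss_prob n G K (I - \<delta>) u v \<partial>noise_block n \<partial>noise_block n)
    = (\<integral>\<^sup>+u. \<integral>\<^sup>+v. \<integral>\<^sup>+z. indicator A (\<lambda>j\<in>{..<n}. (u j, (\<lambda>j\<in>{..<n}. (v j, z j)) j)) \<partial>noise_block n \<partial>noise_block n \<partial>noise_block n)"
    unfolding miss_prob_def tin_test_iff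
    by (intro nn_integral_cong) (auto simp: A_def indicator_def space_PiM space_pair_measure)
  also have "\<dots> = (\<integral>\<^sup>+u. \<integral>\<^sup>+p. indicator A (\<lambda>j\<in>{..<n}. (u j, p j)) \<partial>PiM {..<n} (\<lambda>_. std_gaussian_vec \<Otimes>\<^sub>M std_gaussian_vec) \<partial>noise_block n)"
  proof (rule nn_integral_cong)
    fix u :: "nat \<Rightarrow> real^'t" assume u: "u \<in> space (noise_block n)"
    have m: "(\<lambda>p. \<lambda>j\<in>{..<n}. (u j, p j)) \<in> PiM {..<n} (\<lambda>_. std_gaussian_vec \<Otimes>\<^sub>M std_gaussian_vec) \<rightarrow>\<^sub>M PiM {..<n} (\<lambda>_. ?T)"
      by (intro measurable_restrict measurable_Pair measurable_component_singleton measurable_const) auto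
    show "(\<integral>\<^sup>+v. \<integral>\<^sup>+z. indicator A (\<lambda>j\<in>{..<n}. (u j, (\<lambda>j\<in>{..<n}. (v j, z j)) j)) \<partial>noise_block n \<partial>noise_block n)
      = (\<integral>\<^sup>+p. indicator A (\<lambda>j\<in>{..<n}. (u j, p j)) \<partial>PiM {..<n} (\<lambda>_. std_gaussian_vec \<Otimes>\<^sub>M std_gaussian_vec))"
      unfolding nb by (rule nn_integral_zip_PiM[OF g g]) (use measurable_compose[OF m borel_measurable_indicator[OF A]] in simp_all)
  qed
  also have "\<dots> = (\<integral>\<^sup>+\<omega>. indicator A \<omega> \<partial>PiM {..<n} (\<lambda>_. ?T))"
    unfolding nb by (rule nn_integral_zip_PiM[OF g prob_space_pair[OF g g]]) simp_all
  also have "\<dots> = emeasure (PiM {..<n} (\<lambda>_. ?T)) A" by simp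
  also have "\<dots> \<le> ennreal ((\<integral>x. (info_density G K x - I)\<^sup>2 \<partial>?T) / (real n * \<delta>\<^sup>2))"
    unfolding A_def I_def
    by (rule PiM_weak_law[OF prob_space_triple_gauss integrable_info_density integral_info_density integrable_info_density_square n \<delta>])
  finally show ?thesis .
qed

section \<open>Random codebooks\<close>

definition codebook :: "nat \<Rightarrow> nat \<Rightarrow> (nat \<Rightarrow> nat \<Rightarrow> real^'t) measure" where
  "codebook n M = (\<Pi>\<^sub>M m\<in>{..<M}. noise_block n)"

lemma prob_space_codebook: "prob_space (codebook n M)"
  unfolding codebook_def by (intro prob_space_PiM prob_space_noise_block)

lemma measurable_codebook_component:
  "m < M \<Longrightarrow> (\<lambda>\<xi>. \<xi> m) \<in> codebook n M \<rightarrow>\<^sub>M (\<Pi>\<^sub>M j\<in>{..<n}. borel)"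
  unfolding codebook_def by (subst measurable_cong_sets[OF refl sets_noise_block[symmetric]]) simp

lemma nn_integral_PiM_component:
  assumes N: "prob_space N" and i: "i \<in> I" and f: "f \<in> borel_measurable N"
  shows "(\<integral>\<^sup>+\<omega>. f (\<omega> i) \<partial>PiM I (\<lambda>_. N)) = (\<integral>\<^sup>+x. f x \<partial>N)"
  using distr_PiM_component[of I "\<lambda>_. N" i] N i nn_integral_distr[of "\<lambda>\<omega>. \<omega> i" "PiM I (\<lambda>_. N)" N f] f by simp

text \<open>Every pair of messages obeys the same bound, one miss and \<open>M - 1\<close> false
  alarms, so the average over pairs obeys it too.\<close>

lemma expected_error_le:
  fixes G :: "real^'t^'r" and K :: "real^'s^'r"
  assumes n: "0 < n" and M: "0 < M" and N: "0 < N" and \<delta>: "0 < \<delta>"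
  defines "I \<equiv> tin_rate G K (mat 1) (mat 1)"
  shows "(\<integral>\<^sup>+\<xi>. \<integral>\<^sup>+\<zeta>. ennreal (1 / (real M * real N)) * (\<Sum>m<M. \<Sum>l<N. miss_prob n G K (I - \<delta>) (\<xi> m) (\<zeta> l)
        + (\<Sum>m'\<in>{..<M} - {m}. alarm_prob n G K (I - \<delta>) (\<xi> m') (\<xi> m) (\<zeta> l))) \<partial>codebook n N \<partial>codebook n M)
    \<le> ennreal ((\<integral>x. (info_density G K x - I)\<^sup>2 \<partial>triple_gauss) / (real n * \<delta>\<^sup>2) + (real M - 1) * exp (- (real n * (I - \<delta>))))"
    (is "?L \<le> ennreal (?V + _)")
proof -
  interpret CM: prob_space "codebook n M :: (nat \<Rightarrow> nat \<Rightarrow> real^'t) measure" by (rule prob_space_codebook)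
  interpret CN: prob_space "codebook n N :: (nat \<Rightarrow> nat \<Rightarrow> real^'s) measure" by (rule prob_space_codebook)
  interpret p: pair_prob_space "codebook n M :: (nat \<Rightarrow> nat \<Rightarrow> real^'t) measure" "codebook n N :: (nat \<Rightarrow> nat \<Rightarrow> real^'s) measure" ..
  define \<gamma> where "\<gamma> = I - \<delta>"
  define e where "e = exp (- (real n * \<gamma>))"
  have V: "0 \<le> ?V" using \<delta> by (intro divide_nonneg_nonneg integral_nonneg_AE) auto
  note cf = measurable_compose[OF measurable_fst measurable_codebook_component]
  note cs = measurable_compose[OF measurable_snd measurable_codebook_component]
  have mj: "(\<lambda>x. miss_prob n G K \<gamma> (fst x m) (snd x l)) \<in> borel_measurable (codebook n M \<Otimes>\<^sub>M codebook n N)"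
    if "m < M" "l < N" for m l
    by (intro borel_measurable_miss_prob cf cs that)
  have aj: "(\<lambda>x. alarm_prob n G K \<gamma> (fst x m') (fst x m) (snd x l)) \<in> borel_measurable (codebook n M \<Otimes>\<^sub>M codebook n N)"
    if "m' < M" "m < M" "l < N" for m' m l
    by (intro borel_measurable_alarm_prob cf cs that)
  have mi: "(\<lambda>\<xi>. \<integral>\<^sup>+\<zeta>. miss_prob n G K \<gamma> (\<xi> m) (\<zeta> l) \<partial>codebook n N) \<in> borel_measurable (codebook n M)"
    if "m < M" "l < N" for m l
    by (rule CN.borel_measurable_nn_integral) (use mj[OF that] in \<open>simp add: case_prod_unfold\<close>)
  have ai: "(\<lambda>\<xi>. \<integral>\<^sup>+\<zeta>. alarm_prob n G K \<gamma> (\<xi> m') (\<xi> m) (\<zeta> l) \<partial>codebook n N) \<in> borel_measurable (codebook n M)"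
    if "m' < M" "m < M" "l < N" for m' m l
    by (rule CN.borel_measurable_nn_integral) (use aj[OF that] in \<open>simp add: case_prod_unfold\<close>)
  have miss: "(\<integral>\<^sup>+\<xi>. \<integral>\<^sup>+\<zeta>. miss_prob n G K \<gamma> (\<xi> m) (\<zeta> l) \<partial>codebook n N \<partial>codebook n M) \<le> ennreal ?V" if "m < M" "l < N" for m l
  proof -
    have "(\<integral>\<^sup>+\<xi>. \<integral>\<^sup>+\<zeta>. miss_prob n G K \<gamma> (\<xi> m) (\<zeta> l) \<partial>codebook n N \<partial>codebook n M)
       = (\<integral>\<^sup>+\<xi>. \<integral>\<^sup>+v. miss_prob n G K \<gamma> (\<xi> m) v \<partial>noise_block n \<partial>codebook n M)"
    proof (rule nn_integral_cong)
      fix \<xi> :: "nat \<Rightarrow> nat \<Rightarrow> real^'t" assume "\<xi> \<in> space (codebook n M)"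
      then have "\<xi> m \<in> space (\<Pi>\<^sub>M j\<in>{..<n}. borel)" using measurable_space[OF measurable_codebook_component[OF that(1)]] by blast
      then have "(\<lambda>v. miss_prob n G K \<gamma> (\<xi> m) v) \<in> borel_measurable (noise_block n)"
        by (intro borel_measurable_miss_prob measurable_const measurable_ident_sets[OF sets_noise_block])
      from nn_integral_PiM_component[OF prob_space_noise_block _ this, of l "{..<N}"]
      show "(\<integral>\<^sup>+\<zeta>. miss_prob n G K \<gamma> (\<xi> m) (\<zeta> l) \<partial>codebook n N) = (\<integral>\<^sup>+v. miss_prob n G K \<gamma> (\<xi> m) v \<partial>noise_block n)"
        using that(2) by (simp add: codebook_def)
    qed
    also have "\<dots> = (\<integral>\<^sup>+u. \<integral>\<^sup>+v. miss_prob n G K \<gamma> u v \<partial>noise_block n \<partial>noise_block n)"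
    proof -
      interpret prob_space "noise_block n :: (nat \<Rightarrow> real^'s) measure" by (rule prob_space_noise_block)
      have "(\<lambda>u. \<integral>\<^sup>+v. miss_prob n G K \<gamma> u v \<partial>noise_block n) \<in> borel_measurable (noise_block n)" by measurable
      from nn_integral_PiM_component[OF prob_space_noise_block _ this, of m "{..<M}"] show ?thesis
        using that(1) by (simp add: codebook_def)
    qed
    also have "\<dots> \<le> ennreal ?V" unfolding \<gamma>_def I_def by (rule nn_integral_miss_prob_le[OF n \<delta>])
    finally show ?thesis .
  qed
  have alarm: "(\<integral>\<^sup>+\<xi>. \<integral>\<^sup>+\<zeta>. alarm_prob n G K \<gamma> (\<xi> m') (\<xi> m) (\<zeta> l) \<partial>codebook n N \<partial>codebook n M) \<le> ennreal e"
    if m: "m < M" and l: "l < N" and m': "m' < M" "m' \<noteq> m" for m m' l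
  proof -
    interpret nb: prob_space "noise_block n :: (nat \<Rightarrow> real^'t) measure" by (rule prob_space_noise_block)
    interpret product_sigma_finite "\<lambda>_::nat. noise_block n :: (nat \<Rightarrow> real^'t) measure" ..
    \<comment> \<open>The competing codeword \<open>m'\<close> is split off and integrated while the
      rest of the codebook is fixed. The sent codeword \<open>m\<close> lies in that rest and is
      therefore independent of it.\<close>
    define J where "J = {..<M} - {m'}"
    have J: "finite J" "m' \<notin> J" "insert m' J = {..<M}" "m \<in> J" using m m' by (auto simp: J_def)
    interpret CJ: prob_space "PiM J (\<lambda>_. noise_block n) :: (nat \<Rightarrow> nat \<Rightarrow> real^'t) measure" by (intro prob_space_PiM prob_space_noise_block)
    have "(\<integral>\<^sup>+\<xi>. \<integral>\<^sup>+\<zeta>. alarm_prob n G K \<gamma> (\<xi> m') (\<xi> m) (\<zeta> l) \<partial>codebook n N \<partial>codebook n M)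
      = (\<integral>\<^sup>+\<zeta>. \<integral>\<^sup>+\<xi>. alarm_prob n G K \<gamma> (\<xi> m') (\<xi> m) (\<zeta> l) \<partial>codebook n M \<partial>codebook n N)"
      using aj[OF m'(1) m l] by (intro p.Fubini'[symmetric]) (simp add: case_prod_unfold)
    also have "\<dots> \<le> (\<integral>\<^sup>+\<zeta>. ennreal e \<partial>(codebook n N :: (nat \<Rightarrow> nat \<Rightarrow> real^'s) measure))"
    proof (rule nn_integral_mono)
      fix \<zeta> :: "nat \<Rightarrow> nat \<Rightarrow> real^'s" assume z: "\<zeta> \<in> space (codebook n N)"
      then have zl: "\<zeta> l \<in> space (noise_block n)" using l by (auto simp: codebook_def space_PiM)
      then have "\<zeta> l \<in> space (\<Pi>\<^sub>M j\<in>{..<n}. borel)" by (simp add: sets_eq_imp_space_eq[OF sets_noise_block])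
      then have am: "(\<lambda>\<xi>. alarm_prob n G K \<gamma> (\<xi> m') (\<xi> m) (\<zeta> l)) \<in> borel_measurable (codebook n M)"
        by (intro borel_measurable_alarm_prob measurable_codebook_component measurable_const m m')
      have "(\<integral>\<^sup>+\<xi>. alarm_prob n G K \<gamma> (\<xi> m') (\<xi> m) (\<zeta> l) \<partial>codebook n M)
        = (\<integral>\<^sup>+\<xi>. \<integral>\<^sup>+u'. alarm_prob n G K \<gamma> ((\<xi>(m' := u')) m') ((\<xi>(m' := u')) m) (\<zeta> l) \<partial>noise_block n \<partial>PiM J (\<lambda>_. noise_block n))"
        using product_nn_integral_insert[OF J(1,2), of "\<lambda>\<xi>. alarm_prob n G K \<gamma> (\<xi> m') (\<xi> m) (\<zeta> l)"] am
        unfolding J(3) codebook_def .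
      also have "\<dots> \<le> (\<integral>\<^sup>+\<xi>. ennreal e \<partial>(PiM J (\<lambda>_. noise_block n) :: (nat \<Rightarrow> nat \<Rightarrow> real^'t) measure))"
      proof (rule nn_integral_mono)
        fix \<xi> :: "nat \<Rightarrow> nat \<Rightarrow> real^'t" assume "\<xi> \<in> space (PiM J (\<lambda>_. noise_block n))"
        then have "\<xi> m \<in> space (noise_block n)" using J(4) by (auto simp: space_PiM)
        then show "(\<integral>\<^sup>+u'. alarm_prob n G K \<gamma> ((\<xi>(m' := u')) m') ((\<xi>(m' := u')) m) (\<zeta> l) \<partial>noise_block n) \<le> ennreal e"
          unfolding e_def using m' nn_integral_alarm_prob_le[OF _ zl] by simp
      qed
      also have "\<dots> = ennreal e" by (simp add: CJ.emeasure_space_1)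
      finally show "(\<integral>\<^sup>+\<xi>. alarm_prob n G K \<gamma> (\<xi> m') (\<xi> m) (\<zeta> l) \<partial>codebook n M) \<le> ennreal e" .
    qed
    also have "\<dots> = ennreal e" by (simp add: CN.emeasure_space_1)
    finally show ?thesis .
  qed
  have e0: "0 \<le> e" by (simp add: e_def)
  have each: "(\<integral>\<^sup>+\<xi>. \<integral>\<^sup>+\<zeta>. miss_prob n G K \<gamma> (\<xi> m) (\<zeta> l) + (\<Sum>m'\<in>{..<M} - {m}. alarm_prob n G K \<gamma> (\<xi> m') (\<xi> m) (\<zeta> l)) \<partial>codebook n N \<partial>codebook n M)
      \<le> ennreal (?V + (real M - 1) * e)" (is "?A m l \<le> _") if m: "m < M" and l: "l < N" for m l
  proof -
    have mm1: "(\<lambda>\<zeta>. miss_prob n G K \<gamma> (\<xi> m) (\<zeta> l)) \<in> borel_measurable (codebook n N)" if "\<xi> \<in> space (codebook n M)" for \<xi>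
    proof -
      have "\<xi> m \<in> space (\<Pi>\<^sub>M j\<in>{..<n}. borel)" using measurable_space[OF measurable_codebook_component[OF m] that] .
      then show ?thesis by (intro borel_measurable_miss_prob measurable_codebook_component measurable_const l)
    qed
    have mm2: "(\<lambda>\<zeta>. alarm_prob n G K \<gamma> (\<xi> m') (\<xi> m) (\<zeta> l)) \<in> borel_measurable (codebook n N)" if "\<xi> \<in> space (codebook n M)" "m' < M" for \<xi> m'
    proof -
      have "\<xi> m \<in> space (\<Pi>\<^sub>M j\<in>{..<n}. borel)" "\<xi> m' \<in> space (\<Pi>\<^sub>M j\<in>{..<n}. borel)"
        using measurable_space[OF measurable_codebook_component[OF m] that(1)] measurable_space[OF measurable_codebook_component[OF that(2)] that(1)] by auto
      then show ?thesis by (intro borel_measurable_alarm_prob measurable_codebook_component measurable_const l)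
    qed
    have "?A m l = (\<integral>\<^sup>+\<xi>. (\<integral>\<^sup>+\<zeta>. miss_prob n G K \<gamma> (\<xi> m) (\<zeta> l) \<partial>codebook n N) + (\<Sum>m'\<in>{..<M} - {m}. \<integral>\<^sup>+\<zeta>. alarm_prob n G K \<gamma> (\<xi> m') (\<xi> m) (\<zeta> l) \<partial>codebook n N) \<partial>codebook n M)"
    proof (rule nn_integral_cong)
      fix \<xi> :: "nat \<Rightarrow> nat \<Rightarrow> real^'t" assume sp: "\<xi> \<in> space (codebook n M)"
      have 1: "(\<integral>\<^sup>+\<zeta>. (\<Sum>m'\<in>{..<M} - {m}. alarm_prob n G K \<gamma> (\<xi> m') (\<xi> m) (\<zeta> l)) \<partial>codebook n N)
        = (\<Sum>m'\<in>{..<M} - {m}. \<integral>\<^sup>+\<zeta>. alarm_prob n G K \<gamma> (\<xi> m') (\<xi> m) (\<zeta> l) \<partial>codebook n N)"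
        by (rule nn_integral_sum) (rule mm2[OF sp], simp)
      show "(\<integral>\<^sup>+\<zeta>. miss_prob n G K \<gamma> (\<xi> m) (\<zeta> l) + (\<Sum>m'\<in>{..<M} - {m}. alarm_prob n G K \<gamma> (\<xi> m') (\<xi> m) (\<zeta> l)) \<partial>codebook n N)
        = (\<integral>\<^sup>+\<zeta>. miss_prob n G K \<gamma> (\<xi> m) (\<zeta> l) \<partial>codebook n N) + (\<Sum>m'\<in>{..<M} - {m}. \<integral>\<^sup>+\<zeta>. alarm_prob n G K \<gamma> (\<xi> m') (\<xi> m) (\<zeta> l) \<partial>codebook n N)"
        unfolding 1[symmetric] by (intro nn_integral_add borel_measurable_sum mm1 mm2 sp) simp
    qed
    also have "\<dots> = (\<integral>\<^sup>+\<xi>. \<integral>\<^sup>+\<zeta>. miss_prob n G K \<gamma> (\<xi> m) (\<zeta> l) \<partial>codebook n N \<partial>codebook n M)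
       + (\<Sum>m'\<in>{..<M} - {m}. \<integral>\<^sup>+\<xi>. \<integral>\<^sup>+\<zeta>. alarm_prob n G K \<gamma> (\<xi> m') (\<xi> m) (\<zeta> l) \<partial>codebook n N \<partial>codebook n M)"
    proof -
      have 1: "(\<integral>\<^sup>+\<xi>. (\<Sum>m'\<in>{..<M} - {m}. \<integral>\<^sup>+\<zeta>. alarm_prob n G K \<gamma> (\<xi> m') (\<xi> m) (\<zeta> l) \<partial>codebook n N) \<partial>codebook n M)
        = (\<Sum>m'\<in>{..<M} - {m}. \<integral>\<^sup>+\<xi>. \<integral>\<^sup>+\<zeta>. alarm_prob n G K \<gamma> (\<xi> m') (\<xi> m) (\<zeta> l) \<partial>codebook n N \<partial>codebook n M)"
        by (rule nn_integral_sum) (rule ai, use m l in auto)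
      show ?thesis
        unfolding 1[symmetric] by (intro nn_integral_add borel_measurable_sum mi ai m l) simp
    qed
    also have "\<dots> \<le> ennreal ?V + (\<Sum>m'\<in>{..<M} - {m}. ennreal e)"
      using m l by (intro add_mono sum_mono miss alarm) auto
    also have "\<dots> = ennreal (?V + (real M - 1) * e)"
      using m V e0 by (simp add: card_Diff_singleton of_nat_diff ennreal_of_nat_eq_real_of_nat flip: ennreal_mult ennreal_plus)
    finally show ?thesis .
  qed
  have "?L = ennreal (1 / (real M * real N)) * (\<Sum>m<M. \<Sum>l<N. ?A m l)"
  proof -
    have mm: "(\<lambda>x. miss_prob n G K \<gamma> (fst x m) (snd x l) + (\<Sum>m'\<in>{..<M} - {m}. alarm_prob n G K \<gamma> (fst x m') (fst x m) (snd x l)))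
       \<in> borel_measurable (codebook n M \<Otimes>\<^sub>M codebook n N)" if "m < M" "l < N" for m l
      using that by (intro borel_measurable_add borel_measurable_sum mj aj) auto
    \<comment> \<open>Sums and constants are taken out under the product measure, where
      measurability is needed only jointly in the two codebooks.\<close>
    have F: "(\<integral>\<^sup>+\<xi>. \<integral>\<^sup>+\<zeta>. f \<xi> \<zeta> \<partial>codebook n N \<partial>codebook n M) = (\<integral>\<^sup>+x. f (fst x) (snd x) \<partial>(codebook n M \<Otimes>\<^sub>M codebook n N))"
      if "(\<lambda>x. f (fst x) (snd x)) \<in> borel_measurable (codebook n M \<Otimes>\<^sub>M codebook n N)"
      for f :: "(nat \<Rightarrow> nat \<Rightarrow> real^'t) \<Rightarrow> (nat \<Rightarrow> nat \<Rightarrow> real^'s) \<Rightarrow> ennreal"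
      using CN.nn_integral_fst[OF that] by simp
    have S: "?A m l = (\<integral>\<^sup>+x. miss_prob n G K \<gamma> (fst x m) (snd x l) + (\<Sum>m'\<in>{..<M} - {m}. alarm_prob n G K \<gamma> (fst x m') (fst x m) (snd x l)) \<partial>(codebook n M \<Otimes>\<^sub>M codebook n N))"
      if "m < M" "l < N" for m l using mm[OF that] by (rule F)
    have "?L = (\<integral>\<^sup>+x. ennreal (1 / (real M * real N)) * (\<Sum>m<M. \<Sum>l<N. miss_prob n G K \<gamma> (fst x m) (snd x l)
        + (\<Sum>m'\<in>{..<M} - {m}. alarm_prob n G K \<gamma> (fst x m') (fst x m) (snd x l))) \<partial>(codebook n M \<Otimes>\<^sub>M codebook n N))"
      unfolding \<gamma>_def[symmetric] using mm by (intro F borel_measurable_times_ennreal borel_measurable_sum) auto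
    also have "\<dots> = ennreal (1 / (real M * real N)) * (\<integral>\<^sup>+x. (\<Sum>m<M. \<Sum>l<N. miss_prob n G K \<gamma> (fst x m) (snd x l)
        + (\<Sum>m'\<in>{..<M} - {m}. alarm_prob n G K \<gamma> (fst x m') (fst x m) (snd x l))) \<partial>(codebook n M \<Otimes>\<^sub>M codebook n N))"
      using mm by (intro nn_integral_cmult borel_measurable_sum) auto
    also have "(\<integral>\<^sup>+x. (\<Sum>m<M. \<Sum>l<N. miss_prob n G K \<gamma> (fst x m) (snd x l)
        + (\<Sum>m'\<in>{..<M} - {m}. alarm_prob n G K \<gamma> (fst x m') (fst x m) (snd x l))) \<partial>(codebook n M \<Otimes>\<^sub>M codebook n N))
      = (\<Sum>m<M. \<Sum>l<N. ?A m l)"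
    proof (subst nn_integral_sum)
      show "(\<Sum>m<M. \<integral>\<^sup>+x. (\<Sum>l<N. miss_prob n G K \<gamma> (fst x m) (snd x l)
        + (\<Sum>m'\<in>{..<M} - {m}. alarm_prob n G K \<gamma> (fst x m') (fst x m) (snd x l))) \<partial>(codebook n M \<Otimes>\<^sub>M codebook n N)) = (\<Sum>m<M. \<Sum>l<N. ?A m l)"
        using mm by (intro sum.cong refl, subst nn_integral_sum) (auto simp: S intro!: sum.cong)
    qed (use mm in \<open>auto intro!: borel_measurable_sum\<close>)
    finally show ?thesis .
  qed
  also have "\<dots> \<le> ennreal (1 / (real M * real N)) * (\<Sum>m<M. \<Sum>l<N. ennreal (?V + (real M - 1) * e))"
    by (intro mult_left_mono sum_mono each) auto
  also have "\<dots> = ennreal (?V + (real M - 1) * e)"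
  proof -
    define c where "c = ?V + (real M - 1) * e"
    have "0 \<le> c" unfolding c_def using M V e0 by (intro add_nonneg_nonneg mult_nonneg_nonneg) auto
    then show ?thesis unfolding c_def[symmetric]
      using M N by (simp add: ennreal_of_nat_eq_real_of_nat flip: ennreal_mult)
  qed
  finally show ?thesis by (simp add: e_def \<gamma>_def)
qed


section \<open>Codebooks that meet the power constraints\<close>

lemma power_constraint_prob_ge:
  fixes L :: "real^'t^'t"
  assumes n: "0 < n" and M: "0 < M" and \<delta>: "0 < \<delta>" "\<delta> < 1" and P: "0 \<le> P" and tr: "trace (L ** transpose L) \<le> (1 - \<delta>) * P"
  shows "{\<xi> \<in> space (codebook n M). power_constraint n M P (\<lambda>m j. L *v \<xi> m j)} \<in> sets (codebook n M)"
    and "ennreal \<delta> \<le> emeasure (codebook n M) {\<xi> \<in> space (codebook n M). power_constraint n M P (\<lambda>m j. L *v \<xi> m j)}"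
proof -
  interpret C: prob_space "codebook n M :: (nat \<Rightarrow> nat \<Rightarrow> real^'t) measure" by (rule prob_space_codebook)
  define f where "f \<xi> = (\<Sum>j<n. \<Sum>m<M. (norm (L *v \<xi> m j))\<^sup>2) / (real n * real M)" for \<xi> :: "nat \<Rightarrow> nat \<Rightarrow> real^'t"
  have pc: "power_constraint n M P (\<lambda>m j. L *v \<xi> m j) \<longleftrightarrow> f \<xi> \<le> P" for \<xi>
    unfolding power_constraint_eq[OF M] f_def ..
  have cm: "(\<lambda>\<xi>. \<xi> m j) \<in> borel_measurable (codebook n M)" if "m < M" "j < n" for m j
    by (rule measurable_compose[OF measurable_codebook_component[OF that(1)]]) (use that in simp)
  have lm: "(\<lambda>u. (norm (L *v u))\<^sup>2) \<in> borel_measurable borel" by measurable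
  have cm2: "(\<lambda>\<xi>. (norm (L *v \<xi> m j))\<^sup>2) \<in> borel_measurable (codebook n M)" if "m < M" "j < n" for m j
    by (rule measurable_compose[OF cm[OF that] lm])
  have [measurable]: "f \<in> borel_measurable (codebook n M)"
    unfolding f_def[abs_def] by (intro borel_measurable_divide borel_measurable_sum cm2) auto
  show G: "{\<xi> \<in> space (codebook n M). power_constraint n M P (\<lambda>m j. L *v \<xi> m j)} \<in> sets (codebook n M)"
    unfolding pc by measurable
  have f0: "0 \<le> f \<xi>" for \<xi> unfolding f_def by (intro divide_nonneg_nonneg sum_nonneg) auto
  have comp: "(\<integral>\<^sup>+\<xi>. ennreal ((norm (L *v \<xi> m j))\<^sup>2) \<partial>codebook n M) = ennreal (trace (L ** transpose L))" if "m < M" "j < n" for m j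
  proof -
    have "(\<integral>\<^sup>+\<xi>. ennreal ((norm (L *v \<xi> m j))\<^sup>2) \<partial>codebook n M) = (\<integral>\<^sup>+u. ennreal ((norm (L *v u j))\<^sup>2) \<partial>noise_block n)"
    proof -
      have "(\<lambda>u. u j) \<in> borel_measurable (noise_block n :: (nat \<Rightarrow> real^'t) measure)"
        unfolding measurable_cong_sets[OF sets_noise_block refl] using that by simp
      then have "(\<lambda>u. ennreal ((norm (L *v u j))\<^sup>2)) \<in> borel_measurable (noise_block n)" by measurable
      from nn_integral_PiM_component[OF prob_space_noise_block _ this, of m "{..<M}"] show ?thesis
        using that(1) by (simp add: codebook_def)
    qed
    also have "\<dots> = (\<integral>\<^sup>+u. ennreal ((norm (L *v u))\<^sup>2) \<partial>std_gaussian_vec)"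
      using that(2) nn_integral_PiM_component[OF prob_space_std_gaussian_vec, of j "{..<n}" "\<lambda>u. ennreal ((norm (L *v u))\<^sup>2)"] lm
      by (simp add: noise_block_def measurable_cong_sets[OF sets_std_gaussian_vec refl])
    also have "\<dots> = ennreal (trace (L ** transpose L))"
    proof (subst nn_integral_eq_integral)
      show "integrable std_gaussian_vec (\<lambda>u. (norm (L *v u))\<^sup>2)"
        using integrable_std_gaussian_vec_quadratic[of L 0 "mat 1"] by (simp add: power2_norm_eq_inner)
      show "ennreal (\<integral>u. (norm (L *v u))\<^sup>2 \<partial>std_gaussian_vec) = ennreal (trace (L ** transpose L))"
        using integral_std_gaussian_vec_quadratic[of L 0 "mat 1"] by (simp add: power2_norm_eq_inner)
    qed simp
    finally show ?thesis .
  qed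
  have tr0: "0 \<le> trace (L ** transpose L)"
    unfolding trace_def by (intro sum_nonneg) (simp add: psd_diag_nonneg psd_mult_transpose)
  have "(\<integral>\<^sup>+\<xi>. ennreal (f \<xi>) \<partial>codebook n M) = (\<integral>\<^sup>+\<xi>. ennreal (1 / (real n * real M)) * (\<Sum>j<n. \<Sum>m<M. ennreal ((norm (L *v \<xi> m j))\<^sup>2)) \<partial>codebook n M)"
    by (intro nn_integral_cong) (simp add: f_def sum_ennreal sum_nonneg flip: ennreal_mult)
  also have "\<dots> = ennreal (1 / (real n * real M)) * (\<integral>\<^sup>+\<xi>. (\<Sum>j<n. \<Sum>m<M. ennreal ((norm (L *v \<xi> m j))\<^sup>2)) \<partial>codebook n M)"
    by (intro nn_integral_cmult borel_measurable_sum measurable_compose[OF cm2 measurable_ennreal]) auto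
  also have "(\<integral>\<^sup>+\<xi>. (\<Sum>j<n. \<Sum>m<M. ennreal ((norm (L *v \<xi> m j))\<^sup>2)) \<partial>codebook n M)
     = (\<Sum>j<n. \<integral>\<^sup>+\<xi>. (\<Sum>m<M. ennreal ((norm (L *v \<xi> m j))\<^sup>2)) \<partial>codebook n M)"
    by (intro nn_integral_sum borel_measurable_sum measurable_compose[OF cm2 measurable_ennreal]) auto
  also have "\<dots> = (\<Sum>j<n. \<Sum>m<M. \<integral>\<^sup>+\<xi>. ennreal ((norm (L *v \<xi> m j))\<^sup>2) \<partial>codebook n M)"
    by (intro sum.cong refl nn_integral_sum measurable_compose[OF cm2 measurable_ennreal]) auto
  also have "ennreal (1 / (real n * real M)) * \<dots> = ennreal (trace (L ** transpose L))"
    using n M tr0 by (simp add: comp ennreal_of_nat_eq_real_of_nat flip: ennreal_mult)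
  \<comment> \<open>The mean power of a random codebook is the trace of its covariance, at most
    \<open>(1 - \<delta>) * P\<close>; this is the slack that Markov's inequality uses.\<close>
  finally have Ef: "(\<integral>\<^sup>+\<xi>. ennreal (f \<xi>) \<partial>codebook n M) = ennreal (trace (L ** transpose L))" .
  show "ennreal \<delta> \<le> emeasure (codebook n M) {\<xi> \<in> space (codebook n M). power_constraint n M P (\<lambda>m j. L *v \<xi> m j)}"
  proof (cases "P = 0")
    \<comment> \<open>Markov's inequality divides by \<open>P\<close>. For \<open>P = 0\<close> the
      trace is zero, so the power vanishes almost surely.\<close>
    case True
    then have "trace (L ** transpose L) = 0" using tr tr0 by simp
    then have "(\<integral>\<^sup>+\<xi>. ennreal (f \<xi>) \<partial>codebook n M) = 0" using Ef by simp
    then have "AE \<xi> in codebook n M. ennreal (f \<xi>) = 0"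
      by (subst (asm) nn_integral_0_iff_AE) auto
    then have "AE \<xi> in codebook n M. \<xi> \<in> {\<xi> \<in> space (codebook n M). power_constraint n M P (\<lambda>m j. L *v \<xi> m j)}"
      using f0 True unfolding pc by auto
    then have "emeasure (codebook n M) {\<xi> \<in> space (codebook n M). power_constraint n M P (\<lambda>m j. L *v \<xi> m j)} = 1"
      using C.emeasure_eq_1_AE[OF G] by simp
    then show ?thesis using \<delta> by simp
  next
    case False
    with P have P0: "0 < P" by simp
    define Bd where "Bd = {\<xi> \<in> space (codebook n M). P \<le> f \<xi>}"
    have Bd[measurable]: "Bd \<in> sets (codebook n M)" unfolding Bd_def by measurable
    have "ennreal P * emeasure (codebook n M) Bd = (\<integral>\<^sup>+\<xi>. ennreal P * indicator Bd \<xi> \<partial>codebook n M)"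
      by (simp add: nn_integral_cmult)
    also have "\<dots> \<le> (\<integral>\<^sup>+\<xi>. ennreal (f \<xi>) \<partial>codebook n M)"
      by (intro nn_integral_mono) (auto simp: Bd_def indicator_def intro!: ennreal_leI)
    also have "\<dots> \<le> ennreal ((1 - \<delta>) * P)" unfolding Ef using tr by (rule ennreal_leI)
    finally have "P * C.prob Bd \<le> (1 - \<delta>) * P"
      using P0 \<delta> by (simp add: C.emeasure_eq_measure flip: ennreal_mult)
    then have "C.prob Bd \<le> 1 - \<delta>" using P0 by (simp add: mult.commute)
    moreover have "C.prob (space (codebook n M) - Bd) = 1 - C.prob Bd" by (rule C.prob_compl) simp
    moreover have "C.prob (space (codebook n M) - Bd) \<le> C.prob {\<xi> \<in> space (codebook n M). power_constraint n M P (\<lambda>m j. L *v \<xi> m j)}"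
      by (rule C.finite_measure_mono[OF _ G]) (auto simp: Bd_def pc)
    ultimately show ?thesis using \<delta> by (simp add: C.emeasure_eq_measure)
  qed
qed

text \<open>
  Markov's inequality bounds the probability of each power constraint only by \<open>\<delta>\<close> from below;
  independence of the two codebooks then gives \<open>\<delta>\<^sup>2\<close> for both.
\<close>

lemma exists_good_pair:
  assumes A: "prob_space A" and B: "prob_space B" and G: "GA \<in> sets A" "GB \<in> sets B"
    and d: "ennreal \<delta> \<le> emeasure A GA" "ennreal \<delta> \<le> emeasure B GB" "0 < \<delta>"
    and U: "(\<integral>\<^sup>+a. \<integral>\<^sup>+b. U a b \<partial>B \<partial>A) \<le> ennreal e" and e: "0 \<le> e" and c: "e < c * \<delta>\<^sup>2"
  shows "\<exists>a\<in>GA. \<exists>b\<in>GB. U a b \<le> ennreal c"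
proof (rule ccontr)
  assume "\<not> ?thesis"
  \<comment> \<open>Otherwise \<open>U\<close> is at least \<open>c\<close> on a product set of
    measure at least \<open>\<delta>\<^sup>2\<close>, and its integral exceeds
    \<open>e\<close>.\<close>
  then have U': "ennreal c \<le> U a b" if "a \<in> GA" "b \<in> GB" for a b using that by (meson linear)
  have c0: "0 < c" using e c d(3) by (metis less_le_trans mult_nonpos_nonneg not_le order_le_less_trans zero_le_power2)
  have "ennreal (c * \<delta>\<^sup>2) = ennreal c * (ennreal \<delta> * ennreal \<delta>)"
    using c0 d(3) by (simp add: power2_eq_square flip: ennreal_mult)
  also have "\<dots> \<le> ennreal c * (emeasure B GB * emeasure A GA)"
    by (intro mult_left_mono mult_mono d) auto
  also have "\<dots> = (\<integral>\<^sup>+a. (ennreal c * emeasure B GB) * indicator GA a \<partial>A)"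
    using G by (simp add: nn_integral_cmult mult.assoc)
  also have "\<dots> = (\<integral>\<^sup>+a. (\<integral>\<^sup>+b. ennreal c * indicator GB b \<partial>B) * indicator GA a \<partial>A)"
    using G by (simp add: nn_integral_cmult)
  also have "\<dots> \<le> (\<integral>\<^sup>+a. \<integral>\<^sup>+b. U a b \<partial>B \<partial>A)"
  proof (intro nn_integral_mono)
    fix a
    show "(\<integral>\<^sup>+b. ennreal c * indicator GB b \<partial>B) * indicator GA a \<le> (\<integral>\<^sup>+b. U a b \<partial>B)"
      by (cases "a \<in> GA") (auto intro!: nn_integral_mono simp: indicator_def U')
  qed
  also have "\<dots> \<le> ennreal e" by (rule U)
  finally show False using c e by (simp add: ennreal_le_iff)
qed

lemma num_messages_le: "real (num_messages n R) - 1 \<le> exp (real n * R)"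
  unfolding num_messages_def using ceiling_correct[of "exp (real n * R)"] by simp

text \<open>The threshold \<open>I - \<eta>\<close> lies above the rate
  \<open>I - 2 * \<eta>\<close>, and the gap gives the decay. If the rate is clipped at zero there
  is a single message, so \<open>M - 1 = 0\<close> and there are no competitors.\<close>

lemma num_messages_mult_exp_le:
  assumes "0 \<le> \<eta>"
  shows "(real (num_messages n (max 0 (I - 2 * \<eta>))) - 1) * exp (- (real n * (I - \<eta>))) \<le> exp (- (real n * \<eta>))"
proof (cases "I - 2 * \<eta> \<le> 0")
  case True
  then show ?thesis by (simp add: num_messages_def max_def)
next
  case False
  have "(real (num_messages n (I - 2 * \<eta>)) - 1) * exp (- (real n * (I - \<eta>))) \<le> exp (real n * (I - 2 * \<eta>)) * exp (- (real n * (I - \<eta>)))"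
    by (intro mult_right_mono num_messages_le) simp
  also have "\<dots> = exp (- (real n * \<eta>))" by (simp add: algebra_simps flip: exp_add)
  finally show ?thesis using False by (simp add: max_def)
qed

lemma error_prob_linear_encoder:
  "error_prob n M N G K (\<lambda>m j. L *v \<xi> m j) (\<lambda>l j. L' *v \<zeta> l j) dec = error_prob n M N (G ** L) (K ** L') \<xi> \<zeta> dec"
  by (simp add: error_prob_def received_def matrix_vector_mul_assoc)

lemma tin_rate_factor:
  "tin_rate (G ** L) (K ** L') (mat 1) (mat 1) = tin_rate G K (L ** transpose L) (L' ** transpose L')"
  by (simp add: tin_rate_def matrix_transpose_mul matrix_mul_assoc)

lemma error_prob_nonneg: "0 \<le> error_prob n M N G K enc enc' dec"
  by (simp add: error_prob_def Let_def)

text \<open>One pair of codebooks has to serve both receivers, so the two error bounds are added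
  before a pair is selected. \<open>V\<close> collects the variances of the information densities
  and is the same for all \<open>n\<close>.\<close>

lemma random_coding:
  fixes H1 :: "real^'a^'r" and H2 :: "real^'b^'r" and H3 :: "real^'a^'q" and H4 :: "real^'b^'q"
  assumes S: "psd S1" "psd S2" and \<delta>: "0 < \<delta>" "\<delta> < 1" and P: "0 \<le> P1" "0 \<le> P2"
    and tr: "trace S1 \<le> (1 - \<delta>) * P1" "trace S2 \<le> (1 - \<delta>) * P2" and \<eta>: "0 < \<eta>"
  defines "R1 \<equiv> max 0 (tin_rate H1 H2 S1 S2 - 2 * \<eta>)" and "R2 \<equiv> max 0 (tin_rate H4 H3 S2 S1 - 2 * \<eta>)"
  shows "\<exists>V. \<forall>n>0. \<exists>x w d1 d2. power_constraint n (num_messages n R1) P1 x \<and> power_constraint n (num_messages n R2) P2 w \<and>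
      decoder n (num_messages n R1) d1 \<and> decoder n (num_messages n R2) d2 \<and>
      error_prob n (num_messages n R1) (num_messages n R2) H1 H2 x w d1 \<le> (V / real n + 2 * exp (- (real n * \<eta>))) / \<delta>\<^sup>2 \<and>
      error_prob n (num_messages n R2) (num_messages n R1) H4 H3 w x d2 \<le> (V / real n + 2 * exp (- (real n * \<eta>))) / \<delta>\<^sup>2"
proof -
  obtain L1 :: "real^'a^'a" where L1: "S1 = L1 ** transpose L1" using psd_factor[OF S(1)] .
  obtain L2 :: "real^'b^'b" where L2: "S2 = L2 ** transpose L2" using psd_factor[OF S(2)] .
  define I1 where "I1 = tin_rate (H1 ** L1) (H2 ** L2) (mat 1) (mat 1)"
  define I2 where "I2 = tin_rate (H4 ** L2) (H3 ** L1) (mat 1) (mat 1)"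
  have R: "R1 = max 0 (I1 - 2 * \<eta>)" "R2 = max 0 (I2 - 2 * \<eta>)"
    unfolding R1_def R2_def I1_def I2_def L1 L2 tin_rate_factor by simp_all
  define V1 where "V1 = (\<integral>x. (info_density (H1 ** L1) (H2 ** L2) x - I1)\<^sup>2 \<partial>triple_gauss) / \<eta>\<^sup>2"
  define V2 where "V2 = (\<integral>x. (info_density (H4 ** L2) (H3 ** L1) x - I2)\<^sup>2 \<partial>triple_gauss) / \<eta>\<^sup>2"
  have V0: "0 \<le> V1" "0 \<le> V2" unfolding V1_def V2_def by (intro divide_nonneg_nonneg integral_nonneg_AE; simp)+
  show ?thesis
  \<comment> \<open>The summand 1 makes the mean strictly smaller than
    \<open>c * \<delta>\<^sup>2\<close>, as \<open>exists_good_pair\<close> requires.\<close>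
  proof (intro exI[of _ "V1 + V2 + 1"] allI impI)
    fix n :: nat assume n: "0 < n"
    define M N where "M = num_messages n R1" and "N = num_messages n R2"
    have M: "0 < M" and N: "0 < N" unfolding M_def N_def by (rule num_messages_pos)+
    interpret CM: prob_space "codebook n M :: (nat \<Rightarrow> nat \<Rightarrow> real^'a) measure" by (rule prob_space_codebook)
    interpret CN: prob_space "codebook n N :: (nat \<Rightarrow> nat \<Rightarrow> real^'b) measure" by (rule prob_space_codebook)
    interpret p: pair_prob_space "codebook n N :: (nat \<Rightarrow> nat \<Rightarrow> real^'b) measure" "codebook n M :: (nat \<Rightarrow> nat \<Rightarrow> real^'a) measure" ..
    define U1 where "U1 \<xi> \<zeta> = ennreal (1 / (real M * real N)) * (\<Sum>m<M. \<Sum>l<N. miss_prob n (H1 ** L1) (H2 ** L2) (I1 - \<eta>) (\<xi> m) (\<zeta> l)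
        + (\<Sum>m'\<in>{..<M} - {m}. alarm_prob n (H1 ** L1) (H2 ** L2) (I1 - \<eta>) (\<xi> m') (\<xi> m) (\<zeta> l)))" for \<xi> \<zeta>
    define U2 where "U2 \<zeta> \<xi> = ennreal (1 / (real N * real M)) * (\<Sum>m<N. \<Sum>l<M. miss_prob n (H4 ** L2) (H3 ** L1) (I2 - \<eta>) (\<zeta> m) (\<xi> l)
        + (\<Sum>m'\<in>{..<N} - {m}. alarm_prob n (H4 ** L2) (H3 ** L1) (I2 - \<eta>) (\<zeta> m') (\<zeta> m) (\<xi> l)))" for \<xi> \<zeta>
    note cc = measurable_compose[OF measurable_fst measurable_codebook_component] measurable_compose[OF measurable_snd measurable_codebook_component]
    have U1m: "(\<lambda>x. U1 (snd x) (fst x)) \<in> borel_measurable (codebook n N \<Otimes>\<^sub>M codebook n M)"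
      unfolding U1_def
      by (intro borel_measurable_times_ennreal borel_measurable_const borel_measurable_sum borel_measurable_add borel_measurable_miss_prob borel_measurable_alarm_prob cc) auto
    have U2m: "(\<lambda>x. U2 (fst x) (snd x)) \<in> borel_measurable (codebook n N \<Otimes>\<^sub>M codebook n M)"
      unfolding U2_def
      by (intro borel_measurable_times_ennreal borel_measurable_const borel_measurable_sum borel_measurable_add borel_measurable_miss_prob borel_measurable_alarm_prob cc) auto
    define E where "E = exp (- (real n * \<eta>))"
    have E1: "(\<integral>\<^sup>+\<xi>. \<integral>\<^sup>+\<zeta>. U1 \<xi> \<zeta> \<partial>codebook n N \<partial>codebook n M) \<le> ennreal (V1 / real n + E)"
    proof -
      have "(\<integral>\<^sup>+\<xi>. \<integral>\<^sup>+\<zeta>. U1 \<xi> \<zeta> \<partial>codebook n N \<partial>codebook n M) \<le> ennreal ((\<integral>x. (info_density (H1 ** L1) (H2 ** L2) x - I1)\<^sup>2 \<partial>triple_gauss) / (real n * \<eta>\<^sup>2) + (real M - 1) * exp (- (real n * (I1 - \<eta>))))"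
        unfolding U1_def I1_def by (rule expected_error_le[OF n M N \<eta>])
      also have "\<dots> \<le> ennreal (V1 / real n + E)"
        unfolding V1_def E_def M_def R using num_messages_mult_exp_le[of \<eta> n I1] \<eta>
        by (intro ennreal_leI add_mono) (simp_all add: field_simps)
      finally show ?thesis .
    qed
    have E2: "(\<integral>\<^sup>+\<zeta>. \<integral>\<^sup>+\<xi>. U2 \<zeta> \<xi> \<partial>codebook n M \<partial>codebook n N) \<le> ennreal (V2 / real n + E)"
    proof -
      have "(\<integral>\<^sup>+\<zeta>. \<integral>\<^sup>+\<xi>. U2 \<zeta> \<xi> \<partial>codebook n M \<partial>codebook n N) \<le> ennreal ((\<integral>x. (info_density (H4 ** L2) (H3 ** L1) x - I2)\<^sup>2 \<partial>triple_gauss) / (real n * \<eta>\<^sup>2) + (real N - 1) * exp (- (real n * (I2 - \<eta>))))"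
        unfolding U2_def I2_def by (rule expected_error_le[OF n N M \<eta>])
      also have "\<dots> \<le> ennreal (V2 / real n + E)"
        unfolding V2_def E_def N_def R using num_messages_mult_exp_le[of \<eta> n I2] \<eta>
        by (intro ennreal_leI add_mono) (simp_all add: field_simps)
      finally show ?thesis .
    qed
    have "(\<integral>\<^sup>+\<zeta>. \<integral>\<^sup>+\<xi>. U1 \<xi> \<zeta> + U2 \<zeta> \<xi> \<partial>codebook n M \<partial>codebook n N)
      = (\<integral>\<^sup>+x. U1 (snd x) (fst x) + U2 (fst x) (snd x) \<partial>(codebook n N \<Otimes>\<^sub>M codebook n M))"
      using CM.nn_integral_fst[OF borel_measurable_add[OF U1m U2m]] by simp
    also have "\<dots> = (\<integral>\<^sup>+x. U1 (snd x) (fst x) \<partial>(codebook n N \<Otimes>\<^sub>M codebook n M)) + (\<integral>\<^sup>+x. U2 (fst x) (snd x) \<partial>(codebook n N \<Otimes>\<^sub>M codebook n M))"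
      by (rule nn_integral_add[OF U1m U2m])
    also have "(\<integral>\<^sup>+x. U1 (snd x) (fst x) \<partial>(codebook n N \<Otimes>\<^sub>M codebook n M)) = (\<integral>\<^sup>+\<xi>. \<integral>\<^sup>+\<zeta>. U1 \<xi> \<zeta> \<partial>codebook n N \<partial>codebook n M)"
      using p.nn_integral_snd[of "\<lambda>x. U1 (snd x) (fst x)"] U1m by simp
    also have "(\<integral>\<^sup>+x. U2 (fst x) (snd x) \<partial>(codebook n N \<Otimes>\<^sub>M codebook n M)) = (\<integral>\<^sup>+\<zeta>. \<integral>\<^sup>+\<xi>. U2 \<zeta> \<xi> \<partial>codebook n M \<partial>codebook n N)"
      using CM.nn_integral_fst[OF U2m] by simp
    also have "(\<integral>\<^sup>+\<xi>. \<integral>\<^sup>+\<zeta>. U1 \<xi> \<zeta> \<partial>codebook n N \<partial>codebook n M) + (\<integral>\<^sup>+\<zeta>. \<integral>\<^sup>+\<xi>. U2 \<zeta> \<xi> \<partial>codebook n M \<partial>codebook n N)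
      \<le> ennreal (V1 / real n + E) + ennreal (V2 / real n + E)" by (rule add_mono[OF E1 E2])
    also have "\<dots> = ennreal ((V1 + V2) / real n + 2 * E)"
      using V0 by (simp add: E_def add_divide_distrib algebra_simps flip: ennreal_plus)
    finally have EU: "(\<integral>\<^sup>+\<zeta>. \<integral>\<^sup>+\<xi>. U1 \<xi> \<zeta> + U2 \<zeta> \<xi> \<partial>codebook n M \<partial>codebook n N) \<le> ennreal ((V1 + V2) / real n + 2 * E)" .
    define c where "c = ((V1 + V2 + 1) / real n + 2 * E) / \<delta>\<^sup>2"
    have c: "(V1 + V2) / real n + 2 * E < c * \<delta>\<^sup>2" using \<delta> n by (simp add: c_def divide_strict_right_mono)
    have c0: "0 \<le> (V1 + V2) / real n + 2 * E" using V0 by (simp add: E_def)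
    have cpos: "0 \<le> c" unfolding c_def using V0 by (simp add: E_def)
    note G1 = power_constraint_prob_ge[OF n M \<delta> P(1) tr(1)[unfolded L1]]
    note G2 = power_constraint_prob_ge[OF n N \<delta> P(2) tr(2)[unfolded L2]]
    from exists_good_pair[OF CN.prob_space_axioms CM.prob_space_axioms G2(1) G1(1) G2(2) G1(2) \<delta>(1) EU c0 c]
    obtain \<zeta> \<xi> where z: "\<zeta> \<in> space (codebook n N)" "power_constraint n N P2 (\<lambda>m j. L2 *v \<zeta> m j)"
      and x: "\<xi> \<in> space (codebook n M)" "power_constraint n M P1 (\<lambda>m j. L1 *v \<xi> m j)"
      and U: "U1 \<xi> \<zeta> + U2 \<zeta> \<xi> \<le> ennreal c" by blast
    have sx: "\<xi> m \<in> space (noise_block n)" if "m < M" for m using x(1) that by (auto simp: codebook_def space_PiM)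
    have sz: "\<zeta> l \<in> space (noise_block n)" if "l < N" for l using z(1) that by (auto simp: codebook_def space_PiM)
    define d1 where "d1 = tin_decoder n M (H1 ** L1) (H2 ** L2) (I1 - \<eta>) \<xi>"
    define d2 where "d2 = tin_decoder n N (H4 ** L2) (H3 ** L1) (I2 - \<eta>) \<zeta>"
    have "ennreal (error_prob n M N H1 H2 (\<lambda>m j. L1 *v \<xi> m j) (\<lambda>l j. L2 *v \<zeta> l j) d1) \<le> U1 \<xi> \<zeta>"
      unfolding error_prob_linear_encoder d1_def U1_def by (rule error_prob_tin_decoder_le[OF M N sx sz])
    also have "\<dots> \<le> U1 \<xi> \<zeta> + U2 \<zeta> \<xi>" by simp
    also note U
    finally have e1: "error_prob n M N H1 H2 (\<lambda>m j. L1 *v \<xi> m j) (\<lambda>l j. L2 *v \<zeta> l j) d1 \<le> c"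
      using cpos by (simp add: ennreal_le_iff)
    have "ennreal (error_prob n N M H4 H3 (\<lambda>l j. L2 *v \<zeta> l j) (\<lambda>m j. L1 *v \<xi> m j) d2) \<le> U2 \<zeta> \<xi>"
      unfolding error_prob_linear_encoder d2_def U2_def by (rule error_prob_tin_decoder_le[OF N M sz sx])
    also have "\<dots> \<le> U1 \<xi> \<zeta> + U2 \<zeta> \<xi>" by simp
    also note U
    finally have e2: "error_prob n N M H4 H3 (\<lambda>l j. L2 *v \<zeta> l j) (\<lambda>m j. L1 *v \<xi> m j) d2 \<le> c"
      using cpos by (simp add: ennreal_le_iff)
    have dec: "decoder n M d1" "decoder n N d2"
      unfolding d1_def d2_def by (rule decoder_tin_decoder[OF M sx] decoder_tin_decoder[OF N sz]; assumption)+
    show "\<exists>x w d1 d2. power_constraint n (num_messages n R1) P1 x \<and> power_constraint n (num_messages n R2) P2 w \<and>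
      decoder n (num_messages n R1) d1 \<and> decoder n (num_messages n R2) d2 \<and>
      error_prob n (num_messages n R1) (num_messages n R2) H1 H2 x w d1 \<le> ((V1 + V2 + 1) / real n + 2 * exp (- (real n * \<eta>))) / \<delta>\<^sup>2 \<and>
      error_prob n (num_messages n R2) (num_messages n R1) H4 H3 w x d2 \<le> ((V1 + V2 + 1) / real n + 2 * exp (- (real n * \<eta>))) / \<delta>\<^sup>2"
      unfolding M_def[symmetric] N_def[symmetric] E_def[symmetric] c_def[symmetric]
      using x(2) z(2) dec e1 e2 by blast
  qed
qed

lemma tin_achievable:
  fixes H1 :: "real^'a^'r" and H2 :: "real^'b^'r" and H3 :: "real^'a^'q" and H4 :: "real^'b^'q"
  assumes S: "psd S1" "psd S2" and \<delta>: "0 < \<delta>" "\<delta> < 1" and P: "0 \<le> P1" "0 \<le> P2"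
    and tr: "trace S1 \<le> (1 - \<delta>) * P1" "trace S2 \<le> (1 - \<delta>) * P2" and \<eta>: "0 < \<eta>"
  shows "achievable H1 H2 H3 H4 P1 P2 (max 0 (tin_rate H1 H2 S1 S2 - 2 * \<eta>)) (max 0 (tin_rate H4 H3 S2 S1 - 2 * \<eta>))"
proof -
  define R1 where "R1 = max 0 (tin_rate H1 H2 S1 S2 - 2 * \<eta>)"
  define R2 where "R2 = max 0 (tin_rate H4 H3 S2 S1 - 2 * \<eta>)"
  from random_coding[OF S \<delta> P tr \<eta>, of H1 H2 H4 H3] obtain V where
    V: "\<And>n. 0 < n \<Longrightarrow> \<exists>x w d1 d2. power_constraint n (num_messages n R1) P1 x \<and> power_constraint n (num_messages n R2) P2 w \<and>
      decoder n (num_messages n R1) d1 \<and> decoder n (num_messages n R2) d2 \<and>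
      error_prob n (num_messages n R1) (num_messages n R2) H1 H2 x w d1 \<le> (V / real n + 2 * exp (- (real n * \<eta>))) / \<delta>\<^sup>2 \<and>
      error_prob n (num_messages n R2) (num_messages n R1) H4 H3 w x d2 \<le> (V / real n + 2 * exp (- (real n * \<eta>))) / \<delta>\<^sup>2"
    unfolding R1_def R2_def by blast
  then obtain x w d1 d2 where
    c: "\<And>n. 0 < n \<Longrightarrow> power_constraint n (num_messages n R1) P1 (x n) \<and> power_constraint n (num_messages n R2) P2 (w n) \<and>
      decoder n (num_messages n R1) (d1 n) \<and> decoder n (num_messages n R2) (d2 n) \<and>
      error_prob n (num_messages n R1) (num_messages n R2) H1 H2 (x n) (w n) (d1 n) \<le> (V / real n + 2 * exp (- (real n * \<eta>))) / \<delta>\<^sup>2 \<and>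
      error_prob n (num_messages n R2) (num_messages n R1) H4 H3 (w n) (x n) (d2 n) \<le> (V / real n + 2 * exp (- (real n * \<eta>))) / \<delta>\<^sup>2"
    by metis
  have "(\<lambda>n. exp (- \<eta>) ^ n) \<longlonglongrightarrow> 0" using \<eta> by (intro LIMSEQ_power_zero) simp
  then have "(\<lambda>n. exp (- (real n * \<eta>))) \<longlonglongrightarrow> 0" by (simp add: exp_of_nat_mult[symmetric])
  then have "(\<lambda>n. (V / real n + 2 * exp (- (real n * \<eta>))) / \<delta>\<^sup>2) \<longlonglongrightarrow> (0 + 2 * 0) / \<delta>\<^sup>2"
    using \<delta> by (intro tendsto_intros lim_const_over_n) auto
  then have lim: "(\<lambda>n. (V / real n + 2 * exp (- (real n * \<eta>))) / \<delta>\<^sup>2) \<longlonglongrightarrow> 0" by simp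
  have l1: "(\<lambda>n. error_prob n (num_messages n R1) (num_messages n R2) H1 H2 (x n) (w n) (d1 n)) \<longlonglongrightarrow> 0"
    by (rule tendsto_sandwich[OF _ _ tendsto_const lim])
       (auto intro!: eventually_sequentiallyI[of 1] error_prob_nonneg simp: c)
  have l2: "(\<lambda>n. error_prob n (num_messages n R2) (num_messages n R1) H4 H3 (w n) (x n) (d2 n)) \<longlonglongrightarrow> 0"
    by (rule tendsto_sandwich[OF _ _ tendsto_const lim])
       (auto intro!: eventually_sequentiallyI[of 1] error_prob_nonneg simp: c)
  have "achievable H1 H2 H3 H4 P1 P2 R1 R2"
    unfolding achievable_def using c l1 l2
    by (intro conjI exI[of _ x] exI[of _ w] exI[of _ d1] exI[of _ d2]) (auto simp: R1_def R2_def)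
  then show ?thesis by (simp add: R1_def R2_def)
qed

section \<open>Maximizing over covariances\<close>

lemma continuous_on_matrix_mult [continuous_intros]:
  fixes f :: "'x::topological_space \<Rightarrow> real^'n^'m" and g :: "'x \<Rightarrow> real^'k^'n"
  assumes "continuous_on A f" "continuous_on A g"
  shows "continuous_on A (\<lambda>x. f x ** g x)"
  unfolding matrix_matrix_mult_def by (intro continuous_intros assms)

lemma continuous_on_det [continuous_intros]:
  fixes f :: "'x::topological_space \<Rightarrow> real^'n^'n"
  assumes "continuous_on A f"
  shows "continuous_on A (\<lambda>x. det (f x))"
  unfolding det_def by (intro continuous_intros assms)

text \<open>In the form of \<open>tin_rate_eq\<close> the rate is built from determinants of
  positive definite matrices, so continuity comes from polynomials and from \<open>ln\<close> on
  positive numbers.\<close>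

lemma continuous_on_tin_rate:
  fixes f :: "'x::topological_space \<Rightarrow> real^'t^'t" and g :: "'x \<Rightarrow> real^'s^'s"
  assumes cont: "continuous_on A f" "continuous_on A g" and psd: "\<And>x. x \<in> A \<Longrightarrow> psd (f x)" "\<And>x. x \<in> A \<Longrightarrow> psd (g x)"
  shows "continuous_on A (\<lambda>x. tin_rate G K (f x) (g x))"
proof -
  have W: "posdef (mat 1 + K ** g x ** transpose K)" if "x \<in> A" for x
    by (intro posdef_add_psd posdef_mat_1 psd_congruence psd that)
  have Y: "posdef (mat 1 + K ** g x ** transpose K + G ** f x ** transpose G)" if "x \<in> A" for x
    by (intro posdef_add_psd W psd_congruence psd that)
  have "continuous_on A (\<lambda>x. (ln (det (mat 1 + K ** g x ** transpose K + G ** f x ** transpose G)) - ln (det (mat 1 + K ** g x ** transpose K))) / 2)"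
    using posdef_det_pos[OF W, THEN less_imp_neq] posdef_det_pos[OF Y, THEN less_imp_neq]
    by (intro continuous_intros cont) auto
  then show ?thesis
    by (rule continuous_on_eq) (simp add: tin_rate_eq psd)
qed

text \<open>The conditions are closed. Each diagonal entry lies between 0 and the trace, hence below
  \<open>P\<close>, and \<open>psd_entry_le\<close> carries the bound over to all entries.\<close>

lemma compact_feasible_cov: "compact {S :: real^'t^'t. feasible_cov P S}"
proof -
  have "closed {S :: real^'t^'t. feasible_cov P S}"
  proof -
    have "{S :: real^'t^'t. feasible_cov P S} = {S. transpose S = S} \<inter> (\<Inter>x. {S. 0 \<le> x \<bullet> (S *v x)}) \<inter> {S. trace S \<le> P}"
      by (auto simp: feasible_cov_def psd_def)
    moreover have "closed {S :: real^'t^'t. transpose S = S}"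
      unfolding transpose_def by (intro closed_Collect_eq continuous_intros)
    moreover have "closed {S :: real^'t^'t. 0 \<le> x \<bullet> (S *v x)}" for x
      unfolding matrix_vector_mult_def by (intro closed_Collect_le continuous_intros)
    moreover have "closed {S :: real^'t^'t. trace S \<le> P}"
      unfolding trace_def by (intro closed_Collect_le continuous_intros)
    ultimately show ?thesis by (auto intro!: closed_Int closed_INT)
  qed
  moreover have "bounded {S :: real^'t^'t. feasible_cov P S}"
  proof -
    have "norm S \<le> (\<Sum>i\<in>(UNIV::'t set). \<Sum>j\<in>(UNIV::'t set). P)" if S: "feasible_cov P S" for S :: "real^'t^'t"
    proof -
      have psd: "psd S" using S by (simp add: feasible_cov_def)
      have diag: "0 \<le> S $ i $ i" "S $ i $ i \<le> P" for i
      proof -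
        show "0 \<le> S $ i $ i" by (rule psd_diag_nonneg[OF psd])
        have "S $ i $ i \<le> trace S" unfolding trace_def by (rule member_le_sum) (auto intro: psd_diag_nonneg[OF psd])
        then show "S $ i $ i \<le> P" using S by (simp add: feasible_cov_def)
      qed
      have entry: "\<bar>S $ i $ j\<bar> \<le> P" for i j
      proof -
        have "(S $ i $ j)\<^sup>2 \<le> P * P" using psd_entry_le[OF psd, of i j] mult_mono[OF diag(2)[of i] diag(2)[of j]] diag(1)[of j] order_trans[OF diag]
          by (meson order_trans)
        then show ?thesis using order_trans[OF diag] by (metis abs_le_square_iff abs_of_nonneg power2_eq_square)
      qed
      have "norm S \<le> (\<Sum>i\<in>UNIV. norm (S $ i))" unfolding norm_vec_def by (rule L2_set_le_sum) simp
      also have "\<dots> \<le> (\<Sum>i\<in>UNIV. \<Sum>j\<in>UNIV. \<bar>S $ i $ j\<bar>)" by (intro sum_mono norm_le_l1_cart)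
      also have "\<dots> \<le> (\<Sum>i\<in>(UNIV::'t set). \<Sum>j\<in>(UNIV::'t set). P)" by (intro sum_mono entry)
      finally show ?thesis .
    qed
    then show ?thesis unfolding bounded_iff by auto
  qed
  ultimately show ?thesis by (simp add: compact_eq_bounded_closed)
qed

lemma tin_sum_rate_attains_max:
  fixes H1 :: "real^'a^'r" and H2 :: "real^'b^'r" and H3 :: "real^'a^'q" and H4 :: "real^'b^'q"
  assumes P: "0 \<le> P1" "0 \<le> P2"
  obtains S1 S2 where "feasible_cov P1 S1" "feasible_cov P2 S2"
    "\<And>T1 T2. feasible_cov P1 T1 \<Longrightarrow> feasible_cov P2 T2 \<Longrightarrow> tin_sum_rate H1 H2 H3 H4 T1 T2 \<le> tin_sum_rate H1 H2 H3 H4 S1 S2"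
proof -
  let ?F = "{S. feasible_cov P1 S} \<times> {S. feasible_cov P2 S} :: ((real^'a^'a) \<times> (real^'b^'b)) set"
  have "compact ?F" by (intro compact_Times compact_feasible_cov)
  moreover have "?F \<noteq> {}"
  proof -
    have "(0, 0) \<in> ?F" using P by (simp add: feasible_cov_def psd_0 trace_def)
    then show ?thesis by blast
  qed
  moreover have "continuous_on ?F (\<lambda>p. tin_sum_rate H1 H2 H3 H4 (fst p) (snd p))"
    unfolding tin_sum_rate_def
    by (intro continuous_intros continuous_on_tin_rate) (auto simp: feasible_cov_def)
  ultimately have "\<exists>s\<in>?F. \<forall>t\<in>?F. tin_sum_rate H1 H2 H3 H4 (fst t) (snd t) \<le> tin_sum_rate H1 H2 H3 H4 (fst s) (snd s)"
    by (rule continuous_attains_sup)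
  then obtain s where "s \<in> ?F" "\<forall>t\<in>?F. tin_sum_rate H1 H2 H3 H4 (fst t) (snd t) \<le> tin_sum_rate H1 H2 H3 H4 (fst s) (snd s)"
    by blast
  then show ?thesis by (intro that[of "fst s" "snd s"]) auto
qed

text \<open>Codes exist for the covariances shrunk by \<open>1 - d\<close>, and continuity of the
  rate at \<open>d = 0\<close> recovers the full value up to \<open>e\<close>.\<close>

lemma sum_rate_capacity_ge_tin:
  fixes H1 :: "real^'a^'r" and H2 :: "real^'b^'r" and H3 :: "real^'a^'q" and H4 :: "real^'b^'q"
  assumes P: "0 \<le> P1" "0 \<le> P2" and S: "feasible_cov P1 S1" "feasible_cov P2 S2"
  shows "ereal (tin_sum_rate H1 H2 H3 H4 S1 S2) \<le> sum_rate_capacity H1 H2 H3 H4 P1 P2"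
proof (rule ereal_le_epsilon2)
  fix e :: real assume e: "0 < e"
  \<comment> \<open>Backing off costs \<open>2 * \<eta>\<close> per user, together
    \<open>e / 2\<close>; the other half is left for shrinking the covariances.\<close>
  define \<eta> where "\<eta> = e / 8"
  have \<eta>: "0 < \<eta>" using e by (simp add: \<eta>_def)
  have psd: "psd S1" "psd S2" using S by (simp_all add: feasible_cov_def)
  let ?h = "\<lambda>d. tin_sum_rate H1 H2 H3 H4 ((1 - d) *\<^sub>R S1) ((1 - d) *\<^sub>R S2)"
  have "continuous_on {0..1} ?h"
    unfolding tin_sum_rate_def by (intro continuous_intros continuous_on_tin_rate) (auto intro!: psd_scaleR psd)
  then have "(?h \<longlongrightarrow> ?h 0) (at 0 within {0..1})" unfolding continuous_on_def by (rule bspec) simp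
  then have "eventually (\<lambda>d. dist (?h d) (?h 0) < e / 2) (at 0 within {0..1})" using e by (intro tendstoD) auto
  then obtain r where r: "0 < r" "\<And>d. d \<in> {0..1} \<Longrightarrow> d \<noteq> 0 \<Longrightarrow> dist d 0 < r \<Longrightarrow> dist (?h d) (?h 0) < e / 2"
    unfolding eventually_at by blast
  define d where "d = min (r / 2) (1 / 2)"
  have d: "0 < d" "d < 1" using r(1) by (auto simp: d_def)
  have hd: "\<bar>?h d - tin_sum_rate H1 H2 H3 H4 S1 S2\<bar> < e / 2"
    using r(2)[of d] r(1) d by (auto simp: dist_real_def d_def)
  let ?T1 = "(1 - d) *\<^sub>R S1" and ?T2 = "(1 - d) *\<^sub>R S2"
  define R1 R2 where "R1 = max 0 (tin_rate H1 H2 ?T1 ?T2 - 2 * \<eta>)" and "R2 = max 0 (tin_rate H4 H3 ?T2 ?T1 - 2 * \<eta>)"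
  have "achievable H1 H2 H3 H4 P1 P2 R1 R2"
    unfolding R1_def R2_def
    using S d P \<eta> by (intro tin_achievable[where \<delta> = d] psd_scaleR psd) (auto simp: trace_scaleR feasible_cov_def intro!: mult_left_mono)
  then have "(R1, R2) \<in> capacity_region H1 H2 H3 H4 P1 P2"
    unfolding capacity_region_def using closure_subset by fastforce
  then have "ereal (R1 + R2) \<le> sum_rate_capacity H1 H2 H3 H4 P1 P2"
    unfolding sum_rate_capacity_def by (rule SUP_upper2) simp
  moreover have "tin_sum_rate H1 H2 H3 H4 S1 S2 \<le> R1 + R2 + e"
    using hd unfolding R1_def R2_def tin_sum_rate_def \<eta>_def by linarith
  ultimately show "ereal (tin_sum_rate H1 H2 H3 H4 S1 S2) \<le> sum_rate_capacity H1 H2 H3 H4 P1 P2 + ereal e"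
    by (smt (verit) add_right_mono ereal_less_eq(3) order_trans plus_ereal.simps(1))
qed

lemma sum_rate_capacity_le:
  assumes "\<And>R1 R2. achievable H1 H2 H3 H4 P1 P2 R1 R2 \<Longrightarrow> R1 + R2 \<le> C"
  shows "sum_rate_capacity H1 H2 H3 H4 P1 P2 \<le> ereal C"
proof -
  have "closed {p :: real \<times> real. fst p + snd p \<le> C}" by (intro closed_Collect_le continuous_intros)
  then have "capacity_region H1 H2 H3 H4 P1 P2 \<subseteq> {p. fst p + snd p \<le> C}"
    unfolding capacity_region_def using assms by (intro closure_minimal) auto
  then show ?thesis unfolding sum_rate_capacity_def by (intro SUP_least) auto
qed

theorem theorem2:
  fixes H1 :: "real^'a^'a" and H2 :: "real^'b^'a"
    and H3 :: "real^'a^'b" and H4 :: "real^'b^'b"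
    and P1 P2 :: real
  assumes "invertible H1" and "invertible H4"
    and "0 \<le> P1" and "0 \<le> P2"
    and "\<And>S1 S2. feasible_cov P1 S1 \<Longrightarrow> feasible_cov P2 S2 \<Longrightarrow>
      (\<exists>\<Sigma>1 \<Sigma>2.
         let A1 = genie_matrix H1 H2 H3 S2;
             A2 = genie_matrix H4 H3 H2 S1
         in posdef \<Sigma>1 \<and> posdef \<Sigma>2 \<and>
            \<Sigma>1 \<preceq>\<^sub>L mat 1 - A2 ** matrix_inv \<Sigma>2 ** transpose A2 \<and>
            \<Sigma>2 \<preceq>\<^sub>L mat 1 - A1 ** matrix_inv \<Sigma>1 ** transpose A1)"
  shows "\<exists>S1 S2. feasible_cov P1 S1 \<and> feasible_cov P2 S2 \<and>
      (\<forall>T1 T2. feasible_cov P1 T1 \<longrightarrow> feasible_cov P2 T2 \<longrightarrow>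
         tin_sum_rate H1 H2 H3 H4 T1 T2 \<le> tin_sum_rate H1 H2 H3 H4 S1 S2) \<and>
      sum_rate_capacity H1 H2 H3 H4 P1 P2 = ereal (tin_sum_rate H1 H2 H3 H4 S1 S2)"
proof -
  obtain S1 S2 where S: "feasible_cov P1 S1" "feasible_cov P2 S2"
    and max: "\<And>T1 T2. feasible_cov P1 T1 \<Longrightarrow> feasible_cov P2 T2 \<Longrightarrow>
      tin_sum_rate H1 H2 H3 H4 T1 T2 \<le> tin_sum_rate H1 H2 H3 H4 S1 S2"
    using tin_sum_rate_attains_max[OF assms(3,4)] by metis
  have "sum_rate_capacity H1 H2 H3 H4 P1 P2 \<le> ereal (tin_sum_rate H1 H2 H3 H4 S1 S2)"
    by (rule sum_rate_capacity_le) (rule achievable_sum_rate_le[OF assms(1,2,5) max])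
  moreover have "ereal (tin_sum_rate H1 H2 H3 H4 S1 S2) \<le> sum_rate_capacity H1 H2 H3 H4 P1 P2"
    by (rule sum_rate_capacity_ge_tin[OF assms(3,4) S])
  ultimately show ?thesis using S max by (intro exI[of _ S1] exI[of _ S2]) (auto intro: antisym)
qed

end
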